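(* Let $n\ge4$, and let $\Lambda_0,\dots,\Lambda_n$ be the fundamental weights and $\alpha_0,\dots,\alpha_n$ the simple roots of $D_n^{(1)}$. Let $\delta=\alpha_0+\alpha_1+2\alpha_2+\cdots+2\alpha_{n-2}+\alpha_{n-1}+\alpha_n$ be the null root. Set $q=e^{-\delta/2}$, and $$c_i=e^{\alpha_i+\cdots+\alpha_{n-2}+\alpha_{n-1}/2+\alpha_n/2}\ \text{ for } i\in\{1,\dots,n-1\}\ (\text{so } c_{n-1}=e^{\alpha_{n-1}/2+\alpha_n/2}),\qquad c_n=e^{\alpha_n/2-\alpha_{n-1}/2}.$$ Then $$e^{-\Lambda_0}\mathrm{ch}(L(\Lambda_0))=\mathcal E_{c_1,\dots,c_n}\Big(\prod_{k=1}^n(-c_kq;q^2)_\infty(-c_k^{-1}q;q^2)_\infty\Big),$$ $$e^{-\Lambda_1}\mathrm{ch}(L(\Lambda_1))=\mathcal E_{c_1,\dots,c_n}\Big((-c_1q^3;q^2)_\infty(-c_1^{-1}q^{-1};q^2)_\infty\prod_{k=2}^n(-c_kq;q^2)_\infty(-c_k^{-1}q;q^2)_\infty\Big),$$ $$e^{-\Lambda_{n-1}}\mathrm{ch}(L(\Lambda_{n-1}))=\mathcal E_{c_1,\dots,c_n}\Big((-c_n;q^2)_\infty(-c_n^{-1}q^2;q^2)_\infty\prod_{k=1}^{n-1}(-c_kq^2;q^2)_\infty(-c_k^{-1};q^2)_\infty\Big),$$ $$e^{-\Lambda_n}\mathrm{ch}(L(\Lambda_n))=\mathcal E_{c_1,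\dots,c_n}\Big((-c_nq^2;q^2)_\infty(-c_n^{-1};q^2)_\infty\prod_{k=1}^{n-1}(-c_kq^2;q^2)_\infty(-c_k^{-1};q^2)_\infty\Big).$$
   Context: $L(\lambda)$ denotes the irreducible highest weight module of highest weight $\lambda$ over the affine Kac--Moody algebra, and $\mathrm{ch}(L(\lambda))=\sum_\mu\dim L(\lambda)_\mu\,e^\mu$, where $e^\mu$ are formal exponentials with $e^\mu e^\nu=e^{\mu+\nu}$ (rational combinations of roots allowed in exponents). $(a;q)_\infty=\prod_{k\ge0}(1-aq^k)$. Labelling of $D_n^{(1)}$ ($n\ge 4$): simply laced; nodes $0$ and $1$ are both joined to node $2$, nodes $2,3,\dots,n-2$ form a chain, and nodes $n-1$ and $n$ are both joined to node $n-2$. For a (Laurent-type) power series $G=G(x_1,\dots,x_m)$ and $k\le m$, $\mathcal E_{x_1,\dots,x_k}(G)$ is the sub-series of $G$ consisting of the terms in which the sum of the powers of $x_1,\dots,x_k$ is even; equivalently $\mathcal E_{x_1,\dots,x_k}(G)=\frac12\big(G(x_1,\dots,x_k,x_{k+1},\dots,x_m)+G(-x_1,\dots,-x_k,x_{k+1},\dots,x_m)\big)$. Here $c_1,\dots,c_n,q$ are treated as independent variables when applying $\mathcal E_{c_1,\dots,c_n}$. *)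

theory Defs
  imports
    Complex_Main
    "HOL-Library.Function_Algebras"
    "HOL-Library.Poly_Mapping"
    "HOL-Computational_Algebra.Formal_Laurent_Series"
begin

section \<open>Complex Lie algebras and their modules\<close>

locale lie_algebra = vector_space scale
  for scale :: "complex \<Rightarrow> 'g::ab_group_add \<Rightarrow> 'g" +
  fixes bracket :: "'g \<Rightarrow> 'g \<Rightarrow> 'g"
  assumes bracket_add_left: "bracket (x + y) z = bracket x z + bracket y z"
    and bracket_add_right: "bracket x (y + z) = bracket x y + bracket x z"
    and bracket_scale_left: "bracket (scale c x) y = scale c (bracket x y)"
    and bracket_scale_right: "bracket x (scale c y) = scale c (bracket x y)"
    and bracket_self: "bracket x x = 0"
    and jacobi: "bracket x (bracket y z) + bracket y (bracket z x) + bracket z (bracket x y) = 0"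
begin

definition lie_subalgebra :: "'g set \<Rightarrow> bool" where
  "lie_subalgebra S \<longleftrightarrow> subspace S \<and> (\<forall>x\<in>S. \<forall>y\<in>S. bracket x y \<in> S)"

definition lie_ideal :: "'g set \<Rightarrow> bool" where
  "lie_ideal J \<longleftrightarrow> subspace J \<and> (\<forall>x. \<forall>y\<in>J. bracket x y \<in> J)"

text \<open>
  A functional on a subspace \<open>H\<close> is represented by its extension by zero to the whole Lie algebra;
  equality of functions is then equality of functionals.
\<close>

definition dual_on :: "'g set \<Rightarrow> ('g \<Rightarrow> complex) set" where
  "dual_on H = {\<mu>. (\<forall>x\<in>H. \<forall>y\<in>H. \<mu> (x + y) = \<mu> x + \<mu> y) \<and>
                   (\<forall>c. \<forall>x\<in>H. \<mu> (scale c x) = c * \<mu> x) \<and>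
                   (\<forall>x. x \<notin> H \<longrightarrow> \<mu> x = 0)}"

end

locale lie_module = lie_algebra scale bracket + V: vector_space scaleV
  for scale :: "complex \<Rightarrow> 'g::ab_group_add \<Rightarrow> 'g"
    and bracket :: "'g \<Rightarrow> 'g \<Rightarrow> 'g"
    and scaleV :: "complex \<Rightarrow> 'v::ab_group_add \<Rightarrow> 'v" +
  fixes act :: "'g \<Rightarrow> 'v \<Rightarrow> 'v"
  assumes act_add_left: "act (x + y) v = act x v + act y v"
    and act_add_right: "act x (v + w) = act x v + act x w"
    and act_scale_left: "act (scale c x) v = scaleV c (act x v)"
    and act_scale_right: "act x (scaleV c v) = scaleV c (act x v)"
    and act_bracket: "act (bracket x y) v = act x (act y v) - act y (act x v)"
begin

definition submodule :: "'v set \<Rightarrow> bool" where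
  "submodule W \<longleftrightarrow> V.subspace W \<and> (\<forall>x. \<forall>w\<in>W. act x w \<in> W)"

definition irreducible_module :: bool where
  "irreducible_module \<longleftrightarrow> (\<exists>v::'v. v \<noteq> 0) \<and> (\<forall>W. submodule W \<longrightarrow> W = {0} \<or> W = UNIV)"

end


section \<open>Kac--Moody algebras\<close>

definition matrix_rank :: "'i set \<Rightarrow> ('i \<Rightarrow> 'i \<Rightarrow> int) \<Rightarrow> nat" where
  "matrix_rank I A =
    vector_space.dim (\<lambda>(c::complex) (v::'i \<Rightarrow> complex) j. c * v j)
      ((\<lambda>i j. if j \<in> I then of_int (A i j) else 0) ` I)"

text \<open>
  The Lie algebra \<open>\<gg>(A)\<close> with its Cartan subalgebra, Chevalley generators, simple coroots and
  simple roots, in Kac's intrinsic form (Infinite dimensional Lie algebras, Prop. 1.4): these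
  conditions determine the tuple up to isomorphism.
\<close>

locale kac_moody_algebra = lie_algebra scale bracket
  for scale :: "complex \<Rightarrow> 'g::ab_group_add \<Rightarrow> 'g"
    and bracket :: "'g \<Rightarrow> 'g \<Rightarrow> 'g" +
  fixes I :: "'i set"
    and A :: "'i \<Rightarrow> 'i \<Rightarrow> int"
    and cartan :: "'g set"
    and e f coroot :: "'i \<Rightarrow> 'g"
    and root :: "'i \<Rightarrow> 'g \<Rightarrow> complex"
  assumes finite_I: "finite I"
    and cartan_subspace: "subspace cartan"
    and cartan_commutative: "x \<in> cartan \<Longrightarrow> y \<in> cartan \<Longrightarrow> bracket x y = 0"
    and coroot_in_cartan: "i \<in> I \<Longrightarrow> coroot i \<in> cartan"
    and root_in_dual: "i \<in> I \<Longrightarrow> root i \<in> dual_on cartan"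
    and coroots_independent: "(\<Sum>i\<in>I. scale (c i) (coroot i)) = 0 \<Longrightarrow> i \<in> I \<Longrightarrow> c i = 0"
    and roots_independent:
      "(\<forall>x. (\<Sum>i\<in>I. c i * root i x) = 0) \<Longrightarrow> i \<in> I \<Longrightarrow> c i = 0"
    and root_coroot: "i \<in> I \<Longrightarrow> j \<in> I \<Longrightarrow> root j (coroot i) = of_int (A i j)"
    and dim_cartan: "dim cartan = 2 * card I - matrix_rank I A"
    and bracket_e_f: "i \<in> I \<Longrightarrow> j \<in> I \<Longrightarrow> bracket (e i) (f j) = (if i = j then coroot i else 0)"
    and bracket_cartan_e: "x \<in> cartan \<Longrightarrow> i \<in> I \<Longrightarrow> bracket x (e i) = scale (root i x) (e i)"
    and bracket_cartan_f: "x \<in> cartan \<Longrightarrow> i \<in> I \<Longrightarrow> bracket x (f i) = scale (- root i x) (f i)"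
    and generated: "lie_subalgebra hull (e ` I \<union> f ` I \<union> cartan) = UNIV"
    and no_ideal: "lie_ideal J \<Longrightarrow> J \<inter> cartan = {0} \<Longrightarrow> J = {0}"
begin

definition n_plus :: "'g set" where
  "n_plus = lie_subalgebra hull (e ` I)"

text \<open>
  This determines each fundamental weight up to a functional vanishing on all simple coroots
  (for affine algebras: up to a multiple of the null root); any choice is allowed.
\<close>

definition fundamental_weights :: "('i \<Rightarrow> 'g \<Rightarrow> complex) \<Rightarrow> bool" where
  "fundamental_weights \<Lambda> \<longleftrightarrow>
    (\<forall>i\<in>I. \<Lambda> i \<in> dual_on cartan \<and> (\<forall>j\<in>I. \<Lambda> i (coroot j) = (if i = j then 1 else 0)))"

end

locale kac_moody_module =
  kac_moody_algebra scale bracket I A cartan e f coroot root +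
  lie_module scale bracket scaleV act
  for scale :: "complex \<Rightarrow> 'g::ab_group_add \<Rightarrow> 'g"
    and bracket :: "'g \<Rightarrow> 'g \<Rightarrow> 'g"
    and I :: "'i set"
    and A :: "'i \<Rightarrow> 'i \<Rightarrow> int"
    and cartan :: "'g set"
    and e f coroot :: "'i \<Rightarrow> 'g"
    and root :: "'i \<Rightarrow> 'g \<Rightarrow> complex"
    and scaleV :: "complex \<Rightarrow> 'v::ab_group_add \<Rightarrow> 'v"
    and act :: "'g \<Rightarrow> 'v \<Rightarrow> 'v"
begin

definition weight_space :: "('g \<Rightarrow> complex) \<Rightarrow> 'v set" where
  "weight_space \<mu> = {v. \<forall>x\<in>cartan. act x v = scaleV (\<mu> x) v}"

definition highest_weight_module :: "('g \<Rightarrow> complex) \<Rightarrow> bool" where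
  "highest_weight_module hw \<longleftrightarrow> hw \<in> dual_on cartan \<and>
    (\<exists>v. v \<noteq> 0 \<and> (\<forall>x\<in>n_plus. act x v = 0) \<and> v \<in> weight_space hw \<and>
         (\<forall>W. submodule W \<and> v \<in> W \<longrightarrow> W = UNIV))"

text \<open>
  A formal sum of exponentials \<open>e\<^sup>\<mu>\<close> is represented by its coefficient function
  \<open>\<mu> \<mapsto> coefficient of e\<^sup>\<mu>\<close>, supported on the dual of the Cartan subalgebra.  The weight spaces of
  a highest weight module are finite-dimensional, so the convention that \<open>V.dim\<close> is \<open>0\<close> on
  infinite-dimensional spaces plays no role.
\<close>

definition ch :: "('g \<Rightarrow> complex) \<Rightarrow> int" where
  "ch \<mu> = (if \<mu> \<in> dual_on cartan then int (V.dim (weight_space \<mu>)) else 0)"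

end

text \<open>A model of \<open>L(\<lambda>)\<close>; it is unique up to isomorphism.\<close>

locale irreducible_highest_weight_module =
  kac_moody_module scale bracket I A cartan e f coroot root scaleV act
  for scale :: "complex \<Rightarrow> 'g::ab_group_add \<Rightarrow> 'g"
    and bracket :: "'g \<Rightarrow> 'g \<Rightarrow> 'g"
    and I :: "'i set"
    and A :: "'i \<Rightarrow> 'i \<Rightarrow> int"
    and cartan :: "'g set"
    and e f coroot :: "'i \<Rightarrow> 'g"
    and root :: "'i \<Rightarrow> 'g \<Rightarrow> complex"
    and scaleV :: "complex \<Rightarrow> 'v::ab_group_add \<Rightarrow> 'v"
    and act :: "'g \<Rightarrow> 'v \<Rightarrow> 'v" +
  fixes hw :: "'g \<Rightarrow> complex"
  assumes irreducible: "irreducible_module"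
    and highest_weight: "highest_weight_module hw"

text \<open>Multiplication of a formal sum of exponentials by \<open>e\<^sup>\<nu>\<close>.\<close>

definition exp_times :: "('g \<Rightarrow> complex) \<Rightarrow> (('g \<Rightarrow> complex) \<Rightarrow> int) \<Rightarrow> ('g \<Rightarrow> complex) \<Rightarrow> int" where
  "exp_times \<nu> X = (\<lambda>\<mu>. X (\<mu> - \<nu>))"


section \<open>Type \<open>D\<^sub>n\<^sup>(\<^sup>1\<^sup>)\<close>\<close>

definition D1_edge :: "nat \<Rightarrow> nat \<Rightarrow> nat \<Rightarrow> bool" where
  "D1_edge n i j \<longleftrightarrow>
    (i = 0 \<and> j = 2) \<or> (i = 1 \<and> j = 2) \<or> (2 \<le> i \<and> j = i + 1 \<and> j \<le> n - 2) \<or>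
    (i = n - 2 \<and> j = n - 1) \<or> (i = n - 2 \<and> j = n)"

definition D1_cartan_matrix :: "nat \<Rightarrow> nat \<Rightarrow> nat \<Rightarrow> int" where
  "D1_cartan_matrix n i j =
    (if i = j then 2 else if D1_edge n i j \<or> D1_edge n j i then -1 else 0)"

definition null_root :: "nat \<Rightarrow> (nat \<Rightarrow> 'g \<Rightarrow> complex) \<Rightarrow> 'g \<Rightarrow> complex" where
  "null_root n \<alpha> x = \<alpha> 0 x + \<alpha> 1 x + (\<Sum>i=2..n-2. 2 * \<alpha> i x) + \<alpha> (n - 1) x + \<alpha> n x"

text \<open>The exponents of \<open>q\<close> and of \<open>c\<^sub>1, \<dots>, c\<^sub>n\<close>.\<close>

definition q_exponent :: "nat \<Rightarrow> (nat \<Rightarrow> 'g \<Rightarrow> complex) \<Rightarrow> 'g \<Rightarrow> complex" where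
  "q_exponent n \<alpha> x = - null_root n \<alpha> x / 2"

definition c_exponent :: "nat \<Rightarrow> (nat \<Rightarrow> 'g \<Rightarrow> complex) \<Rightarrow> nat \<Rightarrow> 'g \<Rightarrow> complex" where
  "c_exponent n \<alpha> k x =
    (if k = n then \<alpha> n x / 2 - \<alpha> (n - 1) x / 2
     else (\<Sum>i=k..n-2. \<alpha> i x) + \<alpha> (n - 1) x / 2 + \<alpha> n x / 2)"


section \<open>Series in \<open>q\<close> over Laurent polynomials in \<open>c\<^sub>k\<close>\<close>

text \<open>
  Formal Laurent series in \<open>q\<close> whose coefficients are Laurent polynomials in commuting variables
  \<open>c\<^sub>k\<close>; an exponent vector is a finitely supported map from variable indices to \<open>int\<close>.
\<close>

type_synonym series = "((nat \<Rightarrow>\<^sub>0 int) \<Rightarrow>\<^sub>0 int) fls"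

abbreviation q_var :: series where
  "q_var \<equiv> fls_X"

abbreviation q_var_inv :: series where
  "q_var_inv \<equiv> fls_X_inv"

definition c_var :: "nat \<Rightarrow> series" where
  "c_var k = fls_const (Poly_Mapping.single (Poly_Mapping.single k 1) 1)"

definition c_var_inv :: "nat \<Rightarrow> series" where
  "c_var_inv k = fls_const (Poly_Mapping.single (Poly_Mapping.single k (-1)) 1)"

text \<open>
  The symbol \<open>(a;r)\<^sub>\<infinity>\<close>.  The limit is taken in the \<open>q\<close>-adic metric of \<^typ>\<open>'a fls\<close>; it exists
  whenever \<open>r\<close> is divisible by \<open>q\<close>.
\<close>

definition qpochhammer_inf :: "series \<Rightarrow> series \<Rightarrow> series" where
  "qpochhammer_inf a r = lim (\<lambda>N. \<Prod>k<N. 1 - a * r ^ k)"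

text \<open>The operator \<open>\<E>\<close> for the variables \<open>c\<^sub>k\<close>, \<open>k \<in> K\<close>, on coefficients and on series.\<close>

lift_definition even_part_coeff :: "nat set \<Rightarrow> ((nat \<Rightarrow>\<^sub>0 int) \<Rightarrow>\<^sub>0 int) \<Rightarrow> ((nat \<Rightarrow>\<^sub>0 int) \<Rightarrow>\<^sub>0 int)" is
  "\<lambda>K p a. if even (\<Sum>k\<in>K. Poly_Mapping.lookup a k) then p a else 0"
  by (rule finite_subset) auto

lemma even_part_coeff_0 [simp]: "even_part_coeff K 0 = 0"
  by transfer auto

lift_definition even_part :: "nat set \<Rightarrow> series \<Rightarrow> series" is
  "\<lambda>K G b. even_part_coeff K (G b)"
  by (auto elim: eventually_mono)

text \<open>
  The formal sum of exponentials obtained from a series by \<open>c\<^sub>k = e\<^bsup>\<gamma> k\<^esup>\<close> and \<open>q = e\<^sup>\<beta>\<close>.  The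
  coefficient of \<open>e\<^sup>\<mu>\<close> is the sum of the coefficients of all monomials with exponent \<open>\<mu>\<close>; for
  linearly independent exponents \<open>\<gamma> k\<close> and \<open>\<beta>\<close> there is at most one such monomial.
\<close>

definition monomial_exponent ::
    "(nat \<Rightarrow> 'g \<Rightarrow> complex) \<Rightarrow> ('g \<Rightarrow> complex) \<Rightarrow> (nat \<Rightarrow>\<^sub>0 int) \<Rightarrow> int \<Rightarrow> 'g \<Rightarrow> complex" where
  "monomial_exponent \<gamma> \<beta> a b x =
    (\<Sum>k\<in>Poly_Mapping.keys a. of_int (Poly_Mapping.lookup a k) * \<gamma> k x) + of_int b * \<beta> x"

definition to_exponentials ::
    "(nat \<Rightarrow> 'g \<Rightarrow> complex) \<Rightarrow> ('g \<Rightarrow> complex) \<Rightarrow> series \<Rightarrow> ('g \<Rightarrow> complex) \<Rightarrow> int" where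
  "to_exponentials \<gamma> \<beta> G \<mu> =
    (\<Sum>(a, b) \<in> {(a, b). Poly_Mapping.lookup (fls_nth G b) a \<noteq> 0 \<and> monomial_exponent \<gamma> \<beta> a b = \<mu>}.
       Poly_Mapping.lookup (fls_nth G b) a)"

end

theory Submission
  imports Defs "HOL-Library.FSet" "HOL-Library.Product_Lexorder" "HOL-Library.Groups_Big_Fun"
begin

text \<open>
  Expanding the product and taking its even part counts finite sets of modes, an even number each,
  of \<open>n\<close> charged fermions; these sets form a basis of the even part \<open>F\<close> of a fermionic Fock space.
  Quadratic expressions in the fermions yield operators \<open>E\<^sub>i\<close>, \<open>F\<^sub>i\<close> and a weight grading
  on \<open>F\<close> satisfying the defining relations of the algebra apart from the Serre relations.
  Pairing the vacuum with a highest weight vector of \<open>L(\<Lambda>)\<close> and closing under the \<open>F\<^sub>i\<close> gives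
  the graph of a weight preserving isomorphism, as soon as \<open>F\<close> is generated by the vacuum and the
  contravariant form on \<open>F\<close> detects every vector.
  Since this form is positive definite and contravariant, both properties follow once every vector of
  \<open>F\<close> killed by all \<open>E\<^sub>i\<close> is a multiple of the vacuum. Such a vector has dominant weight by
  positivity, hence vanishing charges, and it is killed by the positive Heisenberg modes, which the
  \<open>E\<^sub>i\<close> generate; the bosonic expression for the energy then shows that its energy is zero.
\<close>

text \<open>The four modules share one argument because they differ only in the sector and in which
  modes the vacuum already contains. L(\<Lambda>_1) is the odd part of the Neveu-Schwarz space, and
  L(\<Lambda>_(n-1)) the odd part of the Ramond space built for \<Lambda>_n. Filling one more mode
  turns an odd part into an even one; this is the source of the factors beginning at q^3 and q^(-1),
  and of the interchange of the two factors of c_n. No action of the whole Kac-Moody algebra on F is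
  available at the start, hence no homomorphism. This is why the comparison goes through a relation
  generated by lowering operators, which is controlled by [E_i, F_j] and weights alone. Two
  restrictions exclude further singular vectors. At level one, dominance leaves only the charges of
  the vacuum and those of its partner at the neighbouring end node, which have the opposite parity.
  At charge zero, the identity (sum over m > 0 of h(-m) h(m)) = energy - charge^2 / 2 is used for
  each index k separately. It is derived from commutators with a single fermion, so that neither a
  bosonic space nor vertex operators are introduced.\<close>

abbreviation "lookup \<equiv> Poly_Mapping.lookup"
abbreviation "single \<equiv> Poly_Mapping.single"
abbreviation "keys \<equiv> Poly_Mapping.keys"

section \<open>Fermionic Fock space\<close>

lift_definition pscale :: "complex \<Rightarrow> ('s \<Rightarrow>\<^sub>0 complex) \<Rightarrow> ('s \<Rightarrow>\<^sub>0 complex)" is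
  "\<lambda>c x S. c * x S"
  by (rule finite_subset) auto

lift_definition diagop :: "('s \<Rightarrow> complex) \<Rightarrow> ('s \<Rightarrow>\<^sub>0 complex) \<Rightarrow> ('s \<Rightarrow>\<^sub>0 complex)" is
  "\<lambda>d x S. d S * x S"
  by (rule finite_subset) auto

lemmas lookup_pscale [simp] = pscale.rep_eq
lemmas lookup_diagop [simp] = diagop.rep_eq

lemma poly_mapping_vector_space: "vector_space (pscale :: complex \<Rightarrow> ('s \<Rightarrow>\<^sub>0 complex) \<Rightarrow> _)"
  by unfold_locales (auto intro!: poly_mapping_eqI simp: lookup_add algebra_simps)

interpretation F: vector_space "pscale :: complex \<Rightarrow> ('s \<Rightarrow>\<^sub>0 complex) \<Rightarrow> _"
  by (rule poly_mapping_vector_space)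

lemma poly_mapping_sum_single:
  "x = (\<Sum>S\<in>keys x. single S (lookup x S))"
proof (rule poly_mapping_eqI)
  fix S
  show "lookup x S =
      lookup (\<Sum>S\<in>keys x. single S (lookup x S)) S"
    by (cases "S \<in> keys x")
      (auto simp: Poly_Mapping.lookup_sum lookup_single when_def sum.delta in_keys_iff)
qed

text \<open>The colours \<open>(k, True)\<close> and \<open>(k, False)\<close> stand for the weights \<open>\<epsilon>\<^sub>k\<close> and \<open>- \<epsilon>\<^sub>k\<close>.\<close>

type_synonym colour = "nat \<times> bool"
type_synonym mode = "colour \<times> int"
type_synonym state = "mode fset"
type_synonym fock = "state \<Rightarrow>\<^sub>0 complex"

definition bar :: "colour \<Rightarrow> colour" where
  "bar a = (fst a, \<not> snd a)"

lemma bar_bar [simp]: "bar (bar a) = a"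
  by (simp add: bar_def)

lemma bar_neq [simp]: "bar a \<noteq> a" "a \<noteq> bar a"
  by (auto simp: bar_def prod_eq_iff)

lemma bar_inject [simp]: "bar a = bar b \<longleftrightarrow> a = b"
  by (auto simp: bar_def prod_eq_iff)

lemma fst_bar [simp]: "fst (bar a) = fst a"
  by (simp add: bar_def)

lemma bar_Pair [simp]: "bar (k, s) = (k, \<not> s)"
  by (simp add: bar_def)

text \<open>
  \<open>cr u\<close> and \<open>an u\<close> create and annihilate the mode \<open>u\<close>; \<open>sg u S\<close> is the sign of moving \<open>u\<close> past the
  smaller modes of \<open>S\<close>.
\<close>

definition sg :: "mode \<Rightarrow> state \<Rightarrow> complex" where
  "sg u S = (- 1) ^ card {y \<in> fset S. y < u}"

lemma sg_sg [simp]: "sg u S * sg u S = 1"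
  by (simp add: sg_def flip: power_mult_distrib)

lemma sg_sg' [simp]: "sg u S * (sg u S * z) = z"
  by (simp flip: mult.assoc)

lemma cnj_sg [simp]: "cnj (sg u S) = sg u S"
  by (simp add: sg_def)

lemma sg_finsert:
  "sg u (finsert v S) = (if v < u \<and> v |\<notin>| S then - sg u S else sg u S)"
proof -
  have "{y \<in> fset (finsert v S). y < u} =
      (if v < u then insert v {y \<in> fset S. y < u} else {y \<in> fset S. y < u})"
    by auto
  then show ?thesis
    by (auto simp: sg_def insert_absorb)
qed

lemma sg_fminus:
  "sg u (S |-| {|v|}) = (if v < u \<and> v |\<in>| S then - sg u S else sg u S)"
  using sg_finsert[of u v "S |-| {|v|}"] by (cases "v |\<in>| S") (auto simp: finsert_absorb)

lift_definition cr :: "mode \<Rightarrow> fock \<Rightarrow> fock" is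
  "\<lambda>u x S. if u |\<in>| S then sg u S * x (S |-| {|u|}) else 0"
proof -
  fix u :: mode and x :: "state \<Rightarrow> complex"
  assume "finite {S. x S \<noteq> 0}"
  moreover have "{S. (if u |\<in>| S then sg u S * x (S |-| {|u|}) else 0) \<noteq> 0} \<subseteq> finsert u ` {S. x S \<noteq> 0}"
  proof
    fix S assume "S \<in> {S. (if u |\<in>| S then sg u S * x (S |-| {|u|}) else 0) \<noteq> 0}"
    then have "u |\<in>| S" "x (S |-| {|u|}) \<noteq> 0" by (auto split: if_splits)
    then show "S \<in> finsert u ` {S. x S \<noteq> 0}"
      by (intro image_eqI[of _ _ "S |-| {|u|}"]) auto
  qed
  ultimately show "finite {S. (if u |\<in>| S then sg u S * x (S |-| {|u|}) else 0) \<noteq> 0}"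
    by (rule rev_finite_subset[OF finite_imageI])
qed

lift_definition an :: "mode \<Rightarrow> fock \<Rightarrow> fock" is
  "\<lambda>u x S. if u |\<in>| S then 0 else sg u S * x (finsert u S)"
proof -
  fix u :: mode and x :: "state \<Rightarrow> complex"
  assume "finite {S. x S \<noteq> 0}"
  moreover have "{S. (if u |\<in>| S then 0 else sg u S * x (finsert u S)) \<noteq> 0} \<subseteq> (\<lambda>S. S |-| {|u|}) ` {S. x S \<noteq> 0}"
  proof
    fix S assume "S \<in> {S. (if u |\<in>| S then 0 else sg u S * x (finsert u S)) \<noteq> 0}"
    then have "u |\<notin>| S" "x (finsert u S) \<noteq> 0" by (auto split: if_splits)
    then show "S \<in> (\<lambda>S. S |-| {|u|}) ` {S. x S \<noteq> 0}"
      by (intro image_eqI[of _ _ "finsert u S"]) auto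
  qed
  ultimately show "finite {S. (if u |\<in>| S then 0 else sg u S * x (finsert u S)) \<noteq> 0}"
    by (rule rev_finite_subset[OF finite_imageI])
qed

lemmas lookup_cr = cr.rep_eq
lemmas lookup_an = an.rep_eq

text \<open>For \<open>u \<noteq> v\<close>, inserting or removing the smaller mode changes the sign
  attached to the larger one but not conversely, so the two orders differ by exactly one sign. The
  same count gives the next two relations.\<close>

lemma cr_cr: "cr u (cr v x) + cr v (cr u x) = 0"
proof (rule poly_mapping_eqI)
  fix S
  consider "u = v" | "u < v" | "v < u" by force
  then show "lookup (cr u (cr v x) + cr v (cr u x)) S = lookup 0 S"
    by cases (auto simp: lookup_add lookup_cr sg_fminus finsert_commute
        algebra_simps intro: arg_cong)
qed

lemma an_an: "an u (an v x) + an v (an u x) = 0"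
proof (rule poly_mapping_eqI)
  fix S
  consider "u = v" | "u < v" | "v < u" by force
  then show "lookup (an u (an v x) + an v (an u x)) S = lookup 0 S"
    by cases (auto simp: lookup_add lookup_an sg_finsert finsert_commute algebra_simps)
qed

lemma finsert_fminus_swap: "u \<noteq> v \<Longrightarrow> finsert v S |-| {|u|} = finsert v (S |-| {|u|})"
  by auto

lemma cr_an: "cr u (an v x) + an v (cr u x) = (if u = v then x else 0)"
proof (rule poly_mapping_eqI)
  fix S
  consider "u = v" | "u < v" | "v < u" by force
  then show "lookup (cr u (an v x) + an v (cr u x)) S = lookup (if u = v then x else 0) S"
    by cases (auto simp: lookup_add lookup_cr lookup_an sg_finsert sg_fminus finsert_fminus_swap
        finsert_absorb algebra_simps)
qed

section \<open>Additive operators and finitely supported sums\<close>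

definition additive_op :: "('a::ab_group_add \<Rightarrow> 'b::ab_group_add) \<Rightarrow> bool" where
  "additive_op T \<longleftrightarrow> (\<forall>x y. T (x + y) = T x + T y)"

lemma additive_opI: "(\<And>x y. T (x + y) = T x + T y) \<Longrightarrow> additive_op T"
  by (simp add: additive_op_def)

lemma additive_op_add: "additive_op T \<Longrightarrow> T (x + y) = T x + T y"
  by (simp add: additive_op_def)

lemma additive_op_zero: "additive_op T \<Longrightarrow> T 0 = 0"
  using additive_op_add[of T 0 0] by simp

lemma additive_op_minus: "additive_op T \<Longrightarrow> T (- x) = - T x"
  using additive_op_add[of T x "- x"] additive_op_zero[of T] by (simp add: eq_neg_iff_add_eq_0 add.commute)

lemma additive_op_diff: "additive_op T \<Longrightarrow> T (x - y) = T x - T y"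
  using additive_op_add[of T x "- y"] additive_op_minus[of T y] by simp

lemma additive_op_sum: "additive_op T \<Longrightarrow> T (sum g A) = (\<Sum>i\<in>A. T (g i))"
  by (induction A rule: infinite_finite_induct) (simp_all add: additive_op_zero additive_op_add)

text \<open>Additivity is the common denominator of the maps moved through sums below: linear
  operators, single coefficients, the form \<open>hin\<close>, which is conjugate-linear in its
  second argument, and maps from the integers to the complex numbers.\<close>

lemma additive_op_Sum_any:
  assumes "additive_op T" and fin: "finite {r. g r \<noteq> 0}"
  shows "T (Sum_any g) = Sum_any (\<lambda>r. T (g r))"
proof -
  have "{r. T (g r) \<noteq> 0} \<subseteq> {r. g r \<noteq> 0}"
    using additive_op_zero[OF assms(1)] by auto
  from Sum_any.expand_superset[OF fin this] show ?thesis
    by (simp add: Sum_any.expand_set additive_op_sum[OF assms(1)])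
qed

lemma Sum_any_diff:
  fixes g h :: "'b \<Rightarrow> 'a::ab_group_add"
  assumes "finite {r. g r \<noteq> 0}" "finite {r. h r \<noteq> 0}"
  shows "Sum_any (\<lambda>r. g r - h r) = Sum_any g - Sum_any h"
proof -
  have "Sum_any (\<lambda>r. g r + (- h r)) = Sum_any g + Sum_any (\<lambda>r. - h r)"
    using assms by (intro Sum_any.distrib) auto
  also have "Sum_any (\<lambda>r. - h r) = - Sum_any h"
    using additive_op_Sum_any[of uminus h] assms by (simp add: additive_op_def)
  finally show ?thesis by simp
qed

lemma finite_neq_add:
  fixes g h :: "'b \<Rightarrow> 'a::ab_group_add"
  shows "finite {r. g r \<noteq> 0} \<Longrightarrow> finite {r. h r \<noteq> 0} \<Longrightarrow> finite {r. g r + h r \<noteq> 0}"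
    and "finite {r. g r \<noteq> 0} \<Longrightarrow> finite {r. h r \<noteq> 0} \<Longrightarrow> finite {r. g r - h r \<noteq> 0}"
  by (rule finite_subset[of _ "{r. g r \<noteq> 0} \<union> {r. h r \<noteq> 0}"]; auto)+

lemma additive_op_cr: "additive_op (cr u)"
  by (rule additive_opI, rule poly_mapping_eqI) (auto simp: lookup_cr lookup_add algebra_simps)

lemma additive_op_an: "additive_op (an u)"
  by (rule additive_opI, rule poly_mapping_eqI) (auto simp: lookup_an lookup_add algebra_simps)

lemma additive_op_diagop: "additive_op (diagop d)"
  by (rule additive_opI, rule poly_mapping_eqI) (auto simp: lookup_add algebra_simps)

lemma cr_pscale: "cr u (pscale c x) = pscale c (cr u x)"
  by (rule poly_mapping_eqI) (auto simp: lookup_cr)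

lemma an_pscale: "an u (pscale c x) = pscale c (an u x)"
  by (rule poly_mapping_eqI) (auto simp: lookup_an)

definition modes_of :: "fock \<Rightarrow> mode set" where
  "modes_of x = (\<Union>S\<in>keys x. fset S)"

lemma finite_modes_of [simp]: "finite (modes_of x)"
  by (simp add: modes_of_def)

lemma an_eq_0: "u \<notin> modes_of x \<Longrightarrow> an u x = 0"
proof (rule poly_mapping_eqI)
  fix S
  assume "u \<notin> modes_of x"
  then have "finsert u S \<notin> keys x"
    unfolding modes_of_def using finsertI1 by blast
  then show "lookup (an u x) S = lookup 0 S"
    by (simp add: lookup_an in_keys_iff)
qed

lemma cr_single: "u |\<notin>| S \<Longrightarrow> cr u (single S c) = single (finsert u S) (sg u S * c)"
  by (rule poly_mapping_eqI) (auto simp: lookup_cr lookup_single when_def sg_fminus finsert_absorb)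

abbreviation vac :: state where "vac \<equiv> {||}"

text \<open>
  The modes \<open>(a, r)\<close> with \<open>r < \<theta> a\<close> are created, all other \<open>phi a r\<close> annihilate the mode
  \<open>(bar a, p - r)\<close>. The mode \<open>(a, r)\<close> carries \<open>q\<close> to the power \<open>p - 2 r\<close>, so that \<open>p = 1\<close> and \<open>p = 0\<close>
  are the Neveu-Schwarz and the Ramond sector; \<open>\<theta>\<close> selects the vacuum.
\<close>

locale clifford =
  fixes p :: int and \<theta> :: "colour \<Rightarrow> int"
  assumes theta_bar: "\<theta> (bar a) = p + 1 - \<theta> a"
begin

definition phi :: "colour \<Rightarrow> int \<Rightarrow> fock \<Rightarrow> fock" where
  "phi a r = (if r < \<theta> a then cr (a, r) else an (bar a, p - r))"

lemma theta_star: "p - r < \<theta> (bar a) \<longleftrightarrow> \<not> r < \<theta> a"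
  by (auto simp: theta_bar)

lemma CAR: "phi a r (phi b s x) + phi b s (phi a r x) = (if b = bar a \<and> s = p - r then x else 0)"
proof -
  \<comment> \<open>Of two conjugate modes exactly one is a creation mode, so two creators, or two
    annihilators, never have a nonzero anticommutator.\<close>
  have 1: "\<not> (b = bar a \<and> s = p - r)" if "r < \<theta> a \<longleftrightarrow> s < \<theta> b"
    using that theta_star[of r a] by auto
  show ?thesis
    using 1 cr_an[of "(a, r)" "(bar b, p - s)" x] cr_an[of "(b, s)" "(bar a, p - r)" x]
    by (auto simp: phi_def cr_cr an_an add.commute)
qed

lemma CAR': "phi a r (phi b s x) = (if b = bar a \<and> s = p - r then x else 0) - phi b s (phi a r x)"
  using CAR[of a r b s x] by (simp add: eq_diff_eq)

lemma additive_op_phi: "additive_op (phi a r)"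
  by (simp add: phi_def additive_op_cr additive_op_an)

lemmas phi_add = additive_op_add[OF additive_op_phi]
lemmas phi_diff = additive_op_diff[OF additive_op_phi]
lemmas phi_minus = additive_op_minus[OF additive_op_phi]
lemmas phi_zero [simp] = additive_op_zero[OF additive_op_phi]
lemmas phi_Sum_any = additive_op_Sum_any[OF additive_op_phi]

lemma phi_pscale: "phi a r (pscale c x) = pscale c (phi a r x)"
  by (simp add: phi_def cr_pscale an_pscale)

text \<open>
  For good \<open>a b m\<close> no normal ordering is needed: the sum defining \<open>X a b m x\<close> is finite. Otherwise
  \<open>Sum_any\<close> may return the junk value \<open>0\<close>.
\<close>

definition good :: "colour \<Rightarrow> colour \<Rightarrow> int \<Rightarrow> bool" where
  "good a b m \<longleftrightarrow> b \<noteq> bar a \<or> m \<noteq> 0"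

definition X :: "colour \<Rightarrow> colour \<Rightarrow> int \<Rightarrow> fock \<Rightarrow> fock" where
  "X a b m x = Sum_any (\<lambda>r. phi a r (phi b (m + p - r) x))"

lemma phi_eq_0: "\<theta> a \<le> r \<Longrightarrow> (bar a, p - r) \<notin> modes_of x \<Longrightarrow> phi a r x = 0"
  by (simp add: phi_def an_eq_0)

lemma finite_phi: "finite {r. r \<ge> \<theta> a \<and> phi a r x \<noteq> 0}"
proof (rule finite_subset)
  show "{r. r \<ge> \<theta> a \<and> phi a r x \<noteq> 0} \<subseteq> (\<lambda>u. p - snd u) ` modes_of x"
  proof
    fix r assume "r \<in> {r. r \<ge> \<theta> a \<and> phi a r x \<noteq> 0}"
    then have "(bar a, p - r) \<in> modes_of x" using phi_eq_0 by blast
    then show "r \<in> (\<lambda>u. p - snd u) ` modes_of x" by (intro image_eqI[where x = "(bar a, p - r)"]) auto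
  qed
qed auto

text \<open>If one of the two factors annihilates, it may be moved next to \<open>x\<close>, since
  goodness excludes a contraction, and then only finitely many indices contribute. If both create,
  then \<open>r\<close> lies in a bounded interval.\<close>

lemma finite_X:
  assumes "good a b m"
  shows "finite {r. phi a r (phi b (m + p - r) x) \<noteq> 0}"
proof (rule finite_subset)
  have anti: "phi a r (phi b (m + p - r) x) = - phi b (m + p - r) (phi a r x)" for r
    using assms by (subst CAR') (auto simp: good_def)
  show "{r. phi a r (phi b (m + p - r) x) \<noteq> 0} \<subseteq>
      {r. r \<ge> \<theta> a \<and> phi a r x \<noteq> 0} \<union> (\<lambda>s. m + p - s) ` {s. s \<ge> \<theta> b \<and> phi b s x \<noteq> 0}
      \<union> {m + p - \<theta> b <..< \<theta> a}"
  proof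
    fix r assume "r \<in> {r. phi a r (phi b (m + p - r) x) \<noteq> 0}"
    then have nz: "phi a r (phi b (m + p - r) x) \<noteq> 0" by simp
    consider "r \<ge> \<theta> a" | "m + p - r \<ge> \<theta> b" | "r < \<theta> a" "m + p - r < \<theta> b" by force
    then show "r \<in> {r. r \<ge> \<theta> a \<and> phi a r x \<noteq> 0} \<union> (\<lambda>s. m + p - s) ` {s. s \<ge> \<theta> b \<and> phi b s x \<noteq> 0}
      \<union> {m + p - \<theta> b <..< \<theta> a}"
    proof cases
      case 1 then show ?thesis using nz anti[of r] by auto
    next
      case 2 then show ?thesis using nz
        by (intro UnI1 UnI2) (rule image_eqI[where x = "m + p - r"], auto)
    qed auto
  qed
qed (auto simp: finite_phi)

section \<open>Quadratic operators and their commutators\<close>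

lemma additive_op_X: "good a b m \<Longrightarrow> additive_op (X a b m)"
  unfolding X_def
  by (rule additive_opI) (simp add: phi_add Sum_any.distrib finite_X)

lemma X_pscale: "good a b m \<Longrightarrow> X a b m (pscale c x) = pscale c (X a b m x)"
  unfolding X_def
  by (subst additive_op_Sum_any[where T = "pscale c"])
    (simp_all add: phi_pscale finite_X additive_op_def F.scale_right_distrib)

lemmas X_add = additive_op_add[OF additive_op_X]
lemmas X_diff = additive_op_diff[OF additive_op_X]
lemmas X_minus = additive_op_minus[OF additive_op_X]
lemmas X_zero = additive_op_zero[OF additive_op_X]

text \<open>Moving \<open>phi c s\<close> to the left past both factors costs two contractions, each
  supported at a single \<open>r\<close>. All partial sums are therefore finite and the sum can be
  split.\<close>

lemma X_phi:
  assumes "good a b m"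
  shows "X a b m (phi c s x) = phi c s (X a b m x)
    + (if c = bar b then phi a (m + s) x else 0) - (if c = bar a then phi b (m + s) x else 0)"
proof -
  let ?d1 = "\<lambda>r. if r = m + s then (if c = bar b then phi a r x else 0) else 0"
  let ?d2 = "\<lambda>r. if r = p - s then (if c = bar a then phi b (m + p - r) x else 0) else 0"
  have *: "phi a r (phi b (m + p - r) (phi c s x)) =
      phi c s (phi a r (phi b (m + p - r) x)) + ?d1 r - ?d2 r" for r
  proof -
    have "phi b (m + p - r) (phi c s x) =
        (if c = bar b \<and> r = m + s then x else 0) - phi c s (phi b (m + p - r) x)"
      by (subst CAR') auto
    then have "phi a r (phi b (m + p - r) (phi c s x)) =
        ?d1 r - phi a r (phi c s (phi b (m + p - r) x))"
      by (auto simp: phi_diff phi_minus)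
    also have "phi a r (phi c s (phi b (m + p - r) x)) =
        ?d2 r - phi c s (phi a r (phi b (m + p - r) x))"
      by (subst CAR') auto
    finally show ?thesis by simp
  qed
  have f: "finite {r. phi c s (phi a r (phi b (m + p - r) x)) \<noteq> 0}"
    by (rule finite_subset[OF _ finite_X[OF assms, of x]]) auto
  have f1: "finite {r. ?d1 r \<noteq> 0}" by (rule finite_subset[of _ "{m + s}"]) auto
  have f2: "finite {r. ?d2 r \<noteq> 0}" by (rule finite_subset[of _ "{p - s}"]) auto
  have "X a b m (phi c s x) = Sum_any (\<lambda>r. phi c s (phi a r (phi b (m + p - r) x))) + Sum_any ?d1 - Sum_any ?d2"
    unfolding X_def *
    by (subst Sum_any_diff, rule finite_neq_add, rule f, rule f1, rule f2,
        subst Sum_any.distrib, rule f, rule f1) simp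
  also have "Sum_any (\<lambda>r. phi c s (phi a r (phi b (m + p - r) x))) = phi c s (X a b m x)"
    unfolding X_def by (rule phi_Sum_any[symmetric]) (rule finite_X[OF assms])
  finally show ?thesis by simp
qed

lemma X_swap: "good a b m \<Longrightarrow> X b a m x = - X a b m x"
proof -
  assume g: "good a b m"
  have b: "bij (\<lambda>r. m + p - r)"
    by (rule bij_betw_byWitness[where f' = "\<lambda>r. m + p - r"]) auto
  have "X b a m x = Sum_any (\<lambda>r. phi b (m + p - r) (phi a r x))"
    unfolding X_def by (rule Sum_any.reindex_cong[OF b]) auto
  also have "\<dots> = Sum_any (\<lambda>r. - phi a r (phi b (m + p - r) x))"
    using g by (intro Sum_any.cong, subst CAR') (auto simp: good_def)
  also have "\<dots> = - X a b m x"
    unfolding X_def using additive_op_Sum_any[of uminus, OF _ finite_X[OF g, of x]]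
    by (simp add: additive_op_def)
  finally show ?thesis .
qed

text \<open>Antisymmetry makes the operator its own negative.\<close>

lemma X_same [simp]: "X a a m x = 0"
proof -
  have "good a a m" by (simp add: good_def)
  show ?thesis
  proof (rule poly_mapping_eqI)
    fix S
    have "lookup (X a a m x) S = - lookup (X a a m x) S"
      using arg_cong[OF X_swap[OF \<open>good a a m\<close>, of x], of "\<lambda>y. lookup y S"] by simp
    then show "lookup (X a a m x) S = lookup 0 S" by simp
  qed
qed

lemma Sum_any_if: "Sum_any (\<lambda>r. if P then g r else 0) = (if P then Sum_any g else 0)"
  by simp

text \<open>Conditions \<open>g1\<close> to \<open>g4\<close> make every contracted term a finite
  sum again. The excluded case, a contraction of the form \<open>X e (bar e) 0\<close>, is the one
  that produces a normal ordering constant and is settled by \<open>X_central\<close>.\<close>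

lemma X_comm:
  assumes g: "good a b m" "good c d m'"
    and g1: "c = bar b \<Longrightarrow> good a d (m + m')"
    and g2: "c = bar a \<Longrightarrow> good b d (m + m')"
    and g3: "d = bar b \<Longrightarrow> good c a (m + m')"
    and g4: "d = bar a \<Longrightarrow> good c b (m + m')"
  shows "X a b m (X c d m' x) = X c d m' (X a b m x)
    + (if c = bar b then X a d (m + m') x else 0) - (if c = bar a then X b d (m + m') x else 0)
    + (if d = bar b then X c a (m + m') x else 0) - (if d = bar a then X c b (m + m') x else 0)"
proof -
  let ?t = "\<lambda>a r. phi a (m + r) (phi d (m' + p - r) x)"
  let ?u = "\<lambda>a r. phi c r (phi a (m + (m' + p - r)) x)"
  let ?v0 = "\<lambda>r. phi c r (phi d (m' + p - r) (X a b m x))"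
  let ?v1 = "\<lambda>r. if c = bar b then ?t a r else 0"
  let ?v2 = "\<lambda>r. if c = bar a then ?t b r else 0"
  let ?v3 = "\<lambda>r. if d = bar b then ?u a r else 0"
  let ?v4 = "\<lambda>r. if d = bar a then ?u b r else 0"
  have bij: "bij (\<lambda>r. m + r)"
    by (rule bij_betw_byWitness[where f' = "\<lambda>r. r - m"]) auto
  have F0: "finite {r. ?v0 r \<noteq> 0}" by (rule finite_X) fact
  have ft: "finite {r. ?t e r \<noteq> 0}" if "good e d (m + m')" for e
  proof -
    have "finite ((\<lambda>r. r - m) ` {r. phi e r (phi d (m + m' + p - r) x) \<noteq> 0})"
      using finite_X[OF that, of x] by simp
    then show ?thesis
    proof (rule rev_finite_subset, intro subsetI)
      fix r assume "r \<in> {r. ?t e r \<noteq> 0}"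
      then show "r \<in> (\<lambda>r. r - m) ` {r. phi e r (phi d (m + m' + p - r) x) \<noteq> 0}"
        by (intro image_eqI[where x = "m + r"]) (auto simp: algebra_simps)
    qed
  qed
  have st: "Sum_any (?t e) = X e d (m + m') x" for e
    unfolding X_def by (rule Sum_any.reindex_cong[OF bij, symmetric]) (auto simp: fun_eq_iff algebra_simps)
  have fu: "finite {r. ?u e r \<noteq> 0}" if "good c e (m + m')" for e
    using finite_X[OF that, of x] by (simp add: algebra_simps)
  have su: "Sum_any (?u e) = X c e (m + m') x" for e
    unfolding X_def by (rule Sum_any.cong) (simp add: algebra_simps)
  have F1: "finite {r. ?v1 r \<noteq> 0}" using ft g1 by (cases "c = bar b") auto
  have F2: "finite {r. ?v2 r \<noteq> 0}" using ft g2 by (cases "c = bar a") auto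
  have F3: "finite {r. ?v3 r \<noteq> 0}" using fu g3 by (cases "d = bar b") auto
  have F4: "finite {r. ?v4 r \<noteq> 0}" using fu g4 by (cases "d = bar a") auto
  have "X a b m (X c d m' x) = Sum_any (\<lambda>r. X a b m (phi c r (phi d (m' + p - r) x)))"
    unfolding X_def[of c d] by (rule additive_op_Sum_any[OF additive_op_X[OF g(1)] finite_X[OF g(2)]])
  also have "\<dots> = Sum_any (\<lambda>r. ?v0 r + ?v1 r - ?v2 r + ?v3 r - ?v4 r)"
    by (rule Sum_any.cong) (simp add: X_phi[OF g(1)] phi_add phi_diff)
  also have "\<dots> = Sum_any ?v0 + Sum_any ?v1 - Sum_any ?v2 + Sum_any ?v3 - Sum_any ?v4"
    using F0 F1 F2 F3 F4
    by (simp only: Sum_any_diff Sum_any.distrib finite_neq_add)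
  also have "\<dots> = X c d m' (X a b m x)
    + (if c = bar b then X a d (m + m') x else 0) - (if c = bar a then X b d (m + m') x else 0)
    + (if d = bar b then X c a (m + m') x else 0) - (if d = bar a then X c b (m + m') x else 0)"
    by (simp only: Sum_any_if st su X_def[of c d m'])
  finally show ?thesis .
qed

section \<open>States and the vacuum\<close>

definition cstate :: "state \<Rightarrow> bool" where
  "cstate S \<longleftrightarrow> (\<forall>u\<in>fset S. snd u < \<theta> (fst u))"

definition fockspace :: "fock set" where
  "fockspace = {x. \<forall>S\<in>keys x. cstate S}"

lemma lookup_phi:
  "lookup (phi a r x) S =
    (if r < \<theta> a then if (a, r) |\<in>| S then sg (a, r) S * lookup x (S |-| {|(a, r)|}) else 0
     else if (bar a, p - r) |\<in>| S then 0 else sg (bar a, p - r) S * lookup x (finsert (bar a, p - r) S))"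
  by (simp add: phi_def lookup_cr lookup_an)

text \<open>The claim is carried for all coefficients \<open>c\<close> at once, so that the sign
  introduced by the creation operator can be absorbed into the coefficient.\<close>

lemma phi_induct:
  assumes "cstate S" and "\<And>c. P (single vac c)"
    and "\<And>a r S c. cstate S \<Longrightarrow> r < \<theta> a \<Longrightarrow> (\<And>c. P (single S c)) \<Longrightarrow> P (phi a r (single S c))"
  shows "P (single S c)"
  using assms(1)
proof (induction S arbitrary: c)
  case empty then show ?case using assms(2) by simp
next
  case (insert u S)
  obtain a r where u: "u = (a, r)" by (cases u)
  have cs: "cstate S" and r: "r < \<theta> a" using insert.prems u by (auto simp: cstate_def)
  have "phi a r (single S (sg u S * c)) = single (finsert u S) c"
    using r insert.hyps by (simp add: phi_def u cr_single)
  moreover have "P (phi a r (single S (sg u S * c)))"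
    using assms(3)[OF cs r] insert.IH[OF cs] by blast
  ultimately show ?case by simp
qed

lemma single_in_fockspace: "cstate S \<Longrightarrow> single S c \<in> fockspace"
  by (simp add: fockspace_def)

lemma additive_ops_eqI:
  assumes "additive_op T" "additive_op T'"
    and "\<And>S c. cstate S \<Longrightarrow> T (single S c) = T' (single S c)"
    and "x \<in> fockspace"
  shows "T x = T' x"
proof -
  have "T (\<Sum>S\<in>keys x. single S (lookup x S)) =
      T' (\<Sum>S\<in>keys x. single S (lookup x S))"
    using assms by (simp add: additive_op_sum fockspace_def)
  then show ?thesis
    by (simp flip: poly_mapping_sum_single)
qed

text \<open>The vacuum generates the Fock space under the operators \<open>phi\<close>. Requiring
  only that the kernel be stable under them covers operators that commute with \<open>phi\<close> as
  well as those that anticommute.\<close>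

lemma operator_eq_0:
  assumes T: "additive_op T"
    and comm: "\<And>a r x. x \<in> fockspace \<Longrightarrow> T x = 0 \<Longrightarrow> T (phi a r x) = 0"
    and v: "\<And>c. T (single vac c) = 0"
    and x: "x \<in> fockspace"
  shows "T x = 0"
proof (rule additive_ops_eqI[OF T _ _ x])
  show "T (single S c) = 0" if "cstate S" for S c
    using that
  proof (rule phi_induct)
    fix a r S c assume "cstate S" "\<And>c. T (single S c) = 0"
    then show "T (phi a r (single S c)) = 0"
      by (intro comm single_in_fockspace)
  qed (rule v)
qed (simp add: additive_op_def)

text \<open>If a state \<open>S\<close> other than the vacuum occurred in \<open>x\<close>,
  annihilating one of its modes would leave a nonzero coefficient, because no other state becomes
  \<open>S\<close> without that mode.\<close>

lemma vacuum_unique: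
  assumes x: "x \<in> fockspace" and ann: "\<And>a r. \<theta> a \<le> r \<Longrightarrow> phi a r x = 0"
  shows "x = single vac (lookup x vac)"
proof (rule poly_mapping_eqI)
  fix S
  have "lookup x S = 0" if "S \<noteq> vac"
  proof (rule ccontr)
    assume nz: "lookup x S \<noteq> 0"
    then have "cstate S" using x by (auto simp: fockspace_def in_keys_iff)
    obtain u where "u |\<in>| S" using \<open>S \<noteq> vac\<close> by blast
    then obtain a r where ar: "(a, r) |\<in>| S" by (cases u) auto
    then have "r < \<theta> a" using \<open>cstate S\<close> by (auto simp: cstate_def)
    then have ge: "\<theta> (bar a) \<le> p - r" by (simp add: theta_bar)
    have "lookup (phi (bar a) (p - r) x) (S |-| {|(a, r)|}) \<noteq> 0"
      using ge nz ar by (auto simp: lookup_phi finsert_absorb sg_def)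
    then show False using ann[OF ge] by simp
  qed
  then show "lookup x S =
      lookup (single vac (lookup x vac)) S"
    by (cases "S = vac") (auto simp: lookup_single when_def)
qed

lemma phi_vac: "\<theta> a \<le> r \<Longrightarrow> phi a r (single vac c) = 0"
  by (rule phi_eq_0) (auto simp: modes_of_def)

lemma phi_keys:
  assumes "S \<in> keys (phi a r x)"
  obtains S' where "S' \<in> keys x" "r < \<theta> a" "(a, r) |\<notin>| S'" "S = finsert (a, r) S'"
  | S' where "S' \<in> keys x" "\<theta> a \<le> r" "(bar a, p - r) |\<notin>| S" "S' = finsert (bar a, p - r) S"
proof (cases "r < \<theta> a")
  case True
  with assms have "(a, r) |\<in>| S" "S |-| {|(a, r)|} \<in> keys x"
    by (auto simp: in_keys_iff lookup_phi split: if_splits)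
  with True that(1)[of "S |-| {|(a, r)|}"] show ?thesis by (auto simp: finsert_absorb)
next
  case False
  with assms that(2) show ?thesis
    by (auto simp: in_keys_iff lookup_phi split: if_splits)
qed

lemma phi_fockspace: "x \<in> fockspace \<Longrightarrow> phi a r x \<in> fockspace"
  unfolding fockspace_def
  by (auto elim!: phi_keys simp: cstate_def)

text \<open>Any odd function on the modes grades the Fock space.\<close>

definition weight :: "(mode \<Rightarrow> 'b::ab_group_add) \<Rightarrow> state \<Rightarrow> 'b" where
  "weight g S = (\<Sum>u\<in>fset S. g u)"

lemma weight_vac [simp]: "weight g vac = 0"
  by (simp add: weight_def)

lemma weight_finsert: "u |\<notin>| S \<Longrightarrow> weight g (finsert u S) = g u + weight g S"
  by (simp add: weight_def)

text \<open>Oddness makes \<open>phi a r\<close> shift the weight by \<open>g (a, r)\<close> in both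
  of its roles: creating \<open>(a, r)\<close> and removing the conjugate mode.\<close>

definition odd_fun :: "(mode \<Rightarrow> 'b::ab_group_add) \<Rightarrow> bool" where
  "odd_fun g \<longleftrightarrow> (\<forall>a r. g (bar a, p - r) = - g (a, r))"

lemma odd_funD: "odd_fun g \<Longrightarrow> g (bar a, p - r) = - g (a, r)"
  unfolding odd_fun_def by blast

lemma phi_weight:
  assumes "odd_fun g" "S \<in> keys (phi a r x)"
  obtains S' where "S' \<in> keys x" "weight g S = g (a, r) + weight g S'"
  using assms(2)
proof (cases rule: phi_keys)
  case (1 S')
  then show ?thesis using that by (simp add: weight_finsert)
next
  case (2 S')
  then have "weight g S' = - g (a, r) + weight g S"
    by (simp add: weight_finsert odd_funD[OF assms(1)])
  with 2 show ?thesis using that by simp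
qed

lemma diagop_phi:
  fixes g :: "mode \<Rightarrow> complex"
  assumes "odd_fun g"
  shows "diagop (weight g) (phi a r x) = phi a r (diagop (weight g) x) + pscale (g (a, r)) (phi a r x)"
proof (rule poly_mapping_eqI)
  fix S
  have o: "g (bar a, p - r) = - g (a, r)" by (rule odd_funD) fact
  have w: "weight g S = g (a, r) + weight g (S |-| {|(a, r)|})" if "(a, r) |\<in>| S"
    using that weight_finsert[of "(a, r)" "S |-| {|(a, r)|}" g] by (simp add: finsert_absorb)
  show "lookup (diagop (weight g) (phi a r x)) S =
    lookup (phi a r (diagop (weight g) x) + pscale (g (a, r)) (phi a r x)) S"
    using o w by (auto simp: lookup_phi lookup_add weight_finsert algebra_simps)
qed

end

lemma lookup_Sum_any:
  fixes g :: "'b \<Rightarrow> ('s \<Rightarrow>\<^sub>0 'a::ab_group_add)"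
  shows "finite {r. g r \<noteq> 0} \<Longrightarrow> lookup (Sum_any g) S = Sum_any (\<lambda>r. lookup (g r) S)"
  by (rule additive_op_Sum_any[where T = "\<lambda>y. lookup y S"]) (auto simp: additive_op_def lookup_add)

lemma keys_Sum_any:
  assumes "S \<in> keys (Sum_any g)"
  obtains r where "S \<in> keys (g r)"
proof -
  have "lookup (\<Sum>r | g r \<noteq> 0. g r) S \<noteq> 0"
    using assms by (simp add: in_keys_iff Sum_any.expand_set)
  then have "(\<Sum>r | g r \<noteq> 0. lookup (g r) S) \<noteq> 0"
    by (simp add: Poly_Mapping.lookup_sum)
  then obtain r where "lookup (g r) S \<noteq> 0"
    using sum.not_neutral_contains_not_neutral by blast
  then show ?thesis using that by (simp add: in_keys_iff)
qed

text \<open>The Casimir operator runs over \<open>m > 0\<close>, whereas \<open>X\<close> is a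
  two-sided sum. Folding \<open>m\<close> with \<open>- m\<close> relates them, at the price of the
  term at \<open>0\<close>.\<close>

lemma Sum_any_pos:
  fixes g :: "int \<Rightarrow> 'a::ab_group_add"
  assumes "finite {m. g m \<noteq> 0}"
  shows "Sum_any (\<lambda>m. if 0 < m then g m + g (- m) else 0) = Sum_any g - g 0"
proof -
  have b: "bij (uminus :: int \<Rightarrow> int)" by (rule bij_uminus)
  have f: "finite {m. (if 0 < m then g m else 0) \<noteq> 0}" "finite {m. (if m < 0 then g m else 0) \<noteq> 0}"
    "finite {m. (if m = 0 then g m else 0) \<noteq> 0}"
    by (rule finite_subset[OF _ assms]; auto)+
  have "{m. (if 0 < m then g (- m) else 0) \<noteq> 0} \<subseteq> uminus ` {m. g m \<noteq> 0}"
    by (auto simp: image_iff split: if_splits intro: exI[of _ "- _"]) (metis minus_minus)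
  then have f': "finite {m. (if 0 < m then g (- m) else 0) \<noteq> 0}"
    using assms finite_surj by blast
  have neg: "Sum_any (\<lambda>m. if m < 0 then g m else 0) = Sum_any (\<lambda>m. if 0 < m then g (- m) else 0)"
    by (rule Sum_any.reindex_cong[OF b]) auto
  have "Sum_any (\<lambda>m. if 0 < m then g m + g (- m) else 0) =
      Sum_any (\<lambda>m. (if 0 < m then g m else 0) + (if 0 < m then g (- m) else 0))"
    by (rule Sum_any.cong) auto
  also have "\<dots> = Sum_any (\<lambda>m. if 0 < m then g m else 0) + Sum_any (\<lambda>m. if m < 0 then g m else 0)"
    by (simp add: Sum_any.distrib f f' neg)
  finally have 1: "Sum_any (\<lambda>m. if 0 < m then g m + g (- m) else 0) = \<dots>" .
  have "Sum_any g = Sum_any (\<lambda>m. ((if 0 < m then g m else 0) + (if m < 0 then g m else 0)) + (if m = 0 then g m else 0))"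
    by (rule Sum_any.cong) auto
  also have "\<dots> = Sum_any (\<lambda>m. if 0 < m then g m else 0) + Sum_any (\<lambda>m. if m < 0 then g m else 0)
      + Sum_any (\<lambda>m. if m = 0 then g m else 0)"
    by (subst Sum_any.distrib, rule finite_neq_add, rule f, rule f, rule f, subst Sum_any.distrib, rule f, rule f) simp
  finally show ?thesis using 1 by simp
qed

lemma diagop_pscale: "diagop d (pscale c x) = pscale c (diagop d x)"
  by (rule poly_mapping_eqI) simp

text \<open>The codomain is left open: integer charges serve parity and dominance, complex ones
  serve as eigenvalues for \<open>diagop\<close>.\<close>

definition colour_charge :: "colour \<Rightarrow> mode \<Rightarrow> 'b::{ab_group_add,one}" where
  "colour_charge a u = (if fst u = a then 1 else 0) - (if fst u = bar a then 1 else 0)"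

context clifford
begin

lemma odd_colour_charge [simp]: "odd_fun (colour_charge a)"
proof -
  have "bar c = a \<longleftrightarrow> c = bar a" for c by (metis bar_bar)
  then show ?thesis unfolding odd_fun_def by (auto simp: colour_charge_def simp del: split_paired_All)
qed

lemma X_fockspace: "x \<in> fockspace \<Longrightarrow> X a b m x \<in> fockspace"
proof -
  assume x: "x \<in> fockspace"
  have "cstate S" if "S \<in> keys (X a b m x)" for S
    using that unfolding X_def
    by (elim keys_Sum_any) (use phi_fockspace[OF phi_fockspace[OF x]] in \<open>auto simp: fockspace_def\<close>)
  then show ?thesis by (simp add: fockspace_def)
qed

lemma X_weight:
  assumes "odd_fun g" and "\<And>r. g (a, r) + g (b, m + p - r) = k" and "S \<in> keys (X a b m x)"
  obtains S' where "S' \<in> keys x" "weight g S = k + weight g S'"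
proof -
  obtain r where "S \<in> keys (phi a r (phi b (m + p - r) x))"
    using assms(3) unfolding X_def by (elim keys_Sum_any)
  then obtain S1 where S1: "S1 \<in> keys (phi b (m + p - r) x)"
      "weight g S = g (a, r) + weight g S1"
    using assms(1) by (elim phi_weight)
  then obtain S2 where "S2 \<in> keys x" "weight g S1 = g (b, m + p - r) + weight g S2"
    using assms(1) by (elim phi_weight[rotated])
  then show ?thesis using that S1(2) assms(2)[of r] by (simp flip: add.assoc)
qed

lemma diagop_X:
  fixes g :: "mode \<Rightarrow> complex"
  assumes "odd_fun g" and "\<And>r. g (a, r) + g (b, m + p - r) = k" and "good a b m"
  shows "diagop (weight g) (X a b m x) = X a b m (diagop (weight g) x) + pscale k (X a b m x)"
proof -
  let ?f = "\<lambda>r. phi a r (phi b (m + p - r) x)"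
  have *: "diagop (weight g) (?f r) = phi a r (phi b (m + p - r) (diagop (weight g) x)) + pscale k (?f r)" for r
    by (simp add: diagop_phi[OF assms(1)] phi_add phi_pscale F.scale_left_distrib flip: assms(2)[of r])
  have f: "finite {r. pscale k (?f r) \<noteq> 0}"
    by (rule finite_subset[OF _ finite_X[OF assms(3), of x]]) auto
  have ps: "additive_op (pscale k)" by (simp add: additive_op_def F.scale_right_distrib)
  have "diagop (weight g) (X a b m x) = Sum_any (\<lambda>r. diagop (weight g) (?f r))"
    unfolding X_def by (rule additive_op_Sum_any[OF additive_op_diagop finite_X[OF assms(3)]])
  also have "\<dots> = X a b m (diagop (weight g) x) + Sum_any (\<lambda>r. pscale k (?f r))"
    unfolding * X_def by (rule Sum_any.distrib[OF finite_X[OF assms(3)] f])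
  also have "Sum_any (\<lambda>r. pscale k (?f r)) = pscale k (X a b m x)"
    unfolding X_def by (rule additive_op_Sum_any[OF ps finite_X[OF assms(3)], symmetric])
  finally show ?thesis .
qed

lemma X_vac:
  assumes "good a b m" "\<theta> a + \<theta> b \<le> m + p + 1"
  shows "X a b m (single vac c) = 0"
proof -
  have "phi a r (phi b (m + p - r) (single vac c)) = 0" for r
  proof (cases "m + p - r \<ge> \<theta> b")
    case True then show ?thesis by (simp add: phi_vac)
  next
    case False
    then have "r \<ge> \<theta> a" using assms(2) by linarith
    then show ?thesis using assms(1) by (subst CAR') (auto simp: phi_vac good_def)
  qed
  then show ?thesis by (simp add: X_def)
qed

text \<open>
  The difference of the two sides commutes with all \<open>phi c s\<close>, so it suffices to compare them on the
  vacuum; there the normal ordering constant appears.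
\<close>

lemma X_central:
  assumes ab: "fst a \<noteq> fst b" and k: "k = m + p + 1 - \<theta> a - \<theta> b" "k = 0 \<or> k = 1"
    and x: "x \<in> fockspace"
  shows "X a b m (X (bar b) (bar a) (- m) x) = X (bar b) (bar a) (- m) (X a b m x)
     + diagop (weight (colour_charge a)) x + diagop (weight (colour_charge b)) x + pscale (of_int k) x"
proof -
  let ?G = "X (bar b) (bar a) (- m)"
  have ne: "a \<noteq> b" "b \<noteq> a" "a \<noteq> bar b" "b \<noteq> bar a" "bar a \<noteq> b" "bar b \<noteq> a"
    using ab by auto
  have g: "good a b m" "good (bar b) (bar a) (- m)" using ne by (auto simp: good_def)
  define T where "T x = X a b m (?G x) - ?G (X a b m x)
      - diagop (weight (colour_charge a)) x - diagop (weight (colour_charge b)) x - pscale (of_int k) x" for x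
  have add: "additive_op T"
    unfolding T_def by (rule additive_opI)
      (simp add: X_add[OF g(1)] X_add[OF g(2)] additive_op_add[OF additive_op_diagop] F.scale_right_distrib)
  have comm: "T (phi c s x) = phi c s (T x)" for c s x
  proof -
    have D: "diagop (weight (colour_charge e)) (phi c s x) = phi c s (diagop (weight (colour_charge e)) x)
      + pscale (colour_charge e (c, s)) (phi c s x)" for e
      by (rule diagop_phi) simp
    consider "c = a" | "c = b" | "c = bar a" | "c = bar b" | "c \<notin> {a, b, bar a, bar b}" by blast
    then show ?thesis
      unfolding T_def D
      by cases (use ne in \<open>simp_all add: X_phi g X_add X_diff X_minus phi_add phi_diff phi_pscale colour_charge_def\<close>)
  qed
  have vac: "T (single vac c) = 0" for c
  proof -
    let ?v = "single vac c"
    have E: "X a b m ?v = 0" using g k by (intro X_vac) auto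
    have Q: "diagop (weight h) ?v = 0" for h
      by (rule poly_mapping_eqI) (auto simp: lookup_single when_def)
    have "X a b m (?G ?v) = pscale (of_int k) ?v"
    proof (cases "k = 0")
      case True
      have "?G ?v = 0" using g k True by (intro X_vac) (auto simp: theta_bar)
      then show ?thesis using g True by (simp add: X_zero)
    next
      case False
      with k have k1: "k = 1" "m + p = \<theta> a + \<theta> b" by auto
      \<comment> \<open>In general \<open>k\<close> is the number of \<open>r\<close> for which both
        factors create. For \<open>k = 1\<close> this is only the pair of top creation modes, at
        \<open>r = p - \<theta> b\<close>.\<close>
      have "phi (bar b) r (phi (bar a) (- m + p - r) ?v) =
        (if r = p - \<theta> b then phi (bar b) r (phi (bar a) (- m + p - r) ?v) else 0)" for r
      proof -
        consider "r = p - \<theta> b" | "r > p - \<theta> b" | "r < p - \<theta> b" by linarith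
        then show ?thesis
        proof cases
          case 2 then show ?thesis using ne
            by (subst CAR') (auto simp: phi_vac theta_bar)
        next
          case 3 then show ?thesis using k1 by (simp add: phi_vac theta_bar)
        qed auto
      qed
      then have "?G ?v = Sum_any (\<lambda>r. if r = p - \<theta> b then phi (bar b) r (phi (bar a) (- m + p - r) ?v) else 0)"
        unfolding X_def by (rule Sum_any.cong)
      also have "\<dots> = phi (bar b) (p - \<theta> b) (phi (bar a) (p - \<theta> a) ?v)"
      proof -
        have "- m + p - (p - \<theta> b) = p - \<theta> a" using k1 by linarith
        then show ?thesis by (subst Sum_any.delta) simp
      qed
      finally have "X a b m (?G ?v) = phi (bar b) (p - \<theta> b) (- phi b (m + (p - \<theta> a)) ?v)
          + phi a (m + (p - \<theta> b)) (phi (bar a) (p - \<theta> a) ?v)"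
        using ne g E by (simp add: X_phi)
      also have "phi b (m + (p - \<theta> a)) ?v = 0" by (rule phi_vac) (use k1 in auto)
      also have "phi a (m + (p - \<theta> b)) (phi (bar a) (p - \<theta> a) ?v) = ?v - phi (bar a) (p - \<theta> a) (phi a (\<theta> a) ?v)"
      proof -
        have "m + (p - \<theta> b) = \<theta> a" using k1 by linarith
        then show ?thesis by (simp only:) (subst CAR', auto)
      qed
      also have "phi a (\<theta> a) ?v = 0" by (rule phi_vac) simp
      finally show ?thesis using k1 by simp
    qed
    then show ?thesis using g by (simp add: T_def E Q X_zero)
  qed
  have "T x = 0"
    by (rule operator_eq_0[OF add _ vac x]) (simp add: comm)
  then show ?thesis by (simp add: T_def algebra_simps)
qed

end

subsection \<open>The contravariant form\<close>

definition hin :: "('s \<Rightarrow>\<^sub>0 complex) \<Rightarrow> ('s \<Rightarrow>\<^sub>0 complex) \<Rightarrow> complex" where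
  "hin x y = (\<Sum>S\<in>keys x. lookup x S * cnj (lookup y S))"

lemma hin_superset:
  assumes "finite A" "keys x \<inter> keys y \<subseteq> A"
  shows "hin x y = (\<Sum>S\<in>A. lookup x S * cnj (lookup y S))"
proof -
  have "hin x y = (\<Sum>S\<in>keys x \<union> A. lookup x S * cnj (lookup y S))"
    unfolding hin_def using assms by (intro sum.mono_neutral_left) (auto simp: in_keys_iff)
  also have "\<dots> = (\<Sum>S\<in>A. lookup x S * cnj (lookup y S))"
    using assms by (intro sum.mono_neutral_right) (auto simp: in_keys_iff)
  finally show ?thesis .
qed

lemma hin_commute: "hin y x = cnj (hin x y)"
proof -
  let ?A = "keys x \<union> keys y"
  have "hin y x = (\<Sum>S\<in>?A. lookup y S * cnj (lookup x S))"
    by (rule hin_superset) auto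
  also have "\<dots> = cnj (\<Sum>S\<in>?A. lookup x S * cnj (lookup y S))"
    by (simp add: mult.commute)
  also have "(\<Sum>S\<in>?A. lookup x S * cnj (lookup y S)) = hin x y"
    by (rule hin_superset[symmetric]) auto
  finally show ?thesis .
qed

lemma additive_op_hin_right: "additive_op (hin x)"
  by (simp add: additive_op_def hin_def lookup_add distrib_left sum.distrib)

lemma additive_op_hin_left: "additive_op (\<lambda>x. hin x y)"
  using additive_op_add[OF additive_op_hin_right[of y]]
  by (intro additive_opI) (metis complex_cnj_add hin_commute)

lemma hin_pscale_right: "hin x (pscale c y) = cnj c * hin x y"
  by (simp add: hin_def sum_distrib_left mult_ac)

lemma hin_self: "hin x x = of_real (\<Sum>S\<in>keys x. (cmod (lookup x S))\<^sup>2)"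
  by (simp add: hin_def complex_norm_square del: of_real_power)

lemma hin_self_pos: "x \<noteq> 0 \<Longrightarrow> 0 < Re (hin x x)"
  unfolding hin_self Re_complex_of_real
  by (rule sum_pos) (auto simp: in_keys_iff)

lemma hin_self_nonneg: "0 \<le> Re (hin x x)"
  unfolding hin_self Re_complex_of_real by (rule sum_nonneg) auto

lemma hin_single_left: "hin (single S c) y = c * cnj (lookup y S)"
  by (subst hin_superset[of "{S}"]) (auto simp: lookup_single)

lemma hin_cr: "hin (cr u x) y = hin x (an u y)"
proof -
  let ?A = "{S \<in> keys x. u |\<notin>| S}"
  have "hin (cr u x) y = (\<Sum>S\<in>finsert u ` ?A. lookup (cr u x) S * cnj (lookup y S))"
  proof (rule hin_superset)
    show "keys (cr u x) \<inter> keys y \<subseteq> finsert u ` ?A"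
    proof
      fix S assume "S \<in> keys (cr u x) \<inter> keys y"
      then have "u |\<in>| S" "S |-| {|u|} \<in> keys x"
        by (auto simp: in_keys_iff lookup_cr split: if_splits)
      then show "S \<in> finsert u ` ?A" by (intro image_eqI[of _ _ "S |-| {|u|}"]) auto
    qed
  qed auto
  also have "\<dots> = (\<Sum>S\<in>?A. lookup (cr u x) (finsert u S) * cnj (lookup y (finsert u S)))"
    by (rule sum.reindex_cong[of "finsert u"])
      (auto intro!: inj_onI simp: finsert_ident)
  also have "\<dots> = (\<Sum>S\<in>?A. lookup x S * cnj (lookup (an u y) S))"
    by (rule sum.cong) (auto simp: lookup_cr lookup_an sg_finsert mult_ac)
  also have "\<dots> = hin x (an u y)"
    by (rule hin_superset[symmetric]) (auto simp: in_keys_iff lookup_an)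
  finally show ?thesis .
qed

lemma hin_an: "hin (an u x) y = hin x (cr u y)"
  using hin_cr[of u y x] by (metis hin_commute)

context clifford
begin

text \<open>Conjugate modes are adjoint to each other for the form in which the states are
  orthonormal. Hence this positive definite form is at the same time contravariant, raising and
  lowering operators being built from adjoint pairs.\<close>

lemma hin_phi: "hin (phi a r x) y = hin x (phi (bar a) (p - r) y)"
  using theta_star[of r a] by (auto simp: phi_def hin_cr hin_an)

lemma hin_X:
  assumes "good a b m"
  shows "hin (X a b m x) y = hin x (X (bar b) (bar a) (- m) y)"
proof -
  have g: "good (bar b) (bar a) (- m)" using assms by (auto simp: good_def)
  have bij: "bij (\<lambda>r. r - m)"
    by (rule bij_betw_byWitness[where f' = "\<lambda>r. r + m"]) auto
  have "hin (X a b m x) y = Sum_any (\<lambda>r. hin (phi a r (phi b (m + p - r) x)) y)"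
    unfolding X_def by (rule additive_op_Sum_any[OF additive_op_hin_left finite_X[OF assms]])
  also have "\<dots> = Sum_any (\<lambda>r. hin x (phi (bar b) (r - m) (phi (bar a) (- m + p - (r - m)) y)))"
    by (rule Sum_any.cong) (simp add: hin_phi algebra_simps)
  also have "\<dots> = Sum_any (\<lambda>r. hin x (phi (bar b) r (phi (bar a) (- m + p - r) y)))"
    by (rule Sum_any.reindex_cong[OF bij, symmetric]) auto
  also have "\<dots> = hin x (X (bar b) (bar a) (- m) y)"
    unfolding X_def by (rule additive_op_Sum_any[OF additive_op_hin_right finite_X[OF g], symmetric])
  finally show ?thesis .
qed

end

section \<open>The oscillator part of the conformal weight operator\<close>

context clifford
begin

text \<open>
  The Heisenberg modes of one colour. Their quadratic Casimir turns out to be the energy of that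
  colour minus half the square of its charge.
\<close>

abbreviation h :: "colour \<Rightarrow> int \<Rightarrow> fock \<Rightarrow> fock" where
  "h a \<equiv> X a (bar a)"

lemma good_h: "m \<noteq> 0 \<Longrightarrow> good a (bar a) m"
  by (simp add: good_def)

lemma h_bar: "m \<noteq> 0 \<Longrightarrow> h (bar a) m x = - h a m x"
  using X_swap[OF good_h] by simp

lemma phi_eventually_0: "\<exists>N. \<forall>r>N. phi a r x = 0"
proof -
  obtain N where N: "\<forall>r\<in>{r. r \<ge> \<theta> a \<and> phi a r x \<noteq> 0}. r \<le> N"
    using finite_phi[of a x] by (meson bdd_above.E bdd_above_finite)
  have "phi a r x = 0" if "r > max N (\<theta> a)" for r
    using N that by (metis (mono_tags, lifting) mem_Collect_eq max_less_iff_conj less_imp_le not_less)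
  then show ?thesis by blast
qed

lemma h_eventually_0: "\<exists>N. \<forall>m>N. h a m x = 0"
proof -
  obtain N1 N2 where N1: "\<forall>r>N1. phi a r x = 0" and N2: "\<forall>r>N2. phi (bar a) r x = 0"
    using phi_eventually_0 by meson
  have "h a m x = 0" if m: "m > max 0 (N1 + N2 - p)" for m
  proof -
    have "phi a r (phi (bar a) (m + p - r) x) = 0" for r
    proof (cases "r > N1")
      case True
      then show ?thesis using N1 m by (subst CAR') auto
    next
      case False
      then have "m + p - r > N2" using m by linarith
      then show ?thesis using N2 by simp
    qed
    then show ?thesis by (simp add: X_def)
  qed
  then show ?thesis by blast
qed

definition casimir :: "colour \<Rightarrow> fock \<Rightarrow> fock" where
  "casimir a x = Sum_any (\<lambda>m. if 0 < m then h a (- m) (h a m x) else 0)"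

text \<open>This is the commutator of \<open>casimir a\<close> with \<open>phi a s\<close>: a mode
  of the normally ordered product of current and fermion, with the charge term \<open>m = 0\<close>
  left out. Its evaluation below is, in modes, the relation that the derivative of a charged fermion
  equals this product.\<close>

definition casimir_comm :: "colour \<Rightarrow> int \<Rightarrow> fock \<Rightarrow> fock" where
  "casimir_comm a s x =
     Sum_any (\<lambda>m. if 0 < m then h a (- m) (phi a (s + m) x) + phi a (s - m) (h a m x) else 0)"

lemma finite_casimir: "finite {m. (if 0 < m then h a (- m) (h a m x) else 0) \<noteq> 0}"
proof -
  obtain N where N: "\<forall>m>N. h a m x = 0" using h_eventually_0 by blast
  show ?thesis
  proof (rule finite_subset)
    show "{m. (if 0 < m then h a (- m) (h a m x) else 0) \<noteq> 0} \<subseteq> {0<..N}"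
    proof
      fix m assume m: "m \<in> {m. (if 0 < m then h a (- m) (h a m x) else 0) \<noteq> 0}"
      have "h a (- m) (h a m x) = 0" if "m > N" "0 < m"
        using that N by (simp add: X_zero good_h)
      then show "m \<in> {0<..N}" using m by (force split: if_splits)
    qed
  qed simp
qed

lemma finite_casimir_comm:
  "finite {m. (if 0 < m then h a (- m) (phi a (s + m) x) + phi a (s - m) (h a m x) else 0) \<noteq> 0}"
proof -
  obtain N1 N2 where N1: "\<forall>m>N1. h a m x = 0" and N2: "\<forall>r>N2. phi a r x = 0"
    using h_eventually_0 phi_eventually_0 by meson
  show ?thesis
  proof (rule finite_subset)
    show "{m. (if 0 < m then h a (- m) (phi a (s + m) x) + phi a (s - m) (h a m x) else 0) \<noteq> 0}
        \<subseteq> {0<..max N1 (N2 - s)}"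
    proof
      fix m assume m: "m \<in> {m. (if 0 < m then h a (- m) (phi a (s + m) x) + phi a (s - m) (h a m x) else 0) \<noteq> 0}"
      have "h a (- m) (phi a (s + m) x) + phi a (s - m) (h a m x) = 0" if "m > max N1 (N2 - s)" "0 < m"
      proof -
        have "phi a (s + m) x = 0" "h a m x = 0" using that N1 N2 by auto
        then show ?thesis using that by (simp add: X_zero good_h)
      qed
      then show "m \<in> {0<..max N1 (N2 - s)}" using m by (force split: if_splits)
    qed
  qed simp
qed

lemma additive_op_casimir: "additive_op (casimir a)"
proof (rule additive_opI)
  fix x y
  have "casimir a (x + y) = Sum_any (\<lambda>m. (if 0 < m then h a (- m) (h a m x) else 0) +
      (if 0 < m then h a (- m) (h a m y) else 0))"
    unfolding casimir_def by (rule Sum_any.cong) (simp add: X_add good_h)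
  then show "casimir a (x + y) = casimir a x + casimir a y"
    by (simp only: Sum_any.distrib finite_casimir casimir_def)
qed

lemma additive_op_casimir_comm: "additive_op (casimir_comm a s)"
proof (rule additive_opI)
  fix x y
  have "casimir_comm a s (x + y) =
      Sum_any (\<lambda>m. (if 0 < m then h a (- m) (phi a (s + m) x) + phi a (s - m) (h a m x) else 0) +
      (if 0 < m then h a (- m) (phi a (s + m) y) + phi a (s - m) (h a m y) else 0))"
    unfolding casimir_comm_def by (rule Sum_any.cong) (simp add: X_add good_h phi_add)
  then show "casimir_comm a s (x + y) = casimir_comm a s x + casimir_comm a s y"
    by (simp only: Sum_any.distrib finite_casimir_comm casimir_comm_def)
qed

lemma casimir_bar: "casimir (bar a) x = casimir a x"
  unfolding casimir_def
  by (rule Sum_any.cong) (simp add: h_bar[unfolded bar_bar] X_swap[of a "bar a"] good_h X_minus)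

lemma casimir_phi: "casimir a (phi a s x) = phi a s (casimir a x) + casimir_comm a s x"
proof -
  have fin: "finite {m. phi a s (if 0 < m then h a (- m) (h a m x) else 0) \<noteq> 0}"
    by (rule finite_subset[OF _ finite_casimir[of a x]]) auto
  have "casimir a (phi a s x) = Sum_any (\<lambda>m. phi a s (if 0 < m then h a (- m) (h a m x) else 0) +
      (if 0 < m then h a (- m) (phi a (s + m) x) + phi a (s - m) (h a m x) else 0))"
    unfolding casimir_def
    by (rule Sum_any.cong) (simp add: X_phi good_h X_add phi_add add_ac)
  also have "\<dots> = phi a s (casimir a x) + casimir_comm a s x"
    unfolding casimir_def casimir_comm_def
    by (subst Sum_any.distrib[OF fin finite_casimir_comm], subst phi_Sum_any[OF finite_casimir]) simp
  finally show ?thesis .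
qed

lemma casimir_phi_other:
  assumes "c \<noteq> a" "c \<noteq> bar a"
  shows "casimir a (phi c s x) = phi c s (casimir a x)"
proof -
  have "casimir a (phi c s x) = Sum_any (\<lambda>m. phi c s (if 0 < m then h a (- m) (h a m x) else 0))"
    unfolding casimir_def
    by (rule Sum_any.cong) (use assms in \<open>simp add: X_phi good_h\<close>)
  then show ?thesis
    unfolding casimir_def by (simp only: phi_Sum_any[OF finite_casimir])
qed

section \<open>Occupation numbers\<close>

definition occ :: "colour \<Rightarrow> int \<Rightarrow> state \<Rightarrow> int" where
  "occ a r S = (if r < \<theta> a then if (a, r) |\<in>| S then 1 else 0
     else if (bar a, p - r) |\<in>| S then 0 else 1)"

lemma phi_phi_occ: "phi a r (phi (bar a) (p - r) x) = diagop (\<lambda>S. of_int (occ a r S)) x"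
  by (rule poly_mapping_eqI)
    (use theta_star[of r a] in \<open>auto simp: lookup_phi occ_def finsert_absorb sg_finsert sg_fminus\<close>)

text \<open>The subtracted term is the occupation number in the vacuum, which is 1 exactly for
  \<open>r \<ge> \<theta> a\<close>. What remains counts the modes of colour \<open>a\<close>
  positively and those of colour \<open>bar a\<close> negatively.\<close>

lemma Sum_any_occ:
  assumes "cstate S"
  shows "finite {r. occ a r S - (if r < \<theta> a then 0 else 1) \<noteq> 0}"
    and "Sum_any (\<lambda>r. occ a r S - (if r < \<theta> a then 0 else 1)) = weight (colour_charge a) S"
proof -
  let ?A = "{r. (a, r) |\<in>| S}" and ?B = "{r. (bar a, r) |\<in>| S}"
  have finA: "finite ?A" and finB: "finite ?B"
    by (rule finite_subset[of _ "snd ` fset S"]; force)+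
  let ?f = "\<lambda>r. if (a, r) |\<in>| S then 1 else 0 :: int"
  let ?g = "\<lambda>r. if (bar a, r) |\<in>| S then 1 else 0 :: int"
  have bij: "bij (\<lambda>r. p - r)"
    by (rule bij_betw_byWitness[where f' = "\<lambda>r. p - r"]) auto
  have eq: "occ a r S - (if r < \<theta> a then 0 else 1) = ?f r - ?g (p - r)" for r
    using assms theta_star[of r a] by (auto simp: occ_def cstate_def)
  have fin: "finite {r. ?f r \<noteq> 0}" using finA by simp
  have "{r. ?g (p - r) \<noteq> 0} = (\<lambda>r. p - r) ` ?B"
    by (auto simp: image_iff intro: exI[of _ "p - _"] split: if_splits) force
  then have fin': "finite {r. ?g (p - r) \<noteq> 0}" using finB by simp
  show "finite {r. occ a r S - (if r < \<theta> a then 0 else 1) \<noteq> 0}"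
    unfolding eq by (rule finite_neq_add(2)[OF fin fin'])
  have "Sum_any (\<lambda>r. occ a r S - (if r < \<theta> a then 0 else 1)) = Sum_any ?f - Sum_any (\<lambda>r. ?g (p - r))"
    unfolding eq by (rule Sum_any_diff[OF fin fin'])
  also have "Sum_any (\<lambda>r. ?g (p - r)) = Sum_any ?g"
    by (rule Sum_any.reindex_cong[OF bij, symmetric]) auto
  also have "Sum_any ?f = int (card ?A)"
    by (simp add: Sum_any.expand_set)
  also have "Sum_any ?g = int (card ?B)"
    by (simp add: Sum_any.expand_set)
  also have "int (card ?A) = (\<Sum>u\<in>fset S. if fst u = a then 1 else 0)"
  proof -
    have "card ?A = card {u \<in> fset S. fst u = a}"
      by (rule bij_betw_same_card[of "\<lambda>r. (a, r)"]) (auto simp: bij_betw_def inj_on_def)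
    then show ?thesis by (simp flip: sum.inter_filter)
  qed
  also have "int (card ?B) = (\<Sum>u\<in>fset S. if fst u = bar a then 1 else 0)"
  proof -
    have "card ?B = card {u \<in> fset S. fst u = bar a}"
      by (rule bij_betw_same_card[of "\<lambda>r. (bar a, r)"]) (auto simp: bij_betw_def inj_on_def)
    then show ?thesis by (simp flip: sum.inter_filter)
  qed
  finally show "Sum_any (\<lambda>r. occ a r S - (if r < \<theta> a then 0 else 1)) = weight (colour_charge a) S"
    by (simp add: weight_def colour_charge_def sum_subtractf)
qed

text \<open>Subtracting the vacuum occupation numbers splits the sum into a charge part and a purely
  numerical part. The numerical part counts, with sign, the integers between \<open>s\<close> and
  \<open>\<theta> a\<close>.\<close>

lemma Sum_any_occ_diff:
  assumes "cstate S"
  shows "finite {m. (if 0 < m then 1 - occ a (s + m) S - occ a (s - m) S else 0) \<noteq> 0}"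
    and "Sum_any (\<lambda>m. if 0 < m then 1 - occ a (s + m) S - occ a (s - m) S else 0)
      = - weight (colour_charge a) S - (1 - occ a s S) - (s - \<theta> a)"
proof -
  let ?f = "\<lambda>r. occ a r S - (if r < \<theta> a then 0 else 1)"
  let ?k = "\<lambda>m. if 0 < m then 1 - (if s + m < \<theta> a then 0 else 1) - (if s - m < \<theta> a then 0 else 1) else 0 :: int"
  have bij: "bij (\<lambda>r. s + r)"
    by (rule bij_betw_byWitness[where f' = "\<lambda>r. r - s"]) auto
  have fin: "finite {m. ?f (s + m) \<noteq> 0}"
  proof -
    have "{m. ?f (s + m) \<noteq> 0} \<subseteq> (\<lambda>r. r - s) ` {r. ?f r \<noteq> 0}"
      by (intro subsetI, rule_tac x = "s + x" in image_eqI) auto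
    then show ?thesis using Sum_any_occ(1)[OF assms, of a] finite_surj by blast
  qed
  have fink: "finite {m. ?k m \<noteq> 0}"
    by (rule finite_subset[of _ "{0..\<bar>s - \<theta> a\<bar>}"]) (auto split: if_splits)
  have k: "Sum_any ?k = (if s < \<theta> a then \<theta> a - s - 1 else - (s - \<theta> a))"
  proof (cases "s < \<theta> a")
    case True
    have "Sum_any ?k = sum ?k {1..\<theta> a - s - 1}"
      using True by (intro Sum_any.expand_superset) (auto split: if_splits)
    also have "\<dots> = (\<Sum>m\<in>{1..\<theta> a - s - 1}. 1)" by (rule sum.cong) auto
    finally show ?thesis using True by simp
  next
    case False
    have "Sum_any ?k = sum ?k {1..s - \<theta> a}"
      using False by (intro Sum_any.expand_superset) (auto split: if_splits)
    also have "\<dots> = (\<Sum>m\<in>{1..s - \<theta> a}. - 1)" using False by (intro sum.cong) auto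
    finally show ?thesis using False by simp
  qed
  have p: "Sum_any (\<lambda>m. if 0 < m then ?f (s + m) + ?f (s + - m) else 0) = weight (colour_charge a) S - ?f s"
  proof -
    have "Sum_any (\<lambda>m. ?f (s + m)) = Sum_any ?f"
      by (rule Sum_any.reindex_cong[OF bij, symmetric]) auto
    then show ?thesis
      using Sum_any_pos[OF fin] Sum_any_occ(2)[OF assms, of a] by simp
  qed
  have finp: "finite {m. (if 0 < m then ?f (s + m) + ?f (s + - m) else 0) \<noteq> 0}"
  proof (rule finite_subset)
    show "{m. (if 0 < m then ?f (s + m) + ?f (s + - m) else 0) \<noteq> 0} \<subseteq>
        {m. ?f (s + m) \<noteq> 0} \<union> uminus ` {m. ?f (s + m) \<noteq> 0}"
    proof
      fix m assume "m \<in> {m. (if 0 < m then ?f (s + m) + ?f (s + - m) else 0) \<noteq> 0}"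
      then have "?f (s + m) \<noteq> 0 \<or> ?f (s + - m) \<noteq> 0" by (simp split: if_splits)
      then show "m \<in> {m. ?f (s + m) \<noteq> 0} \<union> uminus ` {m. ?f (s + m) \<noteq> 0}"
      proof
        assume "?f (s + - m) \<noteq> 0"
        then have "- (- m) \<in> uminus ` {m. ?f (s + m) \<noteq> 0}" by (intro imageI) simp
        then show ?thesis by simp
      qed simp
    qed
  qed (use fin in simp)
  have eq: "(if 0 < m then 1 - occ a (s + m) S - occ a (s - m) S else 0) =
      ?k m - (if 0 < m then ?f (s + m) + ?f (s + - m) else 0)" for m
    by simp
  show "finite {m. (if 0 < m then 1 - occ a (s + m) S - occ a (s - m) S else 0) \<noteq> 0}"
    unfolding eq by (rule finite_neq_add(2)[OF fink finp])
  have "Sum_any (\<lambda>m. if 0 < m then 1 - occ a (s + m) S - occ a (s - m) S else 0)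
      = Sum_any ?k - (weight (colour_charge a) S - ?f s)"
    unfolding eq by (subst Sum_any_diff[OF fink finp], subst p) simp
  then show "Sum_any (\<lambda>m. if 0 < m then 1 - occ a (s + m) S - occ a (s - m) S else 0)
      = - weight (colour_charge a) S - (1 - occ a s S) - (s - \<theta> a)"
    unfolding k by (simp split: if_splits)
qed

lemma fockspace_add: "x \<in> fockspace \<Longrightarrow> y \<in> fockspace \<Longrightarrow> x + y \<in> fockspace"
  unfolding fockspace_def using keys_add[of x y] by blast

lemma fockspace_diagop: "x \<in> fockspace \<Longrightarrow> diagop d x \<in> fockspace"
  by (auto simp: fockspace_def in_keys_iff)

lemma fockspace_pscale: "x \<in> fockspace \<Longrightarrow> pscale c x \<in> fockspace"
  by (auto simp: fockspace_def in_keys_iff)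

lemma fockspace_Sum_any: "(\<And>r. g r \<in> fockspace) \<Longrightarrow> Sum_any g \<in> fockspace"
  unfolding fockspace_def by (blast elim: keys_Sum_any)

lemma fockspace_zero: "0 \<in> fockspace"
  by (simp add: fockspace_def)

lemma of_int_weight_colour_charge:
  "of_int (weight (colour_charge a) S) = (weight (colour_charge a) S :: complex)"
  by (auto simp: weight_def colour_charge_def intro!: sum.cong)

text \<open>With \<open>r = s + m\<close>, the two-sided sum over \<open>m\<close> is the sum
  defining \<open>X\<close>; the subtracted product is its term at \<open>m = 0\<close>.\<close>

lemma Sum_any_phi_phi:
  fixes s s' :: int
  assumes "good a e (s + s' - p)"
  shows "finite {m. (if 0 < m then phi a (s + m) (phi e (s' - m) x) + phi a (s - m) (phi e (s' + m) x) else 0) \<noteq> 0}"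
    and "Sum_any (\<lambda>m. if 0 < m then phi a (s + m) (phi e (s' - m) x) + phi a (s - m) (phi e (s' + m) x) else 0)
     = X a e (s + s' - p) x - phi a s (phi e s' x)"
proof -
  let ?g = "\<lambda>m. phi a (s + m) (phi e (s' - m) x)"
  have bij: "bij (\<lambda>r. s + r)"
    by (rule bij_betw_byWitness[where f' = "\<lambda>r. r - s"]) auto
  have f: "finite {m. ?g m \<noteq> 0}"
  proof -
    have "{m. ?g m \<noteq> 0} \<subseteq> (\<lambda>r. r - s) ` {r. phi a r (phi e (s + s' - p + p - r) x) \<noteq> 0}"
      by (intro subsetI, rule_tac x = "s + xa" in image_eqI) (auto simp: algebra_simps)
    then show ?thesis using finite_X[OF assms, of x] finite_surj by blast
  qed
  have "{m. (if 0 < m then phi a (s + m) (phi e (s' - m) x) + phi a (s - m) (phi e (s' + m) x) else 0) \<noteq> 0}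
      \<subseteq> {m. ?g m \<noteq> 0} \<union> uminus ` {m. ?g m \<noteq> 0}"
  proof
    fix m assume "m \<in> {m. (if 0 < m then phi a (s + m) (phi e (s' - m) x) + phi a (s - m) (phi e (s' + m) x) else 0) \<noteq> 0}"
    then have "?g m \<noteq> 0 \<or> ?g (- m) \<noteq> 0" by (auto split: if_splits)
    then show "m \<in> {m. ?g m \<noteq> 0} \<union> uminus ` {m. ?g m \<noteq> 0}"
    proof
      assume "?g (- m) \<noteq> 0"
      then have "- (- m) \<in> uminus ` {m. ?g m \<noteq> 0}" by (intro imageI) simp
      then show ?thesis by simp
    qed simp
  qed
  then show "finite {m. (if 0 < m then phi a (s + m) (phi e (s' - m) x) + phi a (s - m) (phi e (s' + m) x) else 0) \<noteq> 0}"
    by (rule finite_subset) (use f in simp)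
  have "Sum_any ?g = X a e (s + s' - p) x"
    unfolding X_def by (rule Sum_any.reindex_cong[OF bij, symmetric]) (auto simp: algebra_simps)
  then show "Sum_any (\<lambda>m. if 0 < m then phi a (s + m) (phi e (s' - m) x) + phi a (s - m) (phi e (s' + m) x) else 0)
     = X a e (s + s' - p) x - phi a s (phi e s' x)"
    using Sum_any_pos[OF f]
    by (simp only: add_uminus_conv_diff diff_minus_eq_add add_0_right diff_0_right)
qed

text \<open>
  The difference of the two sides, as an operator on \<open>x\<close>, anticommutes with all \<open>phi c s'\<close>; it maps
  the vacuum to a multiple of the vacuum, which is zero because the operator changes the charge.
\<close>

lemma casimir_comm_eq:
  assumes x: "x \<in> fockspace"
  shows "casimir_comm a s x =
    - diagop (weight (colour_charge a)) (phi a s x) - pscale (of_int (s - \<theta> a)) (phi a s x)"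
proof -
  let ?Q = "diagop (weight (colour_charge a))"
  define k where "k = (of_int (s - \<theta> a) :: complex)"
  define T where "T x = casimir_comm a s x + ?Q (phi a s x) + pscale k (phi a s x)" for x
  have add: "additive_op T"
    unfolding T_def by (rule additive_opI)
      (simp add: additive_op_add[OF additive_op_casimir_comm] phi_add
        additive_op_add[OF additive_op_diagop] F.scale_right_distrib)
  let ?b = "\<lambda>x m. if 0 < m then h a (- m) (phi a (s + m) x) + phi a (s - m) (h a m x) else 0"
  have fp: "finite {m. phi c s' (?b x m) \<noteq> 0}" for c s' x
    by (rule finite_subset[OF _ finite_casimir_comm[of a s x]]) auto
  have sum2: "casimir_comm a s (phi c s' x) + phi c s' (casimir_comm a s x) =
      Sum_any (\<lambda>m. ?b (phi c s' x) m + phi c s' (?b x m))" for c s' x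
    unfolding casimir_comm_def
    by (subst Sum_any.distrib[OF finite_casimir_comm fp], subst phi_Sum_any[OF finite_casimir_comm]) simp
  have fin2: "finite {m. ?b (phi c s' x) m + phi c s' (?b x m) \<noteq> 0}" for c s' x
    by (rule finite_neq_add(1)[OF finite_casimir_comm fp])
  have phiQ: "phi c s' (?Q x) = ?Q (phi c s' x) - pscale (colour_charge a (c, s')) (phi c s' x)" for c s' x
    using diagop_phi[OF odd_colour_charge[of a], of c s' x] by (simp add: eq_diff_eq)
  have master: "T (phi c s' x) + phi c s' (T x) =
     (casimir_comm a s (phi c s' x) + phi c s' (casimir_comm a s x))
     + ?Q (phi a s (phi c s' x) + phi c s' (phi a s x)) - pscale (colour_charge a (c, s')) (phi c s' (phi a s x))
     + pscale k (phi a s (phi c s' x) + phi c s' (phi a s x))" for c s' x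
    by (simp add: T_def phi_add phi_pscale phiQ additive_op_add[OF additive_op_diagop]
        F.scale_right_distrib algebra_simps)
  have anti: "T (phi c s' x) + phi c s' (T x) = 0" if x: "x \<in> fockspace" for c s' x
  proof -
    consider (same) "c = a" | (bar) "c = bar a" "s' \<noteq> p - s" | (bar0) "c = bar a" "s' = p - s"
      | (other) "c \<noteq> a" "c \<noteq> bar a" by blast
    then show ?thesis
    proof cases
      case same
      have "?b (phi a s' x) m + phi a s' (?b x m) =
          (if 0 < m then phi a (s + m) (phi a (s' - m) x) + phi a (s - m) (phi a (s' + m) x) else 0)" for m
        by (simp add: X_phi X_add X_diff X_minus good_h phi_add phi_diff CAR'[of a s' a] add.commute)
      then have "casimir_comm a s (phi a s' x) + phi a s' (casimir_comm a s x) =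
          Sum_any (\<lambda>m. if 0 < m then phi a (s + m) (phi a (s' - m) x) + phi a (s - m) (phi a (s' + m) x) else 0)"
        unfolding sum2 by (rule Sum_any.cong)
      also have "\<dots> = - phi a s (phi a s' x)"
        by (subst Sum_any_phi_phi(2)) (auto simp: good_def)
      finally show ?thesis
        unfolding same master
        by (simp add: colour_charge_def CAR[of a s a s'] CAR'[of a s' a s] additive_op_zero[OF additive_op_diagop])
    next
      case bar
      define d where "d = s + s' - p"
      have d: "d \<noteq> 0" using bar by (simp add: d_def)
      let ?p = "\<lambda>m. if 0 < m then phi a (s + m) (phi (bar a) (s' - m) x) + phi a (s - m) (phi (bar a) (s' + m) x) else 0"
      \<comment> \<open>Contractions occur only for \<open>m = d\<close> and \<open>m = - d\<close>,
        and exactly one of these is positive. They leave a single \<open>h a d x\<close>, which will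
        cancel the one coming from the two-sided sum.\<close>
      have *: "?b (phi (bar a) s' x) m + phi (bar a) s' (?b x m) = (if m = \<bar>d\<bar> then h a d x else 0) - ?p m" for m
      proof (cases "0 < m")
        case True
        have e: "s + m = p - s' \<longleftrightarrow> m = - d" "s - m = p - s' \<longleftrightarrow> m = d"
          "s' = p - (s + m) \<longleftrightarrow> m = - d" "s' = p - (s - m) \<longleftrightarrow> m = d" by (auto simp: d_def)
        have a1: "m = \<bar>d\<bar> \<longleftrightarrow> m = d \<or> m = - d" using True by auto
        have nn: "\<not> (m = d \<and> m = - d)" using True by auto
        have c1: "phi (bar a) (s' - m) (phi a (s + m) x) = - phi a (s + m) (phi (bar a) (s' - m) x)"
          using bar by (subst CAR') auto
        have c2: "phi (bar a) s' (phi a (s + m) x) = (if m = - d then x else 0) - phi a (s + m) (phi (bar a) s' x)"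
          by (subst CAR') (auto simp: d_def)
        have c3: "phi (bar a) s' (phi a (s - m) y) = (if m = d then y else 0) - phi a (s - m) (phi (bar a) s' y)" for y
          by (subst CAR') (auto simp: d_def)
        have c4: "phi (bar a) s' (h a (- m) y) = h a (- m) (phi (bar a) s' y) + phi (bar a) (s' - m) y" for y
          using True by (simp add: X_phi good_h add.commute)
        have c5: "h a m (phi (bar a) s' x) = phi (bar a) s' (h a m x) - phi (bar a) (s' + m) x"
          using True by (simp add: X_phi good_h add.commute)
        show ?thesis
          using True nn by (simp add: c1 c2 c3 c4 c5 a1 phi_add phi_diff X_add X_diff X_zero good_h)
      next
        case False
        then have "m \<noteq> \<bar>d\<bar>" using d by auto
        then show ?thesis using False by simp
      qed
      have fp': "finite {m. ?p m \<noteq> 0}"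
        by (rule Sum_any_phi_phi(1)) (use d in \<open>simp add: good_def d_def\<close>)
      have fd: "finite {m. (if m = \<bar>d\<bar> then h a d x else 0) \<noteq> 0}"
        by (rule finite_subset[of _ "{\<bar>d\<bar>}"]) auto
      have "casimir_comm a s (phi (bar a) s' x) + phi (bar a) s' (casimir_comm a s x) =
          Sum_any (\<lambda>m. (if m = \<bar>d\<bar> then h a d x else 0) - ?p m)"
        unfolding sum2 by (rule Sum_any.cong) (rule *)
      also have "\<dots> = h a d x - Sum_any ?p"
        by (subst Sum_any_diff[OF fd fp']) simp
      also have "Sum_any ?p = h a d x - phi a s (phi (bar a) s' x)"
        unfolding d_def by (rule Sum_any_phi_phi(2)) (use d in \<open>simp add: good_def d_def\<close>)
      finally have "casimir_comm a s (phi (bar a) s' x) + phi (bar a) s' (casimir_comm a s x) =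
          phi a s (phi (bar a) s' x)" by simp
      then show ?thesis
        unfolding bar(1) master using bar(2)
        by (simp add: colour_charge_def CAR[of a s "bar a" s'] additive_op_zero[OF additive_op_diagop])
    next
      case bar0
      let ?o = "\<lambda>m S. if 0 < m then 1 - occ a (s + m) S - occ a (s - m) S else 0"
      \<comment> \<open>For conjugate indices each remaining product is a diagonal number operator,
        so the sum over \<open>m\<close> can be evaluated state by state.\<close>
      have *: "?b (phi (bar a) s' x) m + phi (bar a) s' (?b x m) = diagop (\<lambda>S. of_int (?o m S)) x" for m
      proof (cases "0 < m")
        case True
        have "phi (bar a) (s' - m) (phi a (s + m) x) = x - phi a (s + m) (phi (bar a) (p - (s + m)) x)"
          by (subst CAR') (auto simp: bar0 algebra_simps)
        then have c1: "phi (bar a) (s' - m) (phi a (s + m) x) = x - diagop (\<lambda>S. of_int (occ a (s + m) S)) x"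
          by (simp only: phi_phi_occ)
        have c2: "phi (bar a) s' (phi a (s + m) x) = - phi a (s + m) (phi (bar a) s' x)"
          using True by (subst CAR') (auto simp: bar0)
        have c3: "phi (bar a) s' (phi a (s - m) y) = - phi a (s - m) (phi (bar a) s' y)" for y
          using True by (subst CAR') (auto simp: bar0)
        have c4: "phi (bar a) s' (h a (- m) y) = h a (- m) (phi (bar a) s' y) + phi (bar a) (s' - m) y" for y
          using True by (simp add: X_phi good_h add.commute)
        have c5: "h a m (phi (bar a) s' x) = phi (bar a) s' (h a m x) - phi (bar a) (s' + m) x"
          using True by (simp add: X_phi good_h add.commute)
        have "s' + m = p - (s - m)" by (simp add: bar0)
        then have c6: "phi a (s - m) (phi (bar a) (s' + m) x) = diagop (\<lambda>S. of_int (occ a (s - m) S)) x"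
          by (simp only: phi_phi_occ)
        have "?b (phi (bar a) s' x) m + phi (bar a) s' (?b x m) =
            phi (bar a) (s' - m) (phi a (s + m) x) - phi a (s - m) (phi (bar a) (s' + m) x)"
          using True by (simp add: c2 c3 c4 c5 phi_add phi_diff X_add X_minus good_h)
        also have "\<dots> = diagop (\<lambda>S. of_int (?o m S)) x"
          unfolding c1 c6 by (rule poly_mapping_eqI) (use True in \<open>simp add: lookup_minus lookup_add algebra_simps\<close>)
        finally show ?thesis .
      next
        case False
        then show ?thesis by (auto intro!: poly_mapping_eqI)
      qed
      let ?t = "casimir_comm a s (phi (bar a) s' x) + phi (bar a) s' (casimir_comm a s x)"
      have t: "?t = Sum_any (\<lambda>m. diagop (\<lambda>S. of_int (?o m S)) x)"
        unfolding sum2 by (rule Sum_any.cong) (rule *)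
      have "finite {m. ?b (phi (bar a) s' x) m + phi (bar a) s' (?b x m) \<noteq> 0}" by (rule fin2)
      then have fin: "finite {m. diagop (\<lambda>S. of_int (?o m S)) x \<noteq> 0}" unfolding * .
      have lt: "lookup ?t S =
          (of_int (- weight (colour_charge a) S - (1 - occ a s S) - (s - \<theta> a))) * lookup x S" for S
      proof (cases "cstate S")
        case True
        have "lookup ?t S = Sum_any (\<lambda>m. of_int (?o m S) * lookup x S)"
          unfolding t by (subst lookup_Sum_any[OF fin]) simp
        also have "\<dots> = of_int (Sum_any (\<lambda>m. ?o m S)) * lookup x S"
          by (rule additive_op_Sum_any[where T = "\<lambda>z. of_int z * lookup x S", symmetric])
            (simp add: additive_op_def distrib_right, rule Sum_any_occ_diff(1)[OF True])
        finally show ?thesis by (simp only: Sum_any_occ_diff(2)[OF True])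
      next
        case False
        then have z: "lookup x S = 0" using x by (auto simp: fockspace_def in_keys_iff)
        then show ?thesis unfolding t by (subst lookup_Sum_any[OF fin]) simp
      qed
      have ph: "phi (bar a) s' (phi a s x) = x - diagop (\<lambda>S. of_int (occ a s S)) x"
        using CAR'[of "bar a" s' a s x] by (simp add: bar0 phi_phi_occ)
      have car: "phi a s (phi (bar a) s' x) + phi (bar a) s' (phi a s x) = x"
        by (subst CAR) (simp add: bar0)
      define t where "t = ?t"
      show ?thesis
        unfolding master bar0(1) car t_def[symmetric]
        by (rule poly_mapping_eqI)
          (simp add: lookup_add lookup_minus lt[folded t_def] ph colour_charge_def
            of_int_weight_colour_charge k_def algebra_simps)
    next
      case other
      have "a \<noteq> bar c" using other by auto
      then have "?b (phi c s' x) m + phi c s' (?b x m) = 0" for m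
        using other
        by (simp add: X_phi X_add X_minus good_h phi_add CAR'[of c s' a])
      then have "casimir_comm a s (phi c s' x) + phi c s' (casimir_comm a s x) = 0"
        unfolding sum2 by simp
      then show ?thesis
        unfolding master using other \<open>a \<noteq> bar c\<close>
        by (simp add: colour_charge_def CAR[of a s c s'] additive_op_zero[OF additive_op_diagop])
    qed
  qed
  have "T x = 0"
  proof (rule operator_eq_0[OF add _ _ x])
    show "T (phi c s' x) = 0" if "x \<in> fockspace" "T x = 0" for c s' x
      using anti[OF that(1), of c s'] that(2) by simp
  next
    fix c :: complex
    let ?v = "single vac c"
    have v: "?v \<in> fockspace" by (rule single_in_fockspace) (simp add: cstate_def)
    have zero: "(0::fock) \<in> fockspace" by (rule fockspace_zero)
    have Tv: "T ?v \<in> fockspace"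
      unfolding T_def casimir_comm_def
      by (intro fockspace_add fockspace_diagop fockspace_pscale fockspace_Sum_any)
        (auto intro!: zero fockspace_add X_fockspace phi_fockspace v)
    have "T ?v = single vac (lookup (T ?v) vac)"
    proof (rule vacuum_unique[OF Tv])
      fix b r assume "\<theta> b \<le> r"
      then show "phi b r (T ?v) = 0"
        using anti[OF v, of b r] by (simp add: phi_vac additive_op_zero[OF add])
    qed
    moreover have "lookup (T ?v) vac = 0"
    proof -
      let ?c = "colour_charge a :: mode \<Rightarrow> int"
      have ph: "weight ?c S = 1" if "S \<in> keys (phi a r ?v)" for S r
        using that by (elim phi_weight[OF odd_colour_charge]) (auto simp: colour_charge_def split: if_splits)
      have hh: "\<exists>S'\<in>keys y. weight ?c S = weight ?c S'" if "S \<in> keys (h a m y)" for S m y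
        by (rule X_weight[OF odd_colour_charge _ that, of _ 0]) (auto simp: colour_charge_def)
      have "vac \<notin> keys (phi a s ?v)" using ph by force
      then have 1: "lookup (phi a s ?v) vac = 0" by (simp add: in_keys_iff)
      have "vac \<notin> keys (casimir_comm a s ?v)"
      proof
        assume "vac \<in> keys (casimir_comm a s ?v)"
        then obtain m where "vac \<in> keys (?b ?v m)"
          unfolding casimir_comm_def by (elim keys_Sum_any)
        then have "vac \<in> keys (h a (- m) (phi a (s + m) ?v)) \<or> vac \<in> keys (phi a (s - m) (h a m ?v))"
          using keys_add[of "h a (- m) (phi a (s + m) ?v)"] by (auto split: if_splits)
        then show False
        proof
          assume "vac \<in> keys (h a (- m) (phi a (s + m) ?v))"
          then show False using hh ph by force
        next
          assume "vac \<in> keys (phi a (s - m) (h a m ?v))"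
          then obtain S' where "S' \<in> keys (h a m ?v)" "weight ?c vac = ?c (a, s - m) + weight ?c S'"
            by (elim phi_weight[OF odd_colour_charge])
          with hh[of S' m ?v] show False by (auto simp: colour_charge_def split: if_splits)
        qed
      qed
      then have 2: "lookup (casimir_comm a s ?v) vac = 0" by (simp add: in_keys_iff)
      show ?thesis by (simp add: T_def lookup_add 1 2)
    qed
    ultimately show "T ?v = 0" by (simp add: single_zero)
  qed
  then show ?thesis by (simp add: T_def k_def algebra_simps eq_neg_iff_add_eq_0)
qed

text \<open>Both sides have the same commutators with all \<open>phi\<close> and vanish on the
  vacuum. The shift by 1/2 makes the mode energy odd under conjugation; it also compensates the
  constant 1/2 that arises when \<open>phi\<close> passes half the square of the charge.\<close>

lemma casimir_eq:
  assumes x: "x \<in> fockspace"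
  shows "casimir a x = diagop (\<lambda>S. weight (\<lambda>u. if fst (fst u) = fst a then of_int (\<theta> (fst u) - snd u) - 1 / 2 else 0) S
      - (weight (colour_charge a) S)\<^sup>2 / 2) x"
proof -
  let ?g = "\<lambda>u::mode. if fst (fst u) = fst a then of_int (\<theta> (fst u) - snd u) - 1 / 2 else 0 :: complex"
  let ?Q = "\<lambda>a. diagop (weight (colour_charge a))"
  have fst_eq: "fst c = fst a \<longleftrightarrow> c = a \<or> c = bar a" for c
    by (cases c; cases a) auto
  have odd: "odd_fun ?g"
    unfolding odd_fun_def by (auto simp: theta_bar simp del: split_paired_All)
  define T where "T x = casimir a x - (diagop (weight ?g) x - pscale (1 / 2) (?Q a (?Q a x)))" for x
  have add: "additive_op T"
    unfolding T_def by (rule additive_opI)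
      (simp add: additive_op_add[OF additive_op_casimir] additive_op_add[OF additive_op_diagop] F.scale_right_distrib)
  have Q: "?Q e (phi c s x) = phi c s (?Q e x) + pscale (colour_charge e (c, s)) (phi c s x)" for e c s x
    by (rule diagop_phi) simp
  have "colour_charge (bar a) u = (- colour_charge a u :: complex)" for u
    by (simp add: colour_charge_def)
  then have Qbar: "?Q (bar a) x = - ?Q a x" for x
    by (intro poly_mapping_eqI) (simp add: weight_def sum_negf)
  have comm: "T (phi c s x) = phi c s (T x)" if x: "x \<in> fockspace" for c s x
  proof -
    have G: "diagop (weight ?g) (phi c s x) = phi c s (diagop (weight ?g) x) + pscale (?g (c, s)) (phi c s x)"
      by (rule diagop_phi[OF odd])
    consider "c = a" | "c = bar a" | "c \<noteq> a" "c \<noteq> bar a" by blast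
    then show ?thesis
    proof cases
      case 1
      show ?thesis
        unfolding 1 T_def G[unfolded 1] casimir_phi casimir_comm_eq[OF x]
        by (rule poly_mapping_eqI)
          (simp add: Q phi_add phi_diff phi_pscale F.scale_right_distrib colour_charge_def
           additive_op_add[OF additive_op_diagop] lookup_add lookup_minus field_simps)
    next
      case 2
      have cb: "casimir a (phi (bar a) s x) = phi (bar a) s (casimir a x) + casimir_comm (bar a) s x"
        using casimir_phi[of "bar a" s x] by (simp add: casimir_bar)
      show ?thesis
        unfolding 2 T_def G[unfolded 2] cb casimir_comm_eq[OF x] Qbar
        by (intro poly_mapping_eqI)
          (simp add: Q phi_add phi_diff phi_pscale phi_minus F.scale_right_distrib colour_charge_def
           additive_op_add[OF additive_op_diagop] additive_op_diff[OF additive_op_diagop] lookup_add lookup_minus field_simps)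
    next
      case 3
      then show ?thesis
        unfolding T_def G
        by (simp add: casimir_phi_other Q fst_eq phi_diff phi_pscale colour_charge_def)
    qed
  qed
  have "T x = 0"
  proof (rule operator_eq_0[OF add _ _ x])
    show "T (phi c s x) = 0" if "x \<in> fockspace" "T x = 0" for c s x
      using comm[OF that(1), of c s] that(2) by simp
  next
    fix c :: complex
    let ?v = "single vac c"
    have "h a m ?v = 0" if "0 < m" for m
      by (rule X_vac) (use that in \<open>auto simp: good_def theta_bar\<close>)
    then have 1: "casimir a ?v = 0"
      unfolding casimir_def by (simp add: X_zero good_h cong: if_cong)
    have "diagop (weight f) ?v = 0" for f
      by (rule poly_mapping_eqI) (auto simp: lookup_single when_def)
    then show "T ?v = 0" by (simp add: T_def 1 additive_op_zero[OF additive_op_diagop])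
  qed
  then have "casimir a x = diagop (weight ?g) x - pscale (1 / 2) (?Q a (?Q a x))"
    by (simp add: T_def)
  also have "\<dots> = diagop (\<lambda>S. weight ?g S - (weight (colour_charge a) S)\<^sup>2 / 2) x"
    by (rule poly_mapping_eqI) (simp add: lookup_minus power2_eq_square algebra_simps)
  finally show ?thesis .
qed

text \<open>When the Heisenberg modes kill \<open>x\<close> and the charge is zero, the energies
  \<open>\<theta> - r - 1/2\<close> of the modes with this index sum to zero, although each of them
  is at least 1/2.\<close>

lemma no_modes_of_colour:
  assumes x: "x \<in> fockspace" and h: "\<And>m. 0 < m \<Longrightarrow> h a m x = 0"
    and S: "S \<in> keys x" and Q: "weight (colour_charge a) S = (0::int)"
    and u: "u |\<in>| S"
  shows "fst (fst u) \<noteq> fst a"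
proof
  assume ua: "fst (fst u) = fst a"
  let ?g = "\<lambda>u::mode. if fst (fst u) = fst a then of_int (\<theta> (fst u) - snd u) - 1 / 2 else 0 :: real"
  have "casimir a x = 0"
    unfolding casimir_def by (simp add: h X_zero good_h cong: if_cong)
  then have "lookup (casimir a x) S = 0" by simp
  then have "weight (\<lambda>u. if fst (fst u) = fst a then of_int (\<theta> (fst u) - snd u) - 1 / 2 else 0) S
      = (weight (colour_charge a) S)\<^sup>2 / (2::complex)"
    unfolding casimir_eq[OF x] using S by (simp add: in_keys_iff)
  also have "\<dots> = 0" using Q by (simp flip: of_int_weight_colour_charge)
  also have "weight (\<lambda>u. if fst (fst u) = fst a then of_int (\<theta> (fst u) - snd u) - 1 / 2 else 0) S
      = complex_of_real (weight ?g S)"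
    by (auto simp: weight_def intro!: sum.cong)
  finally have 0: "(\<Sum>u\<in>fset S. ?g u) = 0"
    unfolding of_real_eq_0_iff weight_def .
  have cs: "cstate S" using x S by (auto simp: fockspace_def)
  have "0 < (\<Sum>u\<in>fset S. ?g u)"
  proof (rule sum_pos2[OF _ u])
    have ge: "of_int (\<theta> (fst v) - snd v) \<ge> (1::real)" if "v |\<in>| S" for v
      using cs that unfolding cstate_def
      by (metis of_int_1_le_iff zle_diff1_eq int_one_le_iff_zero_less diff_gt_0_iff_gt)
    show "0 < ?g u" using ge[OF u] ua by simp
    show "0 \<le> ?g v" if "v \<in> fset S" for v using ge[of v] that by simp
  qed simp
  with 0 show False by simp
qed

end

section \<open>The action of the Chevalley generators on Fock space\<close>

abbreviation P :: "nat \<Rightarrow> colour" where "P k \<equiv> (k, True)"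
abbreviation M :: "nat \<Rightarrow> colour" where "M k \<equiv> (k, False)"

text \<open>The simple root \<open>\<alpha>\<^sub>i\<close> is \<open>aa n i + bb n i + mm i \<delta>\<close>, where \<open>P k\<close>, \<open>M k\<close> stand for \<open>\<epsilon>\<^sub>k\<close>, \<open>- \<epsilon>\<^sub>k\<close>.\<close>

definition aa :: "nat \<Rightarrow> nat \<Rightarrow> colour" where
  "aa n i = (if i = 0 then M 1 else if i = n then P (n - 1) else P i)"

definition bb :: "nat \<Rightarrow> nat \<Rightarrow> colour" where
  "bb n i = (if i = 0 then M 2 else if i = n then P n else M (i + 1))"

definition mm :: "nat \<Rightarrow> int" where
  "mm i = (if i = 0 then 1 else 0)"

lemma hin_pscale_left: "hin (pscale c x) y = c * hin x y"
  by (metis hin_commute hin_pscale_right complex_cnj_cnj complex_cnj_mult)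

text \<open>Every mode contributes 1 or -1 to the total charge. This is the bridge between the
  parity of the exponents of the c-variables and the parity of the number of modes.\<close>

lemma charge_sum_parity:
  assumes "\<forall>u\<in>fset S. fst (fst u) \<in> {1..n}"
  shows "even (\<Sum>k=1..n. \<Sum>u\<in>fset S. colour_charge (P k) u :: int) \<longleftrightarrow> even (fcard S)"
proof -
  have one: "(\<Sum>k=1..n. colour_charge (P k) u :: int) = (if snd (fst u) then 1 else -1)"
    if "fst (fst u) \<in> {1..n}" for u
  proof -
    have "(\<Sum>k=1..n. colour_charge (P k) u :: int) =
        (\<Sum>k=1..n. if k = fst (fst u) then if snd (fst u) then 1 else -1 else 0)"
      by (rule sum.cong) (auto simp: colour_charge_def prod_eq_iff)
    also have "\<dots> = (if snd (fst u) then 1 else -1)" using that by simp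
    finally show ?thesis .
  qed
  have "(\<Sum>k=1..n. \<Sum>u\<in>fset S. colour_charge (P k) u :: int) = (\<Sum>u\<in>fset S. \<Sum>k=1..n. colour_charge (P k) u)"
    by (rule sum.swap)
  also have "\<dots> = (\<Sum>u\<in>fset S. if snd (fst u) then 1 else -1)"
    using assms one by (intro sum.cong) auto
  also have "even \<dots> \<longleftrightarrow> even (card (fset S))"
  proof -
    have "even (\<Sum>u\<in>A. if snd (fst u) then 1 else -1 :: int) \<longleftrightarrow> even (card A)" if "finite A" for A :: "mode set"
      using that by induction auto
    then show ?thesis by simp
  qed
  finally show ?thesis by (simp add: fcard.rep_eq)
qed

text \<open>
  \<open>level\<close> makes the vacuum a singular vector of level one, and \<open>dominant\<close> says that no state with an
  even number of modes and dominant weight has nonzero charges \<open>N k\<close>. By \<open>energy\<close> only the top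
  creation mode of a colour can have a negative \<open>q\<close>-exponent, namely \<open>- 1\<close>.
\<close>

locale D_fock = clifford p \<theta> for p :: int and \<theta> :: "colour \<Rightarrow> int" +
  fixes n :: nat
  assumes n: "4 \<le> n"
    and level: "i \<le> n \<Longrightarrow> mm i + p + 1 - \<theta> (aa n i) - \<theta> (bb n i) \<in> {0, 1}"
    and dominant: "\<And>N k. even (\<Sum>k=1..n. N k) \<Longrightarrow>
      \<forall>i\<le>n. 0 \<le> mm i + p + 1 - \<theta> (aa n i) - \<theta> (bb n i)
        + (if snd (aa n i) then N (fst (aa n i)) else - N (fst (aa n i)))
        + (if snd (bb n i) then N (fst (bb n i)) else - N (fst (bb n i))) \<Longrightarrow>
      k \<in> {1..n} \<Longrightarrow> N k = (0::int)"
    and height: "fst a \<in> {1..n} \<Longrightarrow> r < \<theta> a \<Longrightarrow>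
      2 * (int n - int (fst a)) * (if snd a then 1 else - 1) + (2 * r - p) * (2 * int n - 2) \<le> 0"
    and energy: "fst a \<in> {1..n} \<Longrightarrow> 2 * \<theta> a \<le> p + 3"
begin

text \<open>The eigenvalue of the i-th simple coroot on the vacuum, which is also the number of
  pairs of modes that \<open>F i\<close> can create from the vacuum.\<close>

definition const :: "nat \<Rightarrow> int" where
  "const i = mm i + p + 1 - \<theta> (aa n i) - \<theta> (bb n i)"

definition E :: "nat \<Rightarrow> fock \<Rightarrow> fock" where
  "E i = X (aa n i) (bb n i) (mm i)"

definition F :: "nat \<Rightarrow> fock \<Rightarrow> fock" where
  "F i = X (bar (bb n i)) (bar (aa n i)) (- mm i)"

lemma fst_ne: "i \<le> n \<Longrightarrow> fst (aa n i) \<noteq> fst (bb n i)"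
  using n by (auto simp: aa_def bb_def)

lemma fst_range: "i \<le> n \<Longrightarrow> fst (aa n i) \<in> {1..n}" "i \<le> n \<Longrightarrow> fst (bb n i) \<in> {1..n}"
  using n by (auto simp: aa_def bb_def)

lemma good_fst: "fst a \<noteq> fst b \<Longrightarrow> good a b m"
  by (auto simp: good_def)

lemma good_E: "i \<le> n \<Longrightarrow> good (aa n i) (bb n i) m"
  by (rule good_fst[OF fst_ne])

lemma good_F: "i \<le> n \<Longrightarrow> good (bar (bb n i)) (bar (aa n i)) m"
  using fst_ne[of i] by (intro good_fst) auto

lemma E_F_comm_eq:
  assumes "i \<le> n" "x \<in> fockspace"
  shows "E i (F i x) = F i (E i x) + diagop (weight (colour_charge (aa n i))) x
     + diagop (weight (colour_charge (bb n i))) x + pscale (of_int (const i)) x"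
  unfolding E_def F_def
  by (rule X_central) (use assms fst_ne level in \<open>auto simp: const_def\<close>)

lemma E_F_comm_neq:
  assumes "i \<le> n" "j \<le> n" "i \<noteq> j"
  shows "E i (F j x) = F j (E i x)"
proof -
  have "X (aa n i) (bb n i) (mm i) (X (bar (bb n j)) (bar (aa n j)) (- mm j) x)
     = X (bar (bb n j)) (bar (aa n j)) (- mm j) (X (aa n i) (bb n i) (mm i) x)
    + (if bar (bb n j) = bar (bb n i) then X (aa n i) (bar (aa n j)) (mm i + - mm j) x else 0)
    - (if bar (bb n j) = bar (aa n i) then X (bb n i) (bar (aa n j)) (mm i + - mm j) x else 0)
    + (if bar (aa n j) = bar (bb n i) then X (bar (bb n j)) (aa n i) (mm i + - mm j) x else 0)
    - (if bar (aa n j) = bar (aa n i) then X (bar (bb n j)) (bb n i) (mm i + - mm j) x else 0)"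
    using assms n
    by (intro X_comm good_E good_F assms)
      (auto simp: good_def aa_def bb_def mm_def split: if_splits)
  \<comment> \<open>Contractions arise only between the nodes 0 and 1 and between the nodes n-1 and
    n. There the resulting operator pairs a colour with itself, and \<open>X_same\<close> makes it
    zero.\<close>
  also have "\<dots> = X (bar (bb n j)) (bar (aa n j)) (- mm j) (X (aa n i) (bb n i) (mm i) x)"
    using assms n by (auto simp: aa_def bb_def mm_def split: if_splits)
  finally show ?thesis by (simp add: E_def F_def)
qed

section \<open>The even sector and its grading\<close>

definition states :: "state set" where
  "states = {S. cstate S \<and> (\<forall>u\<in>fset S. fst (fst u) \<in> {1..n}) \<and> even (fcard S)}"

definition fock_even :: "fock set" where
  "fock_even = {x. keys x \<subseteq> states}"

lemma fock_even_fockspace: "x \<in> fock_even \<Longrightarrow> x \<in> fockspace"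
  by (auto simp: fock_even_def fockspace_def states_def)

lemma fock_even_single: "S \<in> states \<Longrightarrow> single S c \<in> fock_even"
  by (simp add: fock_even_def)

lemma vac_in_states: "vac \<in> states"
  by (simp add: states_def cstate_def fcard.rep_eq)

lemma X_fock_even:
  assumes x: "x \<in> fock_even" and ab: "fst a \<in> {1..n}" "fst b \<in> {1..n}"
  shows "X a b m x \<in> fock_even"
proof -
  let ?P = "\<lambda>e S. cstate S \<and> (\<forall>u\<in>fset S. fst (fst u) \<in> {1..n}) \<and> even (fcard S) = e"
  have step: "\<forall>S\<in>keys (phi a r y). ?P (\<not> e) S"
    if "\<forall>S\<in>keys y. ?P e S" "fst a \<in> {1..n}" for a r e and y :: fock
  proof
    fix S assume "S \<in> keys (phi a r y)"
    then show "?P (\<not> e) S"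
    proof (cases rule: phi_keys)
      case (1 S')
      with that(1) have "?P e S'" by blast
      with 1 that(2) show ?thesis by (auto simp: cstate_def fcard_finsert_disjoint)
    next
      case (2 S')
      with that(1) have "?P e S'" by blast
      with 2 show ?thesis by (auto simp: cstate_def fcard_finsert_disjoint)
    qed
  qed
  have "\<forall>S\<in>keys x. ?P True S" using x by (auto simp: fock_even_def states_def)
  from step[OF step[OF this ab(2)] ab(1)]
  have "\<forall>S\<in>keys (phi a r (phi b s x)). ?P True S" for r s by simp
  then show ?thesis
    unfolding fock_even_def X_def states_def by (auto elim!: keys_Sum_any)
qed

lemma E_fock_even: "i \<le> n \<Longrightarrow> x \<in> fock_even \<Longrightarrow> E i x \<in> fock_even"
  unfolding E_def by (intro X_fock_even fst_range)

lemma F_fock_even: "i \<le> n \<Longrightarrow> x \<in> fock_even \<Longrightarrow> F i x \<in> fock_even"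
  unfolding F_def by (intro X_fock_even) (use fst_range in auto)

lemma additive_op_E: "i \<le> n \<Longrightarrow> additive_op (E i)"
  unfolding E_def by (intro additive_op_X good_E)

lemma additive_op_F: "i \<le> n \<Longrightarrow> additive_op (F i)"
  unfolding F_def by (intro additive_op_X good_F)

lemma E_pscale: "i \<le> n \<Longrightarrow> E i (pscale c x) = pscale c (E i x)"
  unfolding E_def by (intro X_pscale good_E)

lemma F_pscale: "i \<le> n \<Longrightarrow> F i (pscale c x) = pscale c (F i x)"
  unfolding F_def by (intro X_pscale good_F)

lemma E_vac: "i \<le> n \<Longrightarrow> E i (single vac c) = 0"
  unfolding E_def using level[of i] by (intro X_vac good_E) auto

lemma hin_E: "i \<le> n \<Longrightarrow> hin x (E i y) = hin (F i x) y"
  unfolding E_def F_def using hin_X[OF good_F, of i "- mm i" x y] by simp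

lemma hin_F: "i \<le> n \<Longrightarrow> hin x (F i y) = hin (E i x) y"
  unfolding E_def F_def using hin_X[OF good_E, of i "mm i" x y] by simp

text \<open>The grading for which all raising operators \<open>E i\<close> have degree \<open>2\<close>.\<close>

definition ht :: "mode \<Rightarrow> int" where
  "ht u = 2 * (int n - int (fst (fst u))) * (if snd (fst u) then 1 else - 1) + (2 * snd u - p) * (2 * int n - 2)"

definition en :: "mode \<Rightarrow> int" where
  "en u = p - 2 * snd u"

lemma odd_ht: "odd_fun ht"
  unfolding odd_fun_def ht_def by (auto simp: algebra_simps)

lemma odd_en: "odd_fun en"
  unfolding odd_fun_def en_def by auto

lemma weight_ht_nonpos: "S \<in> states \<Longrightarrow> weight ht S \<le> 0"
  unfolding weight_def by (rule sum_nonpos) (use height in \<open>fastforce simp: states_def cstate_def ht_def\<close>)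

text \<open>\<open>ht\<close> is twice the principal height: \<epsilon>_k has height n-k, and
  \<delta> has height 2n-2, the Coxeter number, while a mode with index \<open>r\<close> carries
  (2r-p)/2 times \<delta>.\<close>

lemma ht_E: "i \<le> n \<Longrightarrow> ht (aa n i, r) + ht (bb n i, mm i + p - r) = 2"
  using n by (auto simp: ht_def aa_def bb_def mm_def algebra_simps of_nat_diff)

lemma F_weight:
  assumes "odd_fun g" "i \<le> n" "\<And>r. g (aa n i, r) + g (bb n i, mm i + p - r) = k"
    and "S \<in> keys (F i x)"
  obtains S' where "S' \<in> keys x" "weight g S = - k + weight g S'"
proof (rule X_weight[OF assms(1)])
  show "S \<in> keys (X (bar (bb n i)) (bar (aa n i)) (- mm i) x)"
    using assms(4) by (simp add: F_def)
  show "g (bar (bb n i), r) + g (bar (aa n i), - mm i + p - r) = - k" for r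
    using assms(3)[of "mm i + r"] odd_funD[OF assms(1), of "bb n i" "p - r"]
      odd_funD[OF assms(1), of "aa n i" "mm i + r"]
    by (simp add: algebra_simps)
qed (use that in blast)

lemma diagop_F:
  fixes g :: "mode \<Rightarrow> complex"
  assumes "odd_fun g" "i \<le> n" "\<And>r. g (aa n i, r) + g (bb n i, mm i + p - r) = k"
  shows "diagop (weight g) (F i x) = F i (diagop (weight g) x) - pscale k (F i x)"
proof -
  have *: "g (bar (bb n i), r) + g (bar (aa n i), - mm i + p - r) = - k" for r
    using assms(3)[of "mm i + r"] odd_funD[OF assms(1), of "bb n i" "p - r"]
      odd_funD[OF assms(1), of "aa n i" "mm i + r"]
    by (simp add: algebra_simps)
  show ?thesis
    using diagop_X[OF assms(1) * good_F[OF assms(2)], of x] by (simp add: F_def)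
qed

lemma E_weight:
  assumes "odd_fun g" "i \<le> n" "\<And>r. g (aa n i, r) + g (bb n i, mm i + p - r) = k"
    and "S \<in> keys (E i x)"
  obtains S' where "S' \<in> keys x" "weight g S = k + weight g S'"
  using X_weight[OF assms(1,3)] assms(4) that by (auto simp: E_def)

text \<open>Only the top mode of each of the 2n colours can lower the total q-exponent, and it does
  so by at most 1. The remaining modes of \<open>S\<close> thus contribute at least -2n.\<close>

lemma energy_mode_bound:
  assumes "cstate S" "\<forall>u\<in>fset S. fst (fst u) \<in> {1..n}" and u: "u |\<in>| S"
  shows "en u \<le> weight en S + 2 * int n"
proof -
  let ?N = "(\<lambda>a. (a, \<theta> a - 1)) ` ({1..n} \<times> (UNIV :: bool set))"
  have cardN: "card ?N \<le> 2 * n"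
    using card_image_le[of "{1..n} \<times> (UNIV :: bool set)" "\<lambda>a. (a, \<theta> a - 1)"]
    by (simp add: card_cartesian_product)
  have lower: "(if v \<in> ?N then - 1 else 0) \<le> en v" if "v |\<in>| S" for v
  proof -
    obtain a r where v: "v = (a, r)" by (cases v)
    have a: "fst a \<in> {1..n}" and r: "r < \<theta> a"
      using assms(1,2) that v by (auto simp: cstate_def)
    show ?thesis
    proof (cases "r = \<theta> a - 1")
      case True
      have "a \<in> {1..n} \<times> UNIV" using a by (cases a) auto
      then have "v \<in> ?N" using True v by blast
      then show ?thesis using energy[OF a] True v by (simp add: en_def)
    next
      case False
      then have "v \<notin> ?N" using v by auto
      then show ?thesis using energy[OF a] False r v by (simp add: en_def)
    qed
  qed
  have "(\<Sum>v\<in>fset S - {u}. if v \<in> ?N then - 1 else 0 :: int) \<le> (\<Sum>v\<in>fset S - {u}. en v)"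
    by (rule sum_mono) (use lower in auto)
  moreover have "(\<Sum>v\<in>fset S - {u}. if v \<in> ?N then - 1 else 0 :: int) = - int (card ((fset S - {u}) \<inter> ?N))"
    by (simp add: sum.If_cases)
  moreover have "card ((fset S - {u}) \<inter> ?N) \<le> 2 * n"
    using card_mono[of ?N "(fset S - {u}) \<inter> ?N"] cardN by simp
  moreover have "weight en S = en u + (\<Sum>v\<in>fset S - {u}. en v)"
    unfolding weight_def using u by (subst sum.remove[of _ u]) auto
  ultimately show ?thesis by linarith
qed

text \<open>A fixed total q-exponent bounds the index of every mode from below, and being a creation
  mode bounds it from above. This leaves a finite set of modes, and states are subsets of
  it.\<close>

lemma finite_energy:
  "finite {S. cstate S \<and> (\<forall>u\<in>fset S. fst (fst u) \<in> {1..n}) \<and> weight en S = b}"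
proof (rule finite_subset)
  let ?R = "\<Union>a\<in>{1..n} \<times> UNIV. Pair a ` {- (\<bar>p\<bar> + \<bar>b\<bar> + 2 * int n) .. \<theta> a}"
  show "{S. cstate S \<and> (\<forall>u\<in>fset S. fst (fst u) \<in> {1..n}) \<and> weight en S = b} \<subseteq> fset -` Pow ?R"
  proof (intro subsetI vimageI2 PowI)
    fix S u
    assume S: "S \<in> {S. cstate S \<and> (\<forall>u\<in>fset S. fst (fst u) \<in> {1..n}) \<and> weight en S = b}"
      and u: "u \<in> fset S"
    obtain a r where ar: "u = (a, r)" by (cases u)
    have "en u \<le> b + 2 * int n" using energy_mode_bound[of S u] S u by auto
    then have "- (\<bar>p\<bar> + \<bar>b\<bar> + 2 * int n) \<le> r" using ar by (simp add: en_def)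
    moreover have "r \<le> \<theta> a" using S u ar by (auto simp: cstate_def)
    moreover have "a \<in> {1..n} \<times> UNIV" using S u ar by (cases a) auto
    ultimately show "u \<in> ?R" unfolding ar by (intro UN_I[of a] imageI) auto
  qed
  show "finite (fset -` Pow ?R)"
    by (rule finite_vimageI) (auto simp: fset_inject inj_on_def)
qed

text \<open>
  The operators \<open>X a b m\<close> killing a fixed vector are closed under commutators; if they include all
  \<open>E i\<close>, they include the positive Heisenberg modes.
\<close>

lemma kill_step:
  assumes "fst a \<noteq> fst b" "fst c \<noteq> fst b" "fst a \<noteq> fst c"
    and "X a b m w = 0" "X (bar b) c m' w = 0"
  shows "X a c (m + m') w = 0"
proof -
  have ne: "b \<noteq> a" "b \<noteq> bar a" "c \<noteq> b" "c \<noteq> bar b" "c \<noteq> bar a" "bar b \<noteq> bar a" using assms(1-3) by auto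
  have "X a b m (X (bar b) c m' w) = X (bar b) c m' (X a b m w) + X a c (m + m') w"
    using X_comm[of a b m "bar b" c m' w] ne assms(1-3) by (auto simp: good_def)
  moreover have "X a b m 0 = 0" "X (bar b) c m' 0 = 0"
    using assms(1,2) by (intro X_zero good_fst; simp)+
  ultimately show ?thesis
    unfolding assms(4,5) by simp
qed

lemma kill_swap: "fst a \<noteq> fst b \<Longrightarrow> X a b m w = 0 \<Longrightarrow> X b a m w = 0"
  using X_swap[OF good_fst, of a b m w] by simp

lemma kill_full:
  assumes "fst a \<noteq> fst b" "m + m' \<noteq> 0"
    and "X a b m w = 0" "X (bar b) (bar a) m' w = 0"
  shows "X a (bar a) (m + m') w = - X b (bar b) (m + m') w"
proof -
  have ne: "b \<noteq> a" "a \<noteq> b" "b \<noteq> bar a" "a \<noteq> bar b" "bar a \<noteq> b" using assms(1) by auto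
  have "X a b m (X (bar b) (bar a) m' w) = X (bar b) (bar a) m' (X a b m w)
      + X a (bar a) (m + m') w - X (bar b) b (m + m') w"
    using X_comm[of a b m "bar b" "bar a" m' w] ne assms(1,2) by (auto simp: good_def)
  moreover have "X (bar b) b (m + m') w = - X b (bar b) (m + m') w"
    using h_bar[of "m + m'" b w] assms(2) by simp
  moreover have "X a b m 0 = 0" "X (bar b) (bar a) m' 0 = 0"
    using assms(1) by (intro X_zero good_fst; simp)+
  ultimately show ?thesis
    unfolding assms(3,4) by (simp add: eq_neg_iff_add_eq_0)
qed

lemma singular_killed:
  assumes E0: "\<And>i. i \<le> n \<Longrightarrow> E i w = 0" and k: "k \<in> {1..n}" and m: "0 < m"
  shows "X (P k) (M k) m w = 0"
proof -
  have PM1: "X (P i) (M (Suc i)) 0 w = 0" if "1 \<le> i" "i < n" for i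
    using E0[of i] that by (auto simp: E_def aa_def bb_def mm_def)
  have PPn: "X (P (n - 1)) (P n) 0 w = 0"
    using E0[of n] n by (auto simp: E_def aa_def bb_def mm_def)
  have MM: "X (M 1) (M 2) 1 w = 0"
    using E0[of 0] by (auto simp: E_def aa_def bb_def mm_def)
  have PM: "X (P i) (M j) 0 w = 0" if i: "1 \<le> i" and ij: "i < j" and "j \<le> n" for i j
    using Suc_leI[OF ij] \<open>j \<le> n\<close>
  proof (induction j rule: dec_induct)
    case base then show ?case using PM1 i by auto
  next
    case (step j)
    show ?case
      using kill_step[of "P i" "M j" "M (Suc j)" 0 w 0] step PM1[of j] i by simp
  qed
  have PPn': "X (P i) (P n) 0 w = 0" if "1 \<le> i" "i < n" for i
  proof (cases "i = n - 1")
    case False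
    then show ?thesis
      using kill_step[of "P i" "M (n - 1)" "P n" 0 w 0] PM[of i "n - 1"] PPn that by simp
  qed (use PPn in simp)
  have PP: "X (P i) (P j) 0 w = 0" if "1 \<le> i" "i < j" "j \<le> n" for i j
  proof (cases "j = n")
    case False
    have "X (M n) (P j) 0 w = 0"
      by (rule kill_swap) (use PM[of j n] False that in auto)
    then show ?thesis
      using kill_step[of "P i" "P n" "P j" 0 w 0] PPn'[of i] False that by simp
  qed (use PPn' that in simp)
  \<comment> \<open>Indices 1 and 2 are those of the affine node, the only source of degree one. The
    indices from 3 on serve as intermediaries for raising the degree.\<close>
  have P0: "X (P i) c 0 w = 0" if "i \<in> {1, 2}" "fst c \<in> {3..n}" for i c
    using PM[of i "fst c"] PP[of i "fst c"] that by (cases c) (auto split: bool.splits, (metis (full_types))+)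
  have M1: "X (M i) c 1 w = 0" if "i \<in> {1, 2}" and c: "fst c \<in> {3..n}" for i c
  proof -
    have "X (M 1) c 1 w = 0"
      using kill_step[of "M 1" "M 2" c 1 w 0] MM P0[of 2 c] c by simp
    moreover have "X (M 2) (M 1) 1 w = 0" using kill_swap[OF _ MM] by simp
    then have "X (M 2) c 1 w = 0"
      using kill_step[of "M 2" "M 1" c 1 w 0] P0[of 1 c] c by simp
    ultimately show ?thesis using that by auto
  qed
  have G1: "X c d 1 w = 0" if c: "fst c \<in> {3..n}" and d: "fst d \<in> {3..n}" and cd: "fst c \<noteq> fst d" for c d
  proof -
    have "X c (M 1) 1 w = 0" by (rule kill_swap) (use M1[of 1 c] c in auto)
    then show ?thesis
      using kill_step[of c "M 1" d 1 w 0] P0[of 1 d] c d cd by simp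
  qed
  have Pm: "X (P i) c (int l) w = 0" if i: "i \<in> {1, 2}" and "fst c \<in> {3..n}" for i c l
    using that(2)
  proof (induction l arbitrary: c)
    case 0 then show ?case using P0 i by simp
  next
    case (Suc l)
    \<comment> \<open>The degree is raised through an auxiliary colour whose index differs from that
      of \<open>c\<close>. A second index in \<open>{3..n}\<close> exists because
      \<open>n \<ge> 4\<close>.\<close>
    obtain d :: colour where d: "fst d \<in> {3..n}" "fst d \<noteq> fst c"
    proof (cases "fst c = 3")
      case True then show ?thesis using that[of "P 4"] n by auto
    next
      case False then show ?thesis using that[of "P 3"] n by auto
    qed
    have "X (P i) c (int l + 1) w = 0"
      using kill_step[of "P i" d c "int l" w 1] Suc.IH[OF d(1)] G1[of "bar d" c] d i Suc.prems by auto
    then show ?case by (simp add: add.commute)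
  qed
  define l where "l = nat (m - 1)"
  have lm: "int l + 1 = m" using m by (simp add: l_def)
  have pm: "X (P i) (M i) m w = - X c (bar c) m w" if i: "i \<in> {1, 2}" and c: "fst c \<in> {3..n}" for i c
  proof -
    have "X (bar c) (M i) 1 w = 0" by (rule kill_swap) (use M1[of i "bar c"] i c in auto)
    then show ?thesis
      using kill_full[of "P i" c "int l" 1 w] Pm[OF i c] lm i c by auto
  qed
  have zero: "X (P i) (M i) m w = 0" if i: "i \<in> {1, 2}" for i
  proof -
    \<comment> \<open>The commutator relation holds for both signs of the third colour. The
      Heisenberg mode of index \<open>i\<close> is therefore equal both to minus and to plus that of
      index 3, and so it kills \<open>w\<close>.\<close>
    have "X (P i) (M i) m w = - X (P 3) (M 3) m w" "X (P i) (M i) m w = - X (M 3) (P 3) m w"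
      using pm[OF i, of "P 3"] pm[OF i, of "M 3"] n by auto
    moreover have "X (M 3) (P 3) m w = - X (P 3) (M 3) m w"
      using h_bar[of m "P 3" w] m by simp
    ultimately have eq: "X (P i) (M i) m w = - X (P i) (M i) m w" by simp
    show ?thesis
    proof (rule poly_mapping_eqI)
      fix S
      from arg_cong[OF eq, of "\<lambda>y. lookup y S"]
      show "lookup (X (P i) (M i) m w) S = lookup 0 S" by simp
    qed
  qed
  show ?thesis
  proof (cases "k \<in> {1, 2}")
    case False
    then have "fst (P k) \<in> {3..n}" using k by auto
    from pm[of 1 "P k", OF _ this] zero[of 1] show ?thesis by simp
  qed (rule zero)
qed

section \<open>Singular vectors\<close>

definition homogeneous :: "fock \<Rightarrow> bool" where
  "homogeneous x \<longleftrightarrow> (\<forall>k S S'. S \<in> keys x \<longrightarrow> S' \<in> keys x \<longrightarrow>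
     weight (colour_charge (P k)) S = (weight (colour_charge (P k)) S' :: int))"

lemma colour_charge_const:
  "(colour_charge c (a, r) + colour_charge c (b, s) :: 'b::{ab_group_add,one})
    = colour_charge c (a, 0) + colour_charge c (b, 0)"
  by (simp add: colour_charge_def)

lemma E_homogeneous:
  assumes i: "i \<le> n" and x: "homogeneous x"
  shows "homogeneous (E i x)"
  unfolding homogeneous_def
proof (intro allI impI)
  fix k S S'
  assume S: "S \<in> keys (E i x)" and S': "S' \<in> keys (E i x)"
  let ?c = "colour_charge (P k) :: mode \<Rightarrow> int"
  obtain T where T: "T \<in> keys x" "weight ?c S = ?c (aa n i, 0) + ?c (bb n i, 0) + weight ?c T"
    by (rule E_weight[OF odd_colour_charge i colour_charge_const S])
  obtain T' where T': "T' \<in> keys x" "weight ?c S' = ?c (aa n i, 0) + ?c (bb n i, 0) + weight ?c T'"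
    by (rule E_weight[OF odd_colour_charge i colour_charge_const S'])
  show "weight ?c S = weight ?c S'"
    using x T T' unfolding homogeneous_def by metis
qed

lemma colour_charge_signed:
  "weight (colour_charge a) S = (if snd a then weight (colour_charge (P (fst a))) S
     else - weight (colour_charge (P (fst a))) S :: int)"
  by (cases a) (auto simp: weight_def colour_charge_def sum_negf[symmetric] intro!: sum.cong)

text \<open>The conclusion is phrased through the vacuum coefficient because the contradiction will
  come from a singular vector orthogonal to the vacuum.\<close>

lemma singular_unique:
  assumes w: "w \<in> fock_even" "homogeneous w" "w \<noteq> 0" and E0: "\<And>i. i \<le> n \<Longrightarrow> E i w = 0"
  shows "lookup w vac \<noteq> 0"
proof -
  obtain S0 where S0: "S0 \<in> keys w" using w(3) by fastforce
  define N where "N k = (weight (colour_charge (P k)) S0 :: int)" for k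
  have N: "weight (colour_charge (P k)) S = N k" if "S \<in> keys w" for k S
    using w(2) that S0 unfolding homogeneous_def N_def by blast
  have wf: "w \<in> fockspace" using w(1) by (rule fock_even_fockspace)
  have Q: "diagop (weight (colour_charge a)) w = pscale (of_int (if snd a then N (fst a) else - N (fst a))) w" for a
  proof (rule poly_mapping_eqI)
    fix S
    show "lookup (diagop (weight (colour_charge a)) w) S =
      lookup (pscale (of_int (if snd a then N (fst a) else - N (fst a))) w) S"
      using N[of S "fst a"] of_int_weight_colour_charge[of a S] colour_charge_signed[of a S]
      by (cases "S \<in> keys w") (auto simp: in_keys_iff)
  qed
  have "N k = 0" if "k \<in> {1..n}" for k
  proof (rule dominant[where N = N, OF _ _ that])
    show "even (\<Sum>k=1..n. N k)"
      using charge_sum_parity[of S0 n] S0 w(1) unfolding N_def weight_def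
      by (auto simp: fock_even_def states_def)
    have "0 \<le> mm i + p + 1 - \<theta> (aa n i) - \<theta> (bb n i)
        + (if snd (aa n i) then N (fst (aa n i)) else - N (fst (aa n i)))
        + (if snd (bb n i) then N (fst (bb n i)) else - N (fst (bb n i)))" if i: "i \<le> n" for i
    proof -
    let ?v = "const i + (if snd (aa n i) then N (fst (aa n i)) else - N (fst (aa n i)))
        + (if snd (bb n i) then N (fst (bb n i)) else - N (fst (bb n i)))"
    \<comment> \<open>Since \<open>E i w = 0\<close>, the commutator gives \<open>w\<close> times
      the value of its weight on the i-th coroot. The norm of \<open>F i w\<close> is then this
      value times the norm of \<open>w\<close>, which forces dominance.\<close>
    have "E i (F i w) = pscale (of_int ?v) w"
      unfolding E_F_comm_eq[OF i wf] E0[OF i] Q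
      by (simp only: additive_op_zero[OF additive_op_F[OF i]] of_int_add F.scale_left_distrib) (simp add: add_ac)
    then have "hin (F i w) (F i w) = of_int ?v * hin w w"
      by (simp only: hin_F[OF i] hin_pscale_left)
    then have "Re (hin (F i w) (F i w)) = of_int ?v * Re (hin w w)" by simp
    then have "0 \<le> of_int ?v * Re (hin w w)" using hin_self_nonneg[of "F i w"] by simp
    then have "0 \<le> (of_int ?v :: real)" using hin_self_pos[OF w(3)] by (simp add: zero_le_mult_iff)
    then have "0 \<le> ?v" by (simp only: of_int_0_le_iff)
    then show "0 \<le> mm i + p + 1 - \<theta> (aa n i) - \<theta> (bb n i)
        + (if snd (aa n i) then N (fst (aa n i)) else - N (fst (aa n i)))
        + (if snd (bb n i) then N (fst (bb n i)) else - N (fst (bb n i)))"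
      by (simp only: const_def)
    qed
    then show "\<forall>i\<le>n. 0 \<le> mm i + p + 1 - \<theta> (aa n i) - \<theta> (bb n i)
        + (if snd (aa n i) then N (fst (aa n i)) else - N (fst (aa n i)))
        + (if snd (bb n i) then N (fst (bb n i)) else - N (fst (bb n i)))"
      by blast
  qed
  then have Q0: "weight (colour_charge (P k)) S0 = (0::int)" if "k \<in> {1..n}" for k
    using that by (simp add: N_def)
  have "u |\<notin>| S0" for u
  proof
    assume u: "u |\<in>| S0"
    have k: "fst (fst u) \<in> {1..n}" using u S0 w(1) by (auto simp: fock_even_def states_def)
    have "fst (fst u) \<noteq> fst (P (fst (fst u)))"
      by (rule no_modes_of_colour[OF wf _ S0 Q0[OF k] u]) (use singular_killed[OF E0 k] in simp)
    then show False by simp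
  qed
  then have "S0 = vac" by blast
  then show ?thesis using S0 by (simp add: in_keys_iff)
qed

section \<open>Words in the lowering operators\<close>

fun fword :: "nat list \<Rightarrow> fock" where
  "fword [] = single vac 1"
| "fword (i # v) = F i (fword v)"

text \<open>Each \<open>F i\<close> shifts such a weight by a constant, so a word lies in a single
  joint weight space. A word therefore meets a set of states cut out by charges and energy either
  completely or not at all.\<close>

lemma fword_weight:
  assumes "odd_fun g" "\<And>i. i \<le> n \<Longrightarrow> \<exists>k. \<forall>r. g (aa n i, r) + g (bb n i, mm i + p - r) = k"
    and "set v \<subseteq> {0..n}" "S \<in> keys (fword v)" "S' \<in> keys (fword v)"
  shows "weight g S = weight g S'"
  using assms(3-)
proof (induction v arbitrary: S S')
  case Nil then show ?case by (auto split: if_splits)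
next
  case (Cons i v)
  then have i: "i \<le> n" by simp
  obtain k where k: "\<And>r. g (aa n i, r) + g (bb n i, mm i + p - r) = k" using assms(2)[OF i] by blast
  from Cons.prems(2,3) have "S \<in> keys (F i (fword v))" "S' \<in> keys (F i (fword v))" by auto
  then obtain T T' where "T \<in> keys (fword v)" "weight g S = - k + weight g T"
      "T' \<in> keys (fword v)" "weight g S' = - k + weight g T'"
    by (elim F_weight[OF assms(1) i k])
  then show ?case using Cons.IH[of T T'] Cons.prems(1) by simp
qed

text \<open>
  Otherwise a linear functional vanishing on all words yields a nonzero homogeneous vector orthogonal
  to them; raising it as far as possible gives a singular vector orthogonal to the vacuum.
\<close>

lemma fock_cyclic:
  assumes s: "s \<in> states"
  shows "single s 1 \<in> F.span {fword v | v. set v \<subseteq> {0..n}}"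
proof (rule ccontr)
  let ?W = "{fword v | v. set v \<subseteq> {0..n}}"
  let ?s = "single s (1::complex)"
  assume ns: "?s \<notin> F.span ?W"
  interpret C: vector_space "(*) :: complex \<Rightarrow> complex \<Rightarrow> complex"
    by unfold_locales (auto simp: algebra_simps)
  interpret FC: vector_space_pair "pscale :: complex \<Rightarrow> fock \<Rightarrow> fock" "(*) :: complex \<Rightarrow> complex \<Rightarrow> complex"
    ..
  obtain B where B: "B \<subseteq> ?W" "F.independent B" "?W \<subseteq> F.span B"
    using F.maximal_independent_subset by blast
  have "F.span B \<subseteq> F.span ?W" using B(1) by (rule F.span_mono)
  then have "F.independent (insert ?s B)" using ns B(2) by (simp add: F.independent_insert) blast
  from FC.linear_independent_extend[OF this, of "\<lambda>x. if x = ?s then 1 else 0"]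
  \<comment> \<open>A linear functional that is zero on every word but takes the value 1 on the
    state assumed to lie outside their span.\<close>
  obtain g where g: "Vector_Spaces.linear pscale (*) g" and gB: "\<forall>x\<in>insert ?s B. g x = (if x = ?s then 1 else 0)"
    by blast
  interpret g: Vector_Spaces.linear pscale "(*)" g by (rule g)
  have gs: "g ?s = 1" using gB by simp
  have "?s \<notin> B" using ns B(1) F.span_superset by blast
  then have gB0: "g x = 0" if "x \<in> B" for x using gB that by auto
  have gW: "g x = 0" if "x \<in> ?W" for x
  proof -
    have "x \<in> F.span B" using B(3) that by blast
    then show ?thesis
      by (induction rule: F.span_induct_alt) (auto simp: g.zero g.add g.scale gB0)
  qed
  \<comment> \<open>Vectors are finitely supported, so the functional can be represented by a vector
    only on finitely many states. One energy level with fixed charges is finite and contains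
    \<open>s\<close>.\<close>
  define A where "A = {S \<in> states. weight en S = weight en s \<and>
      (\<forall>k. weight (colour_charge (P k)) S = (weight (colour_charge (P k)) s :: int))}"
  have finA: "finite A"
    by (rule finite_subset[OF _ finite_energy[of "weight en s"]]) (auto simp: A_def states_def)
  have sA: "s \<in> A" using s by (simp add: A_def)
  \<comment> \<open>The vector representing \<open>g\<close> on \<open>A\<close>. The conjugation
    compensates the conjugate-linearity of \<open>hin\<close> in its second argument.\<close>
  define w where "w = (\<Sum>S\<in>A. single S (cnj (g (single S 1))))"
  have lw: "lookup w S = (if S \<in> A then cnj (g (single S 1)) else 0)" for S
    unfolding w_def using finA by (simp add: Poly_Mapping.lookup_sum lookup_single when_def)
  have w: "w \<in> fock_even" "homogeneous w" "w \<noteq> 0"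
  proof -
    have kA: "S \<in> A" if "S \<in> keys w" for S
      using that by (simp add: in_keys_iff lw split: if_splits)
    then show "w \<in> fock_even" unfolding fock_even_def A_def by blast
    show "homogeneous w"
      unfolding homogeneous_def
    proof (intro allI impI)
      fix k S S' assume "S \<in> keys w" "S' \<in> keys w"
      from this[THEN kA] show "weight (colour_charge (P k)) S = (weight (colour_charge (P k)) S' :: int)"
        by (simp add: A_def)
    qed
    have "lookup w s = 1" using sA gs by (simp add: lw)
    then show "w \<noteq> 0" by auto
  qed
  have orth: "hin (fword v) w = 0" if v: "set v \<subseteq> {0..n}" for v
  proof (cases "keys (fword v) \<subseteq> A")
    case True
    have "hin (fword v) w = (\<Sum>S\<in>keys (fword v). g (single S (lookup (fword v) S)))"
      unfolding hin_def
    proof (rule sum.cong)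
      fix S assume "S \<in> keys (fword v)"
      then have "S \<in> A" using True by blast
      moreover have "single S c = pscale c (single S 1)" for c
        by (rule poly_mapping_eqI) (simp add: lookup_single when_def)
      ultimately show "lookup (fword v) S * cnj (lookup w S) =
          g (single S (lookup (fword v) S))"
        by (metis (full_types) g.scale lw complex_cnj_cnj)
    qed simp
    also have "\<dots> = g (fword v)"
      by (simp only: g.sum[symmetric] poly_mapping_sum_single[symmetric])
    also have "\<dots> = 0" using gW v by blast
    finally show ?thesis .
  next
    case False
    then obtain T where T: "T \<in> keys (fword v)" "T \<notin> A" by blast
    have ev: "fword v \<in> fock_even"
      using v by (induction v) (auto simp: vac_in_states F_fock_even fock_even_single)
    have same: "S \<notin> A" if "S \<in> keys (fword v)" for S
    proof -
      have "weight en S = weight en T"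
      proof (rule fword_weight[OF odd_en _ v that T(1)])
        show "\<exists>k. \<forall>r. en (aa n i, r) + en (bb n i, mm i + p - r) = k" for i
          by (rule exI[of _ "- 2 * mm i"]) (simp add: en_def)
      qed
      moreover have "weight (colour_charge (P k)) S = (weight (colour_charge (P k)) T :: int)" for k
        by (rule fword_weight[OF odd_colour_charge _ v that T(1)]) (use colour_charge_const in blast)
      moreover have "S \<in> states" "T \<in> states" using ev that T(1) by (auto simp: fock_even_def)
      ultimately show ?thesis using T(2) by (simp add: A_def)
    qed
    show ?thesis
      unfolding hin_def by (rule sum.neutral) (use same lw in simp)
  qed
  \<comment> \<open>Applying \<open>E i\<close> keeps orthogonality to all words, since its adjoint
    only lengthens a word, and it raises \<open>ht\<close> by 2. As \<open>ht\<close> is nonpositive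
    on states, the lower bound \<open>- l\<close> can be improved only finitely often.\<close>
  have raise: False
    if "w \<in> fock_even" "homogeneous w" "w \<noteq> 0" "\<And>v. set v \<subseteq> {0..n} \<Longrightarrow> hin (fword v) w = 0"
      "\<And>S. S \<in> keys w \<Longrightarrow> - int l \<le> weight ht S" for w l
    using that
  proof (induction l arbitrary: w rule: less_induct)
    case (less l)
    show False
    proof (cases "\<forall>i\<le>n. E i w = 0")
      case True
      then have "lookup w vac \<noteq> 0" using singular_unique less.prems(1-3) by blast
      moreover have "hin (fword []) w = 0" using less.prems(4) by (metis empty_subsetI list.set(1))
      ultimately show False by (simp add: hin_single_left)
    next
      case False
      then obtain i where i: "i \<le> n" "E i w \<noteq> 0" by blast
      have low: "2 - int l \<le> weight ht S" if S: "S \<in> keys (E i w)" for S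
      proof -
        obtain S' where "S' \<in> keys w" "weight ht S = 2 + weight ht S'"
          using S by (elim E_weight[OF odd_ht i(1) ht_E[OF i(1)]])
        then show ?thesis using less.prems(5)[of S'] by simp
      qed
      obtain S where S: "S \<in> keys (E i w)" using i(2) by fastforce
      have ev: "E i w \<in> fock_even" using i less.prems(1) by (simp add: E_fock_even)
      have "weight ht S \<le> 0" using S ev weight_ht_nonpos by (auto simp: fock_even_def)
      then have l2: "l \<ge> 2" using low[OF S] by linarith
      show False
      proof (rule less.IH[of "l - 2" "E i w"])
        show "hin (fword v) (E i w) = 0" if "set v \<subseteq> {0..n}" for v
          using less.prems(4)[of "i # v"] that i by (simp add: hin_E)
        show "- int (l - 2) \<le> weight ht S" if "S \<in> keys (E i w)" for S
          using low[OF that] l2 by (simp add: of_nat_diff)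
      qed (use ev i less.prems l2 E_homogeneous in auto)
    qed
  qed
  define l where "l = nat (Max (insert 0 ((\<lambda>S. - weight ht S) ` keys w)))"
  show False
  proof (rule raise[OF w orth])
    fix S assume "S \<in> keys w"
    then have "- weight ht S \<le> Max (insert 0 ((\<lambda>S. - weight ht S) ` keys w))"
      by (intro Max_ge) auto
    then show "- int l \<le> weight ht S" unfolding l_def by linarith
  qed
qed

text \<open>By adjunction, the vacuum coefficients after raising are, up to conjugation, the inner
  products of \<open>x\<close> with the reversed words. These words span all states, so
  \<open>x\<close> is orthogonal to every state.\<close>

lemma fock_nondegenerate:
  assumes x: "x \<in> fock_even" and z: "\<And>v. set v \<subseteq> {0..n} \<Longrightarrow> lookup (foldr E v x) vac = 0"
  shows "x = 0"
proof -
  have words: "hin (fword v) x = 0" if "set v \<subseteq> {0..n}" for v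
  proof -
    have "hin (fword v) y = cnj (lookup (foldr E (rev v) y) vac)" for y
      using that by (induction v arbitrary: y) (simp_all add: hin_single_left flip: hin_E)
    then show ?thesis using z[of "rev v"] that by simp
  qed
  have "hin y x = 0" if "y \<in> F.span {fword v | v. set v \<subseteq> {0..n}}" for y
    using that
  proof (induction rule: F.span_induct_alt)
    case base then show ?case by (simp add: hin_def)
  next
    case (step c y z)
    then show ?case
      using words additive_op_add[OF additive_op_hin_left[of x]] by (auto simp: hin_pscale_left)
  qed
  then have "lookup x S = 0" if "S \<in> states" for S
    using fock_cyclic[OF that] hin_single_left[of S 1 x] by simp
  then show ?thesis
    using x by (intro poly_mapping_eqI) (metis fock_even_def in_keys_iff lookup_zero mem_Collect_eq subsetD)
qed

end

section \<open>Transfer to irreducible highest weight modules\<close>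

text \<open>The least linear relation containing \<open>(v, w)\<close> and closed under all pairs \<open>(F i, G i)\<close>.\<close>

inductive intertwined ::
  "'i set \<Rightarrow> ('i \<Rightarrow> 'a::ab_group_add \<Rightarrow> 'a) \<Rightarrow> ('i \<Rightarrow> 'b::ab_group_add \<Rightarrow> 'b) \<Rightarrow>
    (complex \<Rightarrow> 'a \<Rightarrow> 'a) \<Rightarrow> (complex \<Rightarrow> 'b \<Rightarrow> 'b) \<Rightarrow> 'a \<Rightarrow> 'b \<Rightarrow> 'a \<Rightarrow> 'b \<Rightarrow> bool"
  for I F G s t v w where
  base: "intertwined I F G s t v w v w"
| step: "i \<in> I \<Longrightarrow> intertwined I F G s t v w x y \<Longrightarrow> intertwined I F G s t v w (F i x) (G i y)"
| add: "intertwined I F G s t v w x y \<Longrightarrow> intertwined I F G s t v w x' y' \<Longrightarrow>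
    intertwined I F G s t v w (x + x') (y + y')"
| scale: "intertwined I F G s t v w x y \<Longrightarrow> intertwined I F G s t v w (s c x) (t c y)"

context kac_moody_module
begin

lemma act_zero_right [simp]: "act x 0 = 0"
  using act_add_right[of x 0 0] by simp

lemma act_minus_left: "act (- x) z = - act x z"
proof -
  have "act x z + act (- x) z = act (x + - x) z" by (rule act_add_left[symmetric])
  also have "\<dots> = 0" using act_scale_left[of 0 0 z] by simp
  finally show ?thesis by (simp add: eq_neg_iff_add_eq_0 add.commute)
qed

lemma act_diff_right: "act x (v - w) = act x v - act x w"
  using act_add_right[of x "v - w" w] by (simp add: eq_diff_eq)

lemma act_sum_right: "act x (sum g B) = (\<Sum>i\<in>B. act x (g i))"
  by (induction B rule: infinite_finite_induct) (simp_all add: act_add_right)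

text \<open>The elements of the Lie algebra that preserve \<open>W\<close> form a Lie subalgebra, so
  it is enough to test generators.\<close>

lemma submoduleI:
  assumes W: "V.subspace W"
    and e: "\<And>i w. i \<in> I \<Longrightarrow> w \<in> W \<Longrightarrow> act (e i) w \<in> W"
    and f: "\<And>i w. i \<in> I \<Longrightarrow> w \<in> W \<Longrightarrow> act (f i) w \<in> W"
    and h: "\<And>x w. x \<in> cartan \<Longrightarrow> w \<in> W \<Longrightarrow> act x w \<in> W"
  shows "submodule W"
proof -
  let ?S = "{x. \<forall>w\<in>W. act x w \<in> W}"
  have "lie_subalgebra ?S"
    unfolding lie_subalgebra_def subspace_def
    using W act_scale_left[of 0 0]
    by (auto simp: act_add_left act_scale_left act_bracket V.subspace_add V.subspace_scale V.subspace_diff V.subspace_0)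
  moreover have "e ` I \<union> f ` I \<union> cartan \<subseteq> ?S" using e f h by auto
  ultimately have "lie_subalgebra hull (e ` I \<union> f ` I \<union> cartan) \<subseteq> ?S" by (intro hull_minimal)
  then show ?thesis using W generated by (auto simp: submodule_def)
qed

lemma subspace_weight_space: "V.subspace (weight_space \<mu>)"
  unfolding V.subspace_def weight_space_def
  by (auto simp: act_add_right act_scale_right V.scale_right_distrib V.scale_left_commute)

text \<open>Subtracting \<open>\<mu> b x\<close> from the action of a suitable Cartan element
  \<open>x\<close> removes the summand \<open>z b\<close> and multiplies \<open>y\<close> by a
  nonzero scalar. The weights \<open>\<mu> b\<close> may coincide with each other; they only have to
  differ from \<open>\<nu>\<close>.\<close>

lemma weight_vectors_independent:
  assumes "finite t" "y = (\<Sum>b\<in>t. z b)" "\<And>b. b \<in> t \<Longrightarrow> z b \<in> weight_space (\<mu> b)"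
    and "y \<in> weight_space \<nu>" "\<And>b. b \<in> t \<Longrightarrow> \<exists>x\<in>cartan. \<mu> b x \<noteq> \<nu> x"
  shows "y = 0"
  using assms
proof (induction t arbitrary: y z)
  case empty
  then show ?case by simp
next
  case (insert b t)
  obtain x where x: "x \<in> cartan" "\<mu> b x \<noteq> \<nu> x" using insert.prems(4) by blast
  let ?y = "scaleV (\<nu> x - \<mu> b x) y"
  have "?y = act x y - scaleV (\<mu> b x) y"
    using insert.prems(3) x by (simp add: weight_space_def V.scale_left_diff_distrib)
  also have "\<dots> = (\<Sum>c\<in>insert b t. act x (z c) - scaleV (\<mu> b x) (z c))"
    by (simp only: insert.prems(1) act_sum_right V.scale_sum_right sum_subtractf)
  also have "\<dots> = (\<Sum>c\<in>insert b t. scaleV (\<mu> c x - \<mu> b x) (z c))"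
    by (rule sum.cong) (use insert.prems(2) x in \<open>auto simp: weight_space_def V.scale_left_diff_distrib\<close>)
  also have "\<dots> = (\<Sum>c\<in>t. scaleV (\<mu> c x - \<mu> b x) (z c))"
    using insert.hyps by simp
  finally have "?y = 0"
    by (rule insert.IH)
      (use insert.prems in \<open>auto intro: V.subspace_scale[OF subspace_weight_space]\<close>)
  then show ?case using x by simp
qed

lemma act_f_weight_space:
  assumes "i \<in> I" "y \<in> weight_space \<mu>"
  shows "act (f i) y \<in> weight_space (\<lambda>x. \<mu> x - root i x)"
  unfolding weight_space_def
proof (intro CollectI ballI)
  fix x assume x: "x \<in> cartan"
  have "act x (act (f i) y) = act (bracket x (f i)) y + act (f i) (act x y)"
    by (simp add: act_bracket)
  also have "\<dots> = scaleV (- root i x) (act (f i) y) + scaleV (\<mu> x) (act (f i) y)"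
    using assms x by (simp add: bracket_cartan_f act_scale_left act_minus_left weight_space_def act_scale_right)
  finally show "act x (act (f i) y) = scaleV (\<mu> x - root i x) (act (f i) y)"
    by (simp add: V.scale_left_diff_distrib)
qed

section \<open>Weights below the highest weight\<close>

definition lower_weights :: "('g \<Rightarrow> complex) \<Rightarrow> ('g \<Rightarrow> complex) set" where
  "lower_weights \<nu> = {\<mu>. \<exists>m::'i \<Rightarrow> nat. (\<exists>i\<in>I. m i \<noteq> 0) \<and> \<mu> = (\<lambda>x. \<nu> x - (\<Sum>i\<in>I. of_nat (m i) * root i x))}"

definition lower_part :: "('g \<Rightarrow> complex) \<Rightarrow> 'v set" where
  "lower_part \<nu> = V.span (\<Union>\<mu>\<in>lower_weights \<nu>. weight_space \<mu>)"

lemma lower_weights_distinct: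
  assumes "\<mu> \<in> lower_weights \<nu>"
  shows "\<exists>x\<in>cartan. \<mu> x \<noteq> \<nu> x"
proof (rule ccontr)
  assume c: "\<not> ?thesis"
  obtain m :: "'i \<Rightarrow> nat" and i where m: "i \<in> I" "m i \<noteq> 0"
    and \<mu>: "\<mu> = (\<lambda>x. \<nu> x - (\<Sum>i\<in>I. of_nat (m i) * root i x))"
    using assms by (auto simp: lower_weights_def)
  \<comment> \<open>Independence of the roots is phrased over all elements of the Lie algebra. Off
    the Cartan subalgebra the sum vanishes because functionals are extended by zero.\<close>
  have "(\<Sum>i\<in>I. of_nat (m i) * root i x) = 0" for x
  proof (cases "x \<in> cartan")
    case True
    then show ?thesis using c \<mu> by auto
  next
    case False
    then show ?thesis using root_in_dual by (intro sum.neutral) (auto simp: dual_on_def)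
  qed
  then have "of_nat (m i) = (0::complex)" using m(1) by (intro roots_independent) auto
  then show False using m by simp
qed

lemma lower_part_weight_space: "y \<in> lower_part \<nu> \<Longrightarrow> y \<in> weight_space \<nu> \<Longrightarrow> y = 0"
proof -
  assume "y \<in> lower_part \<nu>" and y: "y \<in> weight_space \<nu>"
  then obtain t r where t: "finite t" "t \<subseteq> (\<Union>\<mu>\<in>lower_weights \<nu>. weight_space \<mu>)" "y = (\<Sum>a\<in>t. scaleV (r a) a)"
    unfolding lower_part_def V.span_explicit by blast
  then have "\<forall>b\<in>t. \<exists>\<mu>. \<mu> \<in> lower_weights \<nu> \<and> b \<in> weight_space \<mu>" by blast
  then obtain \<mu> where \<mu>: "\<forall>b\<in>t. \<mu> b \<in> lower_weights \<nu> \<and> b \<in> weight_space (\<mu> b)"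
    by metis
  show "y = 0"
    by (rule weight_vectors_independent[OF t(1,3) _ y])
      (use \<mu> in \<open>auto intro: V.subspace_scale[OF subspace_weight_space] lower_weights_distinct\<close>)
qed

lemma act_f_lower:
  assumes i: "i \<in> I"
  shows "y \<in> weight_space \<nu> \<Longrightarrow> act (f i) y \<in> lower_part \<nu>"
    and "y \<in> lower_part \<nu> \<Longrightarrow> act (f i) y \<in> lower_part \<nu>"
proof -
  have sum1: "(\<Sum>j\<in>I. of_nat (if j = i then Suc (m j) else m j) * root j x) =
      root i x + (\<Sum>j\<in>I. of_nat (m j) * root j x)" for m :: "'i \<Rightarrow> nat" and x
  proof -
    have "(\<Sum>j\<in>I. of_nat (if j = i then Suc (m j) else m j) * root j x) =
       (\<Sum>j\<in>I. (if j = i then root j x else 0) + of_nat (m j) * root j x)"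
      by (rule sum.cong) (auto simp: algebra_simps)
    then show ?thesis using i finite_I by (simp add: sum.distrib)
  qed
  have mono: "act (f i) y \<in> lower_part \<nu>"
    if y: "y \<in> weight_space \<mu>" and \<mu>: "\<mu> = (\<lambda>x. \<nu> x - (\<Sum>i\<in>I. of_nat (m i) * root i x))" for y \<mu> m
  proof -
    let ?m = "\<lambda>j. if j = i then Suc (m j) else m j"
    have "(\<lambda>x. \<mu> x - root i x) = (\<lambda>x. \<nu> x - (\<Sum>j\<in>I. of_nat (?m j) * root j x))"
      unfolding \<mu> sum1 by (simp add: algebra_simps)
    then have "(\<lambda>x. \<mu> x - root i x) \<in> lower_weights \<nu>"
      unfolding lower_weights_def using i by (intro CollectI exI[of _ ?m]) auto
    then show ?thesis
      using act_f_weight_space[OF i y] unfolding lower_part_def by (intro V.span_base) blast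
  qed
  show "y \<in> weight_space \<nu> \<Longrightarrow> act (f i) y \<in> lower_part \<nu>"
    by (rule mono[where m = "\<lambda>_. 0"]) auto
  show "y \<in> lower_part \<nu> \<Longrightarrow> act (f i) y \<in> lower_part \<nu>"
    unfolding lower_part_def
  proof (induction rule: V.span_induct_alt)
    case base
    then show ?case by (simp add: V.span_zero)
  next
    case (step c z y)
    then obtain \<mu> where "\<mu> \<in> lower_weights \<nu>" "z \<in> weight_space \<mu>" by blast
    then have "act (f i) z \<in> lower_part \<nu>" using mono by (auto simp: lower_weights_def)
    then show ?case
      using step(2) unfolding lower_part_def
      by (simp add: act_add_right act_scale_right V.span_add V.span_scale)
  qed
qed

end

context irreducible_highest_weight_module
begin

text \<open>
  The relation is closed under the \<open>E i\<close> as well. So the vectors related to \<open>0\<close> form a proper submodule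
  of \<open>L(\<Lambda>)\<close>, while nondegeneracy leaves only \<open>0\<close> on the Fock side.
\<close>

lemma dim_weight_space:
  fixes E F :: "'i \<Rightarrow> ('s \<Rightarrow>\<^sub>0 complex) \<Rightarrow> ('s \<Rightarrow>\<^sub>0 complex)" and wt :: "'s \<Rightarrow> 'g \<Rightarrow> complex"
    and St :: "'s set" and vac :: 's
  assumes vac: "vac \<in> St"
    and E: "\<And>i. i \<in> I \<Longrightarrow> additive_op (E i)" "\<And>i c x. i \<in> I \<Longrightarrow> E i (pscale c x) = pscale c (E i x)"
    and F: "\<And>i. i \<in> I \<Longrightarrow> additive_op (F i)" "\<And>i c x. i \<in> I \<Longrightarrow> F i (pscale c x) = pscale c (F i x)"
    and F_St: "\<And>i x. i \<in> I \<Longrightarrow> keys x \<subseteq> St \<Longrightarrow> keys (F i x) \<subseteq> St"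
    and EF: "\<And>i j x. i \<in> I \<Longrightarrow> j \<in> I \<Longrightarrow> keys x \<subseteq> St \<Longrightarrow>
       E i (F j x) = F j (E i x) + (if i = j then diagop (\<lambda>S. wt S (coroot i)) x else 0)"
    and HF: "\<And>i x y. i \<in> I \<Longrightarrow> x \<in> cartan \<Longrightarrow>
       diagop (\<lambda>S. wt S x) (F i y) = F i (diagop (\<lambda>S. wt S x) y) - pscale (root i x) (F i y)"
    and E_vac: "\<And>i c. i \<in> I \<Longrightarrow> E i (single vac c) = 0"
    and F_vac: "\<And>i x. i \<in> I \<Longrightarrow> keys x \<subseteq> St \<Longrightarrow> lookup (F i x) vac = 0"
    and wt_vac: "\<And>x. x \<in> cartan \<Longrightarrow> wt vac x = hw x"
    and wt_dual: "\<And>S. S \<in> St \<Longrightarrow> wt S \<in> dual_on cartan"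
    and cyclic: "\<And>W S. F.subspace W \<Longrightarrow> single vac 1 \<in> W \<Longrightarrow>
       (\<And>i x. i \<in> I \<Longrightarrow> x \<in> W \<Longrightarrow> F i x \<in> W) \<Longrightarrow> S \<in> St \<Longrightarrow> single S 1 \<in> W"
    and nondegenerate: "\<And>x. keys x \<subseteq> St \<Longrightarrow>
       (\<And>v. set v \<subseteq> I \<Longrightarrow> lookup (foldr E v x) vac = 0) \<Longrightarrow> x = 0"
    and \<nu>: "\<nu> \<in> dual_on cartan"
  shows "V.dim (weight_space \<nu>) = card {S \<in> St. wt S = \<nu>}"
proof -
  obtain v where v: "v \<noteq> 0" "\<And>x. x \<in> n_plus \<Longrightarrow> act x v = 0" "v \<in> weight_space hw"
      "\<And>W. submodule W \<Longrightarrow> v \<in> W \<Longrightarrow> W = UNIV"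
    using highest_weight unfolding highest_weight_module_def by blast
  have irr: "W = {0} \<or> W = UNIV" if "submodule W" for W
    using irreducible that by (auto simp: irreducible_module_def)
  have ev: "act (e i) v = 0" if "i \<in> I" for i
    by (rule v(2)) (use that in \<open>auto simp: n_plus_def intro: hull_inc\<close>)
  have v_lower: "v \<notin> lower_part hw" using lower_part_weight_space v(1,3) by blast
  let ?v = "single vac (1::complex)"
  define R where "R = intertwined I F (\<lambda>i. act (f i)) pscale scaleV ?v v"
  let ?H = "\<lambda>x. diagop (\<lambda>S. wt S x)"
  have R_base: "R ?v v"
    and R_step: "\<And>i x y. i \<in> I \<Longrightarrow> R x y \<Longrightarrow> R (F i x) (act (f i) y)"
    and R_add: "\<And>x y x' y'. R x y \<Longrightarrow> R x' y' \<Longrightarrow> R (x + x') (y + y')"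
    and R_scale: "\<And>c x y. R x y \<Longrightarrow> R (pscale c x) (scaleV c y)"
    unfolding R_def by (rule intertwined.intros; assumption)+
  have R_induct [consumes 1]: "Q x y" if "R x y" "Q ?v v"
    "\<And>i x y. i \<in> I \<Longrightarrow> R x y \<Longrightarrow> Q x y \<Longrightarrow> Q (F i x) (act (f i) y)"
    "\<And>x y x' y'. R x y \<Longrightarrow> Q x y \<Longrightarrow> R x' y' \<Longrightarrow> Q x' y' \<Longrightarrow> Q (x + x') (y + y')"
    "\<And>c x y. R x y \<Longrightarrow> Q x y \<Longrightarrow> Q (pscale c x) (scaleV c y)" for Q x y
    using that(1) unfolding R_def
    by (induction rule: intertwined.induct) (rule that(2-5)[unfolded R_def]; assumption)+
  have R_0: "R 0 0" using R_scale[OF R_base, of 0] by simp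
  have R_diff: "R (x - x') (y - y')" if "R x y" "R x' y'" for x y x' y'
    using R_add[OF that(1) R_scale[OF that(2), of "- 1"]] by simp
  have R_sum: "R (\<Sum>i\<in>B. g i) (\<Sum>i\<in>B. g' i)" if "\<And>i. i \<in> B \<Longrightarrow> R (g i) (g' i)" for B :: "'s set" and g g'
    using that by (induction B rule: infinite_finite_induct) (auto simp: R_0 R_add)
  have R_keys: "keys x \<subseteq> St" if "R x y" for x y
    using that
  proof (induction rule: R_induct)
    case 1 then show ?case using vac by simp
  next
    case (3 x y x' y') then show ?case using keys_add[of x x'] by blast
  next
    case (4 c x y) then show ?case by (auto simp: in_keys_iff)
  qed (rule F_St)
  have H_single: "?H x (single S c) = pscale (wt S x) (single S c)" for x S c
    by (rule poly_mapping_eqI) (simp add: lookup_single when_def)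
  have H_add: "?H x (y + z) = ?H x y + ?H x z" for x y z
    by (rule additive_op_add[OF additive_op_diagop])
  have R_H: "R (?H x y) (act x z)" if x: "x \<in> cartan" and "R y z" for x y z
    using that(2)
  proof (induction rule: R_induct)
    case 1
    have "act x v = scaleV (hw x) v" using v(3) x by (simp add: weight_space_def)
    then show ?case using R_scale[OF R_base, of "hw x"] by (simp add: H_single wt_vac x)
  next
    case (2 i y z)
    have "act x (act (f i) z) = act (bracket x (f i)) z + act (f i) (act x z)"
      by (simp add: act_bracket)
    also have "\<dots> = act (f i) (act x z) - scaleV (root i x) (act (f i) z)"
      using 2(1) x by (simp add: bracket_cartan_f act_scale_left act_minus_left)
    finally show ?case
      unfolding HF[OF 2(1) x] using R_diff[OF R_step[OF 2(1,3)] R_scale[OF R_step[OF 2(1,2)]]] by simp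
  next
    case (3 y z y' z') then show ?case by (simp add: H_add act_add_right R_add)
  next
    case (4 c y z) then show ?case by (simp add: diagop_pscale act_scale_right R_scale)
  qed
  have R_E: "R (E i x) (act (e i) y)" if i: "i \<in> I" and "R x y" for i x y
    using that(2)
  proof (induction rule: R_induct)
    case 1 then show ?case using i by (simp add: E_vac ev R_0)
  next
    case (2 j x y)
    have "act (e i) (act (f j) y) = act (bracket (e i) (f j)) y + act (f j) (act (e i) y)"
      by (simp add: act_bracket)
    also have "\<dots> = act (f j) (act (e i) y) + (if i = j then act (coroot i) y else 0)"
      using i 2(1) act_scale_left[of 0 0 y] by (auto simp: bracket_e_f)
    finally show ?case
      unfolding EF[OF i 2(1) R_keys[OF 2(2)]]
      using R_step[OF 2(1,3)] R_add[OF R_step[OF 2(1,3)] R_H[OF coroot_in_cartan[OF i] 2(2)]]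
      by (auto split: if_splits)
  next
    case (3 y z y' z')
    then show ?case by (simp add: additive_op_add[OF E(1)[OF i]] act_add_right R_add)
  next
    case (4 c y z) then show ?case by (simp add: E(2)[OF i] act_scale_right R_scale)
  qed
  \<comment> \<open>The vacuum coefficient of \<open>x\<close> gives the component of
    \<open>y\<close> along \<open>v\<close> modulo lower weights. It behaves correctly under
    lowering because \<open>F i\<close> never produces the vacuum and \<open>act (f i)\<close> moves
    \<open>v\<close> into the lower part.\<close>
  have R_lower: "y - scaleV (lookup x vac) v \<in> lower_part hw" if "R x y" for x y
    using that
  proof (induction rule: R_induct)
    case 1 then show ?case by (simp add: lower_part_def V.span_zero)
  next
    case (2 i x y)
    have "act (f i) (y - scaleV (lookup x vac) v) + scaleV (lookup x vac) (act (f i) v) \<in> lower_part hw"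
      using act_f_lower[OF 2(1)] 2(3) v(3) unfolding lower_part_def
      by (intro V.span_add V.span_scale)
    then show ?case
      using F_vac[OF 2(1) R_keys[OF 2(2)]] by (simp add: act_diff_right act_scale_right)
  next
    case (3 x y x' y')
    have eq: "y + y' - scaleV (lookup (x + x') vac) v =
        (y - scaleV (lookup x vac) v) + (y' - scaleV (lookup x' vac) v)"
      by (simp add: lookup_add V.scale_left_distrib)
    show ?case unfolding eq lower_part_def by (rule V.span_add) (use 3 in \<open>simp_all add: lower_part_def\<close>)
  next
    case (4 c x y)
    have eq: "scaleV c y - scaleV (lookup (pscale c x) vac) v =
        scaleV c (y - scaleV (lookup x vac) v)"
      by (simp add: V.scale_right_diff_distrib)
    show ?case unfolding eq lower_part_def by (rule V.span_scale) (use 4 in \<open>simp add: lower_part_def\<close>)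
  qed
  have R_left: "y = 0" if "R 0 y" for y
  proof -
    let ?W = "{y. R 0 y}"
    have "submodule ?W"
    proof (rule submoduleI)
      show "V.subspace ?W"
        unfolding V.subspace_def using R_0 R_add[of 0 _ 0] R_scale[of 0] by auto
      show "act (e i) w \<in> ?W" if "i \<in> I" "w \<in> ?W" for i w
        using R_E[of i 0 w] that by (simp add: additive_op_zero[OF E(1)])
      show "act (f i) w \<in> ?W" if "i \<in> I" "w \<in> ?W" for i w
        using R_step[of i 0 w] that by (simp add: additive_op_zero[OF F(1)])
      show "act x w \<in> ?W" if "x \<in> cartan" "w \<in> ?W" for x w
        using R_H[of x 0 w] that by (simp add: additive_op_zero[OF additive_op_diagop])
    qed
    moreover have "v \<notin> ?W" using R_lower[of 0 v] v_lower by auto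
    ultimately have "?W = {0}" using irr[of ?W] by blast
    then show ?thesis using that by blast
  qed
  have R_right: "x = 0" if "R x 0" for x
  proof (rule nondegenerate[OF R_keys[OF that]])
    fix u assume u: "set u \<subseteq> I"
    have "R (foldr E u x) 0"
      using u
    proof (induction u)
      case Nil then show ?case using that by simp
    next
      case (Cons i u)
      then show ?case using R_E[of i "foldr E u x" 0] by simp
    qed
    \<comment> \<open>Raising keeps the second component equal to 0, so a multiple of
      \<open>v\<close> lies in the lower part as well as in the top weight space and must
      vanish.\<close>
    from R_lower[OF this] have "- scaleV (lookup (foldr E u x) vac) v \<in> lower_part hw" by simp
    then have "scaleV (lookup (foldr E u x) vac) v \<in> lower_part hw"
      unfolding lower_part_def using V.span_neg by fastforce
    then have "scaleV (lookup (foldr E u x) vac) v = 0"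
      by (rule lower_part_weight_space) (rule V.subspace_scale[OF subspace_weight_space v(3)])
    then show "lookup (foldr E u x) vac = 0" using v(1) by simp
  qed
  have R_surj: "\<exists>x. R x y" for y
  proof -
    have "submodule {y. \<exists>x. R x y}"
    proof (rule submoduleI)
      show "V.subspace {y. \<exists>x. R x y}"
        unfolding V.subspace_def using R_0 R_add R_scale by blast
    qed (use R_E R_step R_H in blast)+
    then have "{y. \<exists>x. R x y} = UNIV" using R_base by (intro v(4)) auto
    then show ?thesis by blast
  qed
  have "\<exists>y. R (single S 1) y" if "S \<in> St" for S
  proof -
    have "single S 1 \<in> {x. \<exists>y. R x y}"
    proof (rule cyclic[OF _ _ _ that])
      show "F.subspace {x. \<exists>y. R x y}"
        unfolding F.subspace_def using R_0 R_add R_scale by blast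
    qed (use R_base R_step in blast)+
    then show ?thesis by blast
  qed
  then obtain b where b: "\<And>S. S \<in> St \<Longrightarrow> R (single S 1) (b S)" by metis
  have R_eq: "y = y'" if "R x y" "R x y'" for x y y'
    using R_left[of "y - y'"] R_diff[OF that] by simp
  have R_eq': "x = x'" if "R x y" "R x' y" for x x' y
    using R_right[of "x - x'"] R_diff[OF that] by simp
  have single: "single S c = pscale c (single S 1)" for S :: 's and c
    by (rule poly_mapping_eqI) (simp add: lookup_single when_def)
  have b_wt: "b S \<in> weight_space (wt S)" if S: "S \<in> St" for S
    unfolding weight_space_def
  proof (intro CollectI ballI)
    fix x assume x: "x \<in> cartan"
    show "act x (b S) = scaleV (wt S x) (b S)"
      by (rule R_eq[OF R_H[OF x b[OF S]]]) (simp only: H_single R_scale[OF b[OF S]])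
  qed
  have R_expand: "y = (\<Sum>S\<in>keys x. scaleV (lookup x S) (b S))" if "R x y" for x y
  proof (rule R_eq[OF that])
    have "R (\<Sum>S\<in>keys x. single S (lookup x S))
        (\<Sum>S\<in>keys x. scaleV (lookup x S) (b S))"
    proof (rule R_sum)
      fix S assume "S \<in> keys x"
      then have "S \<in> St" using R_keys[OF that] by blast
      then show "R (single S (lookup x S)) (scaleV (lookup x S) (b S))"
        by (subst single) (rule R_scale[OF b])
    qed
    then show "R x (\<Sum>S\<in>keys x. scaleV (lookup x S) (b S))"
      by (simp flip: poly_mapping_sum_single)
  qed
  define T where "T = {S \<in> St. wt S = \<nu>}"
  have inj: "inj_on b T"
  proof (rule inj_onI)
    fix S S' assume S: "S \<in> T" "S' \<in> T" "b S = b S'"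
    then have "single S (1::complex) = single S' 1"
      using R_eq'[OF b[of S], of "single S' 1"] b[of S'] by (simp add: T_def)
    then show "S = S'" by (metis lookup_single_eq lookup_single_not_eq zero_neq_one)
  qed
  have ind: "V.independent (b ` T)"
    unfolding V.dependent_explicit
  proof (rule notI, elim exE conjE bexE)
    fix t u w assume t: "finite t" "t \<subseteq> b ` T" "w \<in> t" "u w \<noteq> 0" "(\<Sum>w\<in>t. scaleV (u w) w) = 0"
    obtain t' where t': "t' \<subseteq> T" "t = b ` t'" using t(2) by (meson subset_imageE)
    have inj': "inj_on b t'" using inj t'(1) inj_on_subset by blast
    then have fin: "finite t'" using t(1) t'(2) finite_image_iff by blast
    have "R (\<Sum>S\<in>t'. single S (u (b S))) (\<Sum>S\<in>t'. scaleV (u (b S)) (b S))"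
      by (rule R_sum, subst single, rule R_scale, rule b) (use t' in \<open>auto simp: T_def\<close>)
    moreover have "(\<Sum>S\<in>t'. scaleV (u (b S)) (b S)) = 0"
      using t(5) unfolding t'(2) sum.reindex[OF inj'] by simp
    ultimately have z: "(\<Sum>S\<in>t'. single S (u (b S))) = 0" using R_right by simp
    obtain S where S: "S \<in> t'" "w = b S" using t(3) t'(2) by blast
    have "lookup (\<Sum>S\<in>t'. single S (u (b S))) S = u (b S)"
      using S(1) fin by (simp add: Poly_Mapping.lookup_sum lookup_single when_def)
    then show False using z S(2) t(4) by simp
  qed
  have "V.span (b ` T) = V.span (weight_space \<nu>)"
  proof
    show "V.span (b ` T) \<subseteq> V.span (weight_space \<nu>)"
      by (rule V.span_mono) (use b_wt in \<open>auto simp: T_def\<close>)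
    have "weight_space \<nu> \<subseteq> V.span (b ` T)"
    proof
      fix y assume y: "y \<in> weight_space \<nu>"
      obtain x where x: "R x y" using R_surj by blast
      have T: "S \<in> T" if S: "S \<in> keys x" for S
      proof -
        have St: "S \<in> St" using R_keys[OF x] S by blast
        have "wt S h = \<nu> h" for h
        proof (cases "h \<in> cartan")
          case True
          have "act h y = scaleV (\<nu> h) y" using y True by (simp add: weight_space_def)
          then have "?H h x = pscale (\<nu> h) x"
            using R_eq'[OF R_H[OF True x]] R_scale[OF x] by metis
          from arg_cong[OF this, of "\<lambda>y. lookup y S"] S show ?thesis
            by (simp add: in_keys_iff)
        next
          case False
          then show ?thesis using wt_dual[OF St] \<nu> by (simp add: dual_on_def)
        qed
        then show ?thesis using St by (simp add: T_def fun_eq_iff)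
      qed
      show "y \<in> V.span (b ` T)"
        by (subst R_expand[OF x], rule V.span_sum, rule V.span_scale, rule V.span_base) (use T in blast)
    qed
    then show "V.span (weight_space \<nu>) \<subseteq> V.span (b ` T)"
      using V.span_minimal V.subspace_span by blast
  qed
  from V.dim_eq_card[OF this ind] show ?thesis
    using card_image[OF inj] by (simp add: T_def)
qed

end

section \<open>Expansion of the product\<close>

text \<open>Coefficientwise stabilisation with a common lower bound on the exponents. The bound
  turns each coefficient of a product into a fixed finite sum, so that limits can be
  multiplied.\<close>

definition coeff_conv :: "(nat \<Rightarrow> 'a::comm_ring_1 fls) \<Rightarrow> 'a fls \<Rightarrow> bool" where
  "coeff_conv f g \<longleftrightarrow>
    (\<exists>l. (\<forall>N. \<forall>i<l. fls_nth (f N) i = 0) \<and> (\<forall>i<l. fls_nth g i = 0)) \<and>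
    (\<forall>i. eventually (\<lambda>N. fls_nth (f N) i = fls_nth g i) sequentially)"

lemma fls_times_nth_bounds:
  fixes f g :: "'a::comm_ring_1 fls"
  assumes "\<forall>i<l. fls_nth f i = 0" "\<forall>i<l'. fls_nth g i = 0"
  shows "fls_nth (f * g) k = (\<Sum>i=l..k - l'. fls_nth f i * fls_nth g (k - i))"
proof (cases "f = 0 \<or> g = 0")
  case False
  then have "l \<le> fls_subdegree f" "l' \<le> fls_subdegree g"
    using assms by (auto intro: fls_subdegree_geI)
  then show ?thesis
    unfolding fls_times_nth(2)
    by (intro sum.mono_neutral_left) (auto simp: not_le)
qed auto

lemma coeff_conv_mult:
  assumes "coeff_conv f g" "coeff_conv f' g'"
  shows "coeff_conv (\<lambda>N. f N * f' N) (g * g')"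
proof -
  obtain l where l: "\<forall>N. \<forall>i<l. fls_nth (f N) i = 0" "\<forall>i<l. fls_nth g i = 0"
    using assms(1) by (auto simp: coeff_conv_def)
  obtain l' where l': "\<forall>N. \<forall>i<l'. fls_nth (f' N) i = 0" "\<forall>i<l'. fls_nth g' i = 0"
    using assms(2) by (auto simp: coeff_conv_def)
  have n: "fls_nth (f N * f' N) k = (\<Sum>i=l..k - l'. fls_nth (f N) i * fls_nth (f' N) (k - i))" for N k
    by (rule fls_times_nth_bounds) (use l l' in auto)
  have n': "fls_nth (g * g') k = (\<Sum>i=l..k - l'. fls_nth g i * fls_nth g' (k - i))" for k
    by (rule fls_times_nth_bounds) (use l l' in auto)
  have "eventually (\<lambda>N. fls_nth (f N * f' N) k = fls_nth (g * g') k) sequentially" for k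
  proof -
    have "eventually (\<lambda>N. \<forall>i\<in>{l..k - l'}. fls_nth (f N) i = fls_nth g i) sequentially"
      by (rule eventually_ball_finite) (use assms(1) in \<open>auto simp: coeff_conv_def\<close>)
    moreover have "eventually (\<lambda>N. \<forall>i\<in>{l..k - l'}. fls_nth (f' N) (k - i) = fls_nth g' (k - i)) sequentially"
      by (rule eventually_ball_finite) (use assms(2) in \<open>auto simp: coeff_conv_def\<close>)
    ultimately show ?thesis
      by eventually_elim (simp add: n n')
  qed
  moreover have "\<forall>N. \<forall>i<l + l'. fls_nth (f N * f' N) i = 0" "\<forall>i<l + l'. fls_nth (g * g') i = 0"
    by (auto simp: n n')
  ultimately show ?thesis unfolding coeff_conv_def by blast
qed

lemma coeff_conv_const: "coeff_conv (\<lambda>N. g) g"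
  unfolding coeff_conv_def by (intro conjI exI[of _ "fls_subdegree g"]) auto

lemma coeff_conv_prod:
  assumes "finite C" "\<And>c. c \<in> C \<Longrightarrow> coeff_conv (f c) (g c)"
  shows "coeff_conv (\<lambda>N. \<Prod>c\<in>C. f c N) (\<Prod>c\<in>C. g c)"
  using assms by (induction C) (auto intro: coeff_conv_mult coeff_conv_const)

lemma coeff_conv_ex:
  fixes f :: "nat \<Rightarrow> 'a::comm_ring_1 fls"
  assumes "\<And>N i. i < l \<Longrightarrow> fls_nth (f N) i = 0"
    and "\<And>i. \<exists>c. eventually (\<lambda>N. fls_nth (f N) i = c) sequentially"
  shows "\<exists>g. coeff_conv f g"
proof -
  obtain c where c: "\<And>i. eventually (\<lambda>N. fls_nth (f N) i = c i) sequentially"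
    using assms(2) by metis
  have c0: "c i = 0" if "i < l" for i
  proof -
    have "eventually (\<lambda>N. c i = 0) sequentially"
      using c[of i] by eventually_elim (use assms(1) that in auto)
    then show ?thesis by simp
  qed
  have "fls_nth (Abs_fls c) i = c i" for i
    using nth_Abs_fls_lower_bound[of l c] c0 by simp
  then have "coeff_conv f (Abs_fls c)"
    unfolding coeff_conv_def using assms(1) c0 c by auto
  then show ?thesis by blast
qed

text \<open>Closeness in the q-adic metric concerns the coefficients up to some exponent. Below the
  common bound they all vanish, so only finitely many have to stabilise.\<close>

lemma coeff_conv_LIMSEQ:
  assumes "coeff_conv f g"
  shows "f \<longlonglongrightarrow> g"
proof (rule metric_LIMSEQ_I)
  fix r :: real assume r: "0 < r"
  obtain l where l: "\<forall>N. \<forall>i<l. fls_nth (f N) i = 0" "\<forall>i<l. fls_nth g i = 0"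
    using assms by (auto simp: coeff_conv_def)
  obtain k where k: "inverse (2 ^ k) < r"
    using real_arch_pow_inv[OF r, of "1/2"] by (auto simp: power_one_over inverse_eq_divide)
  have "eventually (\<lambda>N. \<forall>i\<in>{l..int k}. fls_nth (f N) i = fls_nth g i) sequentially"
    by (rule eventually_ball_finite) (use assms in \<open>auto simp: coeff_conv_def\<close>)
  then have "eventually (\<lambda>N. dist (f N) g < r) sequentially"
  proof eventually_elim
    case (elim N)
    show ?case
    proof (cases "f N = g")
      case False
      have z: "fls_nth (f N - g) i = 0" if "i < int k + 1" for i
        using elim l that by (cases "i < l") auto
      then have sd: "int k + 1 \<le> fls_subdegree (f N - g)"
        using False by (intro fls_subdegree_geI) auto
      then have "dist (f N) g = inverse (2 ^ nat (fls_subdegree (f N - g)))"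
        using False by (simp add: dist_fls_def)
      also have "\<dots> \<le> inverse (2 ^ k)"
        by (rule le_imp_inverse_le) (use sd in \<open>auto intro!: power_increasing\<close>)
      finally show ?thesis using k by simp
    qed (use r in simp)
  qed
  then show "\<exists>no. \<forall>N\<ge>no. dist (f N) g < r" by (simp add: eventually_sequentially)
qed

section \<open>Monomials and finite products\<close>

definition smono :: "(nat \<Rightarrow>\<^sub>0 int) \<Rightarrow> int \<Rightarrow> series" where
  "smono a b = fls_const (single a 1) * fls_X_intpow b"

lemma smono_mult: "smono a b * smono a' b' = smono (a + a') (b + b')"
proof -
  have "smono a b * smono a' b' = (fls_const (single a 1) * fls_const (single a' 1)) *
      (fls_X_intpow b * fls_X_intpow b')"
    unfolding smono_def by (simp only: mult_ac)
  then show ?thesis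
    unfolding smono_def fls_const_mult_const fls_X_intpow_times_fls_X_intpow mult_single by simp
qed

lemma smono_0: "smono 0 0 = 1"
  by (simp add: smono_def single_one)

lemma smono_nth: "lookup (fls_nth (smono a b) i) a' = (if i = b \<and> a' = a then 1 else 0)"
  by (auto simp: smono_def fls_X_intpow_times_conv_shift lookup_single)

lemma fls_times_smono_nth: "fls_nth (f * smono a b) i = fls_nth f (i - b) * single a 1"
proof -
  have "f * smono a b = (f * fls_X_intpow b) * fls_const (single a 1)"
    by (simp add: smono_def mult_ac)
  then show ?thesis by (simp add: fls_X_intpow_times_conv_shift(2))
qed

lemma smono_power: "smono 0 b ^ k = smono 0 (int k * b)"
  by (induction k) (simp_all add: smono_0 smono_mult algebra_simps)

lemma q_var_smono: "q_var = smono 0 1" "q_var_inv = smono 0 (- 1)"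
  by (simp_all add: smono_def single_one fls_X_conv_shift_1 fls_X_inv_conv_shift_1)

lemma q_var_power_smono: "q_var ^ k = smono 0 (int k)"
  by (simp add: q_var_smono smono_power)

lemma c_var_smono:
  "c_var k = smono (single k 1) 0" "c_var_inv k = smono (single k (- 1)) 0"
  by (simp_all add: c_var_def c_var_inv_def smono_def)

lemma prod_one_plus:
  fixes g :: "'b \<Rightarrow> 'a::comm_semiring_1"
  assumes "finite A"
  shows "(\<Prod>u\<in>A. 1 + g u) = (\<Sum>S\<in>Pow A. \<Prod>u\<in>S. g u)"
  using assms
proof induction
  case (insert u A)
  have "inj_on (insert u) (Pow A)" "Pow A \<inter> insert u ` Pow A = {}"
    using insert.hyps by (auto simp: inj_on_def)
  then have "(\<Sum>S\<in>Pow (insert u A). \<Prod>v\<in>S. g v) = (\<Sum>S\<in>Pow A. \<Prod>v\<in>S. g v) + (\<Sum>S\<in>Pow A. \<Prod>v\<in>insert u S. g v)"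
    using insert.hyps by (simp add: Pow_insert sum.union_disjoint sum.reindex)
  also have "(\<Sum>S\<in>Pow A. \<Prod>v\<in>insert u S. g v) = (\<Sum>S\<in>Pow A. g u * (\<Prod>v\<in>S. g v))"
    using insert.hyps by (intro sum.cong refl prod.insert) (auto intro: finite_subset)
  finally show ?case
    using insert by (simp add: sum_distrib_left[symmetric] algebra_simps)
qed simp

lemma prod_smono:
  assumes "finite S"
  shows "(\<Prod>u\<in>S. smono (a u) (b u)) = smono (\<Sum>u\<in>S. a u) (\<Sum>u\<in>S. b u)"
  using assms by induction (simp_all add: smono_0 smono_mult)

lemma lookup_prod_one_plus_smono:
  assumes "finite A"
  shows "lookup (fls_nth (\<Prod>u\<in>A. 1 + smono (a u) (b u)) i) k =
    int (card {S \<in> Pow A. (\<Sum>u\<in>S. a u) = k \<and> (\<Sum>u\<in>S. b u) = i})"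
proof -
  have nth_sum: "fls_nth (\<Sum>S\<in>B. f S) i = (\<Sum>S\<in>B. fls_nth (f S) i)" for f :: "'b set \<Rightarrow> series" and B
    by (induction B rule: infinite_finite_induct) auto
  have "(\<Prod>u\<in>A. 1 + smono (a u) (b u)) = (\<Sum>S\<in>Pow A. smono (\<Sum>u\<in>S. a u) (\<Sum>u\<in>S. b u))"
    unfolding prod_one_plus[OF assms]
    by (rule sum.cong) (auto intro!: prod_smono intro: finite_subset[OF _ assms])
  then have "lookup (fls_nth (\<Prod>u\<in>A. 1 + smono (a u) (b u)) i) k =
      (\<Sum>S\<in>Pow A. if i = (\<Sum>u\<in>S. b u) \<and> k = (\<Sum>u\<in>S. a u) then 1 else 0)"
    by (simp add: nth_sum Poly_Mapping.lookup_sum smono_nth)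
  also have "\<dots> = int (card {S \<in> Pow A. i = (\<Sum>u\<in>S. b u) \<and> k = (\<Sum>u\<in>S. a u)})"
    using assms by (simp flip: sum.inter_filter)
  also have "{S \<in> Pow A. i = (\<Sum>u\<in>S. b u) \<and> k = (\<Sum>u\<in>S. a u)} = {S \<in> Pow A. (\<Sum>u\<in>S. a u) = k \<and> (\<Sum>u\<in>S. b u) = i}"
    by auto
  finally show ?thesis .
qed

lemma qpochhammer_coeff_conv:
  assumes "- 1 \<le> b"
  shows "coeff_conv (\<lambda>N. \<Prod>k<N. 1 + smono a (b + 2 * int k)) (qpochhammer_inf (- smono a b) (q_var\<^sup>2))"
proof -
  let ?f = "\<lambda>N. \<Prod>k<N. 1 + smono a (b + 2 * int k)"
  have factor: "1 - (- smono a b) * (q_var\<^sup>2) ^ k = 1 + smono a (b + 2 * int k)" for k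
    by (simp add: q_var_power_smono smono_power smono_mult mult.commute)
  have step: "fls_nth (?f (Suc N)) i = fls_nth (?f N) i + fls_nth (?f N) (i - (b + 2 * int N)) * single a 1" for N i
    by (simp add: distrib_left fls_times_smono_nth)
  \<comment> \<open>Only the factor \<open>k = 0\<close> can lower the exponent, and by at most 1;
    the later factors have exponents \<open>b + 2 k \<ge> 1\<close>. Hence -1 bounds all partial
    products.\<close>
  have low: "fls_nth (?f N) i = 0" if "i < - 1" for N i
    using that
  proof (induction N arbitrary: i)
    case (Suc N)
    show ?case
    proof (cases N)
      case 0
      then show ?thesis using Suc.prems assms by (subst step) simp
    next
      case (Suc N')
      then have "i - (b + 2 * int N) < - 1" using Suc.prems assms by simp
      then show ?thesis using Suc.IH Suc.prems by (subst step) simp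
    qed
  qed simp
  have const: "\<exists>c. eventually (\<lambda>N. fls_nth (?f N) i = c) sequentially" for i
  proof -
    \<comment> \<open>From \<open>N \<ge> i + 3\<close> on, \<open>i - (b + 2 N)\<close> lies below
      -1, so a further factor no longer affects the coefficient at \<open>i\<close>.\<close>
    define N0 where "N0 = nat (i + 3)"
    have "fls_nth (?f (N0 + d)) i = fls_nth (?f N0) i" for d
    proof (induction d)
      case (Suc d)
      have "i - (b + 2 * int (N0 + d)) < - 1" 
      proof -
        have "i + 3 \<le> int N0" unfolding N0_def by simp
        then show ?thesis using assms by simp
      qed
      then have "fls_nth (?f (N0 + d)) (i - (b + 2 * int (N0 + d))) = 0" by (rule low)
      then show ?case using Suc by (simp only: add_Suc_right step) simp
    qed simp
    then have "\<forall>N\<ge>N0. fls_nth (?f N) i = fls_nth (?f N0) i"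
      by (metis le_add_diff_inverse)
    then show ?thesis by (auto simp: eventually_sequentially)
  qed
  obtain g where g: "coeff_conv ?f g" using coeff_conv_ex[of "- 1" ?f] low const by blast
  have "qpochhammer_inf (- smono a b) (q_var\<^sup>2) = lim ?f"
    unfolding qpochhammer_inf_def factor ..
  also have "\<dots> = g" by (rule limI) (rule coeff_conv_LIMSEQ[OF g])
  finally show ?thesis using g by simp
qed

section \<open>The generating function of states\<close>

definition cexp :: "mode \<Rightarrow> nat \<Rightarrow>\<^sub>0 int" where
  "cexp u = single (fst (fst u)) (if snd (fst u) then 1 else - 1)"

context D_fock
begin

text \<open>The exponent \<open>p + 2 - 2 * \<theta> c\<close> is that of the top creation mode
  \<open>(c, \<theta> c - 1)\<close>, and each lower mode adds 2. The second component 0 is a dummy,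
  since \<open>cexp\<close> depends only on the colour.\<close>

definition fermion_product :: series where
  "fermion_product = (\<Prod>c\<in>{1..n} \<times> UNIV. qpochhammer_inf (- smono (cexp (c, 0)) (p + 2 - 2 * \<theta> c)) (q_var\<^sup>2))"

definition all_states :: "state set" where
  "all_states = {S. cstate S \<and> (\<forall>u\<in>fset S. fst (fst u) \<in> {1..n})}"

lemma lookup_fermion_product:
  "lookup (fls_nth fermion_product b) a =
    int (card {S \<in> all_states. weight cexp S = a \<and> weight en S = b})"
proof -
  let ?C = "{1..n} \<times> (UNIV :: bool set)"
  let ?f = "\<lambda>N. \<Prod>c\<in>?C. \<Prod>k<N. 1 + smono (cexp (c, 0)) (p + 2 - 2 * \<theta> c + 2 * int k)"
  let ?M = "\<lambda>N. (\<lambda>(c, k). (c, \<theta> c - 1 - int k)) ` (?C \<times> {..<N})"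
  let ?T = "{S \<in> all_states. weight cexp S = a \<and> weight en S = b}"
  have "coeff_conv ?f fermion_product"
    unfolding fermion_product_def
  proof (intro coeff_conv_prod qpochhammer_coeff_conv)
    fix c assume "c \<in> ?C"
    then show "- 1 \<le> p + 2 - 2 * \<theta> c" using energy[of c] by (cases c) auto
  qed simp
  then have ev1: "eventually (\<lambda>N. fls_nth (?f N) b = fls_nth fermion_product b) sequentially"
    by (simp add: coeff_conv_def)
  have f: "?f N = (\<Prod>u\<in>?M N. 1 + smono (cexp u) (en u))" for N
  proof -
    have "(\<Prod>u\<in>?M N. 1 + smono (cexp u) (en u)) =
        (\<Prod>(c, k)\<in>?C \<times> {..<N}. 1 + smono (cexp (c, 0)) (p + 2 - 2 * \<theta> c + 2 * int k))"
      by (subst prod.reindex) (auto simp: inj_on_def cexp_def en_def algebra_simps intro!: prod.cong)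
    then show ?thesis by (simp add: prod.cartesian_product split_def)
  qed
  have "finite ?T"
    by (rule finite_subset[OF _ finite_energy[of b]]) (auto simp: all_states_def)
  \<comment> \<open>Only finitely many states contribute to the given exponents, so a sufficiently
    long partial product contains all their modes.\<close>
  have "eventually (\<lambda>N. \<forall>S\<in>?T. \<forall>u\<in>fset S. u \<in> ?M N) sequentially"
  proof (intro eventually_ball_finite ballI)
    fix S u assume S: "S \<in> ?T" and u: "u \<in> fset S"
    obtain c r where cr: "u = (c, r)" by (cases u)
    have c: "c \<in> ?C" and r: "r < \<theta> c" using S u cr by (cases c; auto simp: all_states_def cstate_def)+
    have "u \<in> ?M N" if "N \<ge> nat (\<theta> c - r)" for N
      by (rule image_eqI[where x = "(c, nat (\<theta> c - 1 - r))"]) (use that c r cr in auto)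
    then show "eventually (\<lambda>N. u \<in> ?M N) sequentially" by (auto simp: eventually_sequentially)
  qed (use \<open>finite ?T\<close> in auto)
  with ev1 have "eventually (\<lambda>N. lookup (fls_nth fermion_product b) a = int (card ?T)) sequentially"
  proof eventually_elim
    case (elim N)
    have finM: "finite (?M N)" by simp
    have M: "snd u < \<theta> (fst u) \<and> fst (fst u) \<in> {1..n}" if "u \<in> ?M N" for u using that by auto
    have "bij_betw fset ?T {S \<in> Pow (?M N). (\<Sum>u\<in>S. cexp u) = a \<and> (\<Sum>u\<in>S. en u) = b}"
    proof (rule bij_betw_imageI)
      show "inj_on fset ?T" by (simp add: inj_on_def fset_inject)
      show "fset ` ?T = {S \<in> Pow (?M N). (\<Sum>u\<in>S. cexp u) = a \<and> (\<Sum>u\<in>S. en u) = b}"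
      proof (intro equalityI subsetI)
        fix S' assume "S' \<in> fset ` ?T"
        then show "S' \<in> {S \<in> Pow (?M N). (\<Sum>u\<in>S. cexp u) = a \<and> (\<Sum>u\<in>S. en u) = b}"
          using elim(2) by (auto simp: weight_def simp del: split_paired_All)
      next
        fix S' assume S': "S' \<in> {S \<in> Pow (?M N). (\<Sum>u\<in>S. cexp u) = a \<and> (\<Sum>u\<in>S. en u) = b}"
        then have "finite S'" using finM finite_subset by blast
        then have fs: "fset (Abs_fset S') = S'" by (simp add: Abs_fset_inverse)
        have "Abs_fset S' \<in> ?T"
        proof -
          have "\<forall>u\<in>S'. snd u < \<theta> (fst u) \<and> fst (fst u) \<in> {1..n}"
          proof
            fix u assume "u \<in> S'"
            then have "u \<in> ?M N" using S' by blast
            then show "snd u < \<theta> (fst u) \<and> fst (fst u) \<in> {1..n}" by (rule M)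
          qed
          then show ?thesis
            using S' unfolding all_states_def cstate_def weight_def mem_Collect_eq fs by simp
        qed
        then have "fset (Abs_fset S') \<in> fset ` ?T" by (rule imageI)
        then show "S' \<in> fset ` ?T" unfolding fs .
      qed
    qed
    then have "card ?T = card {S \<in> Pow (?M N). (\<Sum>u\<in>S. cexp u) = a \<and> (\<Sum>u\<in>S. en u) = b}"
      by (rule bij_betw_same_card)
    then show ?case
      using lookup_prod_one_plus_smono[OF finM, of cexp en b a] elim(1) unfolding f by simp
  qed
  then show ?thesis by simp
qed

lemma lookup_sum_cexp:
  "lookup (weight cexp S) k = (\<Sum>u\<in>fset S. colour_charge (P k) u)"
  unfolding weight_def Poly_Mapping.lookup_sum
  by (rule sum.cong) (auto simp: cexp_def lookup_single colour_charge_def prod_eq_iff)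

lemma keys_sum_cexp:
  assumes "S \<in> all_states"
  shows "keys (weight cexp S) \<subseteq> {1..n}"
proof
  fix k assume "k \<in> keys (weight cexp S)"
  then have "(\<Sum>u\<in>fset S. lookup (cexp u) k) \<noteq> 0"
    by (simp add: in_keys_iff weight_def Poly_Mapping.lookup_sum)
  then obtain u where u: "u \<in> fset S" "lookup (cexp u) k \<noteq> 0"
    by (meson sum.not_neutral_contains_not_neutral)
  then have "fst (fst u) = k" by (auto simp: cexp_def lookup_single when_def split: if_splits)
  then show "k \<in> {1..n}" using assms u by (auto simp: all_states_def)
qed

lemma states_iff_even:
  assumes "S \<in> all_states"
  shows "S \<in> states \<longleftrightarrow> even (\<Sum>k\<in>{1..n}. lookup (weight cexp S) k)"
  using assms charge_sum_parity[of S n]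
  by (auto simp: states_def all_states_def lookup_sum_cexp)

lemma lookup_even_fermion_product:
  "lookup (fls_nth (even_part {1..n} fermion_product) b) a =
    int (card {S \<in> states. weight cexp S = a \<and> weight en S = b})"
proof -
  have "{S \<in> states. weight cexp S = a \<and> weight en S = b} =
      (if even (\<Sum>k\<in>{1..n}. lookup a k) then {S \<in> all_states. weight cexp S = a \<and> weight en S = b} else {})"
    using states_iff_even by (auto simp: states_def all_states_def)
  then show ?thesis
    by (simp add: even_part.rep_eq even_part_coeff.rep_eq lookup_fermion_product)
qed

text \<open>A sum over an infinite index set would take the default value 0. Injectivity leaves at
  most one monomial with exponent \<open>\<mu>\<close>, and its coefficient is the number of states
  of that weight.\<close>

lemma to_exponentials_fermion_product:
  assumes inj: "\<And>a a' b b'. keys a \<subseteq> {1..n} \<Longrightarrow> keys a' \<subseteq> {1..n} \<Longrightarrow>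
      monomial_exponent \<gamma> \<beta> a b = monomial_exponent \<gamma> \<beta> a' b' \<Longrightarrow> a = a' \<and> b = b'"
  shows "to_exponentials \<gamma> \<beta> (even_part {1..n} fermion_product) \<mu> =
    int (card {S \<in> states. monomial_exponent \<gamma> \<beta> (weight cexp S) (weight en S) = \<mu>})"
proof -
  let ?G = "even_part {1..n} fermion_product"
  let ?I = "{(a, b). lookup (fls_nth ?G b) a \<noteq> 0 \<and> monomial_exponent \<gamma> \<beta> a b = \<mu>}"
  let ?T = "{S \<in> states. monomial_exponent \<gamma> \<beta> (weight cexp S) (weight en S) = \<mu>}"
  have keys: "keys (weight cexp S) \<subseteq> {1..n}" if "S \<in> states" for S
    using that keys_sum_cexp[of S] by (auto simp: states_def all_states_def)
  show ?thesis
  proof (cases "?T = {}")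
    case True
    have "?I = {}"
    proof -
      have "False" if "(a, b) \<in> ?I" for a b
      proof -
        have "card {S \<in> states. weight cexp S = a \<and> weight en S = b} \<noteq> 0"
          using that by (simp add: lookup_even_fermion_product del: One_nat_def)
        then obtain S where "S \<in> states" "weight cexp S = a" "weight en S = b"
          by (metis (mono_tags, lifting) card.empty ex_in_conv mem_Collect_eq)
        then have "S \<in> ?T" using that by simp
        then show False using True by blast
      qed
      then show ?thesis by auto
    qed
    then show ?thesis unfolding to_exponentials_def True by (simp only: sum.empty card.empty)
  next
    case False
    then obtain S0 where S0: "S0 \<in> states" "monomial_exponent \<gamma> \<beta> (weight cexp S0) (weight en S0) = \<mu>" by blast
    define a0 b0 where "a0 = weight cexp S0" and "b0 = weight en S0"
    have T: "?T = {S \<in> states. weight cexp S = a0 \<and> weight en S = b0}"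
    proof (intro equalityI subsetI)
      fix S assume S: "S \<in> ?T"
      then have "monomial_exponent \<gamma> \<beta> (weight cexp S) (weight en S) =
          monomial_exponent \<gamma> \<beta> (weight cexp S0) (weight en S0)" using S0 by simp
      then have "weight cexp S = weight cexp S0 \<and> weight en S = weight en S0"
        using S S0(1) keys by (intro inj) auto
      then show "S \<in> {S \<in> states. weight cexp S = a0 \<and> weight en S = b0}"
        using S by (simp add: a0_def b0_def)
    next
      fix S assume "S \<in> {S \<in> states. weight cexp S = a0 \<and> weight en S = b0}"
      then show "S \<in> ?T" using S0(2) by (simp add: a0_def b0_def)
    qed
    have fin: "finite ?T"
      unfolding T by (rule finite_subset[OF _ finite_energy[of b0]]) (auto simp: states_def)
    have "?I = {(a0, b0)}"
    proof -
      have 1: "(a, b) = (a0, b0)" if "(a, b) \<in> ?I" for a b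
      proof -
        have "card {S \<in> states. weight cexp S = a \<and> weight en S = b} \<noteq> 0"
          using that by (simp add: lookup_even_fermion_product del: One_nat_def)
        then obtain S where S: "S \<in> states" "weight cexp S = a" "weight en S = b"
          by (metis (mono_tags, lifting) card.empty ex_in_conv mem_Collect_eq)
        then have "S \<in> ?T" using that by simp
        then show ?thesis unfolding T using S by simp
      qed
      have 2: "(a0, b0) \<in> ?I"
      proof -
        have "lookup (fls_nth ?G b0) a0 = int (card ?T)"
          unfolding lookup_even_fermion_product T ..
        also have "\<dots> \<noteq> 0" using fin False by (simp add: card_eq_0_iff)
        finally show ?thesis using S0(2) by (simp add: a0_def b0_def)
      qed
      show ?thesis
      proof (rule equalityI)
        show "?I \<subseteq> {(a0, b0)}"
        proof
          fix z assume "z \<in> ?I"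
          then show "z \<in> {(a0, b0)}" using 1[of "fst z" "snd z"] by (simp only: prod.collapse singleton_iff)
        qed
        show "{(a0, b0)} \<subseteq> ?I" using 2 by (simp only: insert_subset empty_subsetI simp_thms)
      qed
    qed
    then have "to_exponentials \<gamma> \<beta> ?G \<mu> = lookup (fls_nth ?G b0) a0"
      unfolding to_exponentials_def by simp
    also have "\<dots> = int (card ?T)" unfolding lookup_even_fermion_product T ..
    finally show ?thesis .
  qed
qed

end

section \<open>Root data of type \<open>D\<^sub>n\<^sup>(\<^sup>1\<^sup>)\<close> and the characters\<close>

definition signed_exponent :: "(nat \<Rightarrow> 'g \<Rightarrow> complex) \<Rightarrow> colour \<Rightarrow> 'g \<Rightarrow> complex" where
  "signed_exponent \<gamma> a x = (if snd a then \<gamma> (fst a) x else - \<gamma> (fst a) x)"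

lemma c_exponent_rec:
  assumes "1 \<le> k" "k \<le> n - 2"
  shows "c_exponent n \<alpha> k x = \<alpha> k x + c_exponent n \<alpha> (Suc k) x"
  using assms by (auto simp: c_exponent_def sum.atLeast_Suc_atMost)

lemma c_exponent_last:
  assumes "4 \<le> n"
  shows "c_exponent n \<alpha> (n - 1) x = \<alpha> (n - 1) x / 2 + \<alpha> n x / 2"
    and "c_exponent n \<alpha> n x = \<alpha> n x / 2 - \<alpha> (n - 1) x / 2"
  using assms by (auto simp: c_exponent_def)

lemma null_root_c_exponent:
  assumes "4 \<le> n"
  shows "null_root n \<alpha> x = \<alpha> 0 x + c_exponent n \<alpha> 1 x + c_exponent n \<alpha> 2 x"
proof -
  have "c_exponent n \<alpha> 1 x = \<alpha> 1 x + c_exponent n \<alpha> 2 x"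
    using c_exponent_rec[of 1 n \<alpha> x] assms by (simp add: numeral_2_eq_2)
  moreover have "c_exponent n \<alpha> 2 x = (\<Sum>i=2..n-2. \<alpha> i x) + \<alpha> (n - 1) x / 2 + \<alpha> n x / 2"
    using assms by (auto simp: c_exponent_def)
  ultimately show ?thesis
    by (simp add: null_root_def sum_distrib_left[symmetric])
qed

text \<open>Here \<open>q_exponent\<close> is -\<delta>/2, so the last term contributes
  \<open>mm i\<close> times \<delta>; this ties the mode index of the quadratic operators to the
  null root.\<close>

lemma simple_root_eq:
  assumes n: "4 \<le> n" and i: "i \<le> n"
  shows "\<alpha> i x = signed_exponent (c_exponent n \<alpha>) (aa n i) x + signed_exponent (c_exponent n \<alpha>) (bb n i) x
    - 2 * of_int (mm i) * q_exponent n \<alpha> x"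
proof -
  consider "i = 0" | "1 \<le> i" "i \<le> n - 2" | "i = n - 1" | "i = n" using i by linarith
  then show ?thesis
  proof cases
    case 1
    then show ?thesis using n
      by (simp add: signed_exponent_def aa_def bb_def mm_def q_exponent_def null_root_c_exponent field_simps)
  next
    case 2
    then show ?thesis using n c_exponent_rec[of i n \<alpha> x]
      by (auto simp: signed_exponent_def aa_def bb_def mm_def)
  next
    case 3
    then have "Suc i = n" "i \<noteq> 0" "i \<noteq> n" using n by auto
    then show ?thesis using 3 c_exponent_last[OF n, of \<alpha> x]
      by (simp add: signed_exponent_def aa_def bb_def mm_def)
  next
    case 4
    then have "n \<noteq> 0" using n by auto
    then show ?thesis using 4 c_exponent_last[OF n, of \<alpha> x]
      by (simp add: signed_exponent_def aa_def bb_def mm_def)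
  qed
qed

text \<open>Writing \<open>n = m + 4\<close> removes the truncated subtractions from the description
  of the diagram.\<close>

lemma D1_edge_left: "D1_edge (m + 4) i k \<longleftrightarrow>
  (if i \<le> 1 then k = 2 else if i \<le> m + 1 then k = Suc i else if i = m + 2 then k = m + 3 \<or> k = m + 4 else False)"
  unfolding D1_edge_def by (simp split del: if_split) presburger

lemma D1_edge_right: "D1_edge (m + 4) k i \<longleftrightarrow>
  (if i = 2 then k \<le> 1 else if 3 \<le> i \<and> i \<le> m + 2 then Suc k = i else if i = m + 3 \<or> i = m + 4 then k = m + 2 else False)"
  unfolding D1_edge_def by (simp split del: if_split) presburger

text \<open>\<open>c\<close> lists the \<epsilon>-coordinates of the i-th simple coroot. The entries
  of the row are its pairings with \<epsilon>_k - \<epsilon>_(k+1) and \<epsilon>_(n-1) +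
  \<epsilon>_n, and with the finite part -\<epsilon>_1 - \<epsilon>_2 of the affine root.\<close>

lemma D1_cartan_matrix_row: assumes "i \<le> m + 4"
  defines "c \<equiv> \<lambda>k. (if i = 0 then (if k = 1 then -1 else 0) + (if k = 2 then -1 else 0)
      else if i = m + 4 then (if k = m + 3 then 1 else 0) + (if k = m + 4 then 1 else 0)
      else (if k = i then 1 else 0) - (if k = Suc i then 1 else (0::int)))"
  shows "1 \<le> k \<Longrightarrow> k \<le> m + 2 \<Longrightarrow> D1_cartan_matrix (m + 4) i k = c k - c (Suc k)"
  "D1_cartan_matrix (m + 4) i (m + 3) = c (m + 3) - c (m + 4)"
    "D1_cartan_matrix (m + 4) i (m + 4) = c (m + 3) + c (m + 4)"
    "D1_cartan_matrix (m + 4) i 0 = - c 1 - c 2"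
proof -
  show "D1_cartan_matrix (m + 4) i (m + 3) = c (m + 3) - c (m + 4)"
    "D1_cartan_matrix (m + 4) i (m + 4) = c (m + 3) + c (m + 4)"
    "D1_cartan_matrix (m + 4) i 0 = - c 1 - c 2"
   using assms(1) unfolding D1_cartan_matrix_def D1_edge_left D1_edge_right c_def by (simp_all split: if_split) 
  show "D1_cartan_matrix (m + 4) i k = c k - c (Suc k)" if "1 \<le> k" "k \<le> m + 2"
   using assms(1) that unfolding D1_cartan_matrix_def D1_edge_left D1_edge_right c_def by (simp split: if_split) 
qed

lemma D1_cartan_matrix_charge:
  assumes n: "4 \<le> n" and i: "i \<le> n"
  defines "c \<equiv> \<lambda>k. colour_charge (aa n i) (P k, 0) + colour_charge (bb n i) (P k, 0) :: int"
  shows "1 \<le> k \<Longrightarrow> k \<le> n - 2 \<Longrightarrow> D1_cartan_matrix n i k = c k - c (Suc k)"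
    and "D1_cartan_matrix n i (n - 1) = c (n - 1) - c n"
    and "D1_cartan_matrix n i n = c (n - 1) + c n"
    and "D1_cartan_matrix n i 0 = - c 1 - c 2"
proof -
  obtain m where nm: "n = m + 4" using n by (metis add.commute le_Suc_ex)
  have c: "c k = (if i = 0 then (if k = 1 then -1 else 0) + (if k = 2 then -1 else 0)
      else if i = m + 4 then (if k = m + 3 then 1 else 0) + (if k = m + 4 then 1 else 0)
      else (if k = i then 1 else 0) - (if k = Suc i then 1 else 0))" for k
    by (simp add: c_def colour_charge_def aa_def bb_def nm)
  have sub: "m + 4 - 1 = m + 3" "m + 4 - 2 = m + 2" by auto
  note row = D1_cartan_matrix_row[OF i[unfolded nm]]
  show "1 \<le> k \<Longrightarrow> k \<le> n - 2 \<Longrightarrow> D1_cartan_matrix n i k = c k - c (Suc k)"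
    unfolding c unfolding nm sub by (rule row(1))
  show "D1_cartan_matrix n i (n - 1) = c (n - 1) - c n"
    unfolding c unfolding nm sub by (rule row(2))
  show "D1_cartan_matrix n i n = c (n - 1) + c n"
    unfolding c unfolding nm sub by (rule row(3))
  show "D1_cartan_matrix n i 0 = - c 1 - c 2"
    unfolding c unfolding nm sub by (rule row(4))
qed

context lie_algebra
begin

lemma dual_on_add: "\<mu> \<in> dual_on H \<Longrightarrow> \<nu> \<in> dual_on H \<Longrightarrow> (\<lambda>x. \<mu> x + \<nu> x) \<in> dual_on H"
  by (auto simp: dual_on_def algebra_simps)

lemma dual_on_mult: "\<mu> \<in> dual_on H \<Longrightarrow> (\<lambda>x. c * \<mu> x) \<in> dual_on H"
  by (auto simp: dual_on_def algebra_simps)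

lemma dual_on_sum:
  assumes "\<And>i. i \<in> B \<Longrightarrow> \<mu> i \<in> dual_on H"
  shows "(\<lambda>x. \<Sum>i\<in>B. \<mu> i x) \<in> dual_on H"
  using assms
proof (induction B rule: infinite_finite_induct)
  case (insert i B)
  then have "(\<lambda>x. \<mu> i x + (\<Sum>j\<in>B. \<mu> j x)) \<in> dual_on H" by (intro dual_on_add) auto
  then show ?case using insert.hyps by simp
qed (auto simp: dual_on_def)

end

section \<open>Exponents as functionals on the Cartan subalgebra\<close>

locale D1_algebra =
  kac_moody_algebra scale bracket "{0..n}" "D1_cartan_matrix n" cartan e f coroot \<alpha>
  for n :: nat
    and scale :: "complex \<Rightarrow> 'g::ab_group_add \<Rightarrow> 'g"
    and bracket :: "'g \<Rightarrow> 'g \<Rightarrow> 'g"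
    and cartan :: "'g set"
    and e f coroot :: "nat \<Rightarrow> 'g"
    and \<alpha> :: "nat \<Rightarrow> 'g \<Rightarrow> complex" +
  assumes n4: "4 \<le> n"
begin

abbreviation "\<gamma> \<equiv> c_exponent n \<alpha>"
abbreviation "\<beta> \<equiv> q_exponent n \<alpha>"

text \<open>The values for n-1 and n are the half-sum and half-difference of the last two roots on
  the coroot; the other values follow downwards, adding one root at a time.\<close>

lemma c_exponent_coroot:
  assumes i: "i \<le> n" and k: "k \<in> {1..n}"
  shows "\<gamma> k (coroot i) = of_int (colour_charge (aa n i) (P k, 0) + colour_charge (bb n i) (P k, 0))"
    (is "_ = of_int (?c k)")
proof -
  have \<alpha>: "\<alpha> j (coroot i) = of_int (D1_cartan_matrix n i j)" if "j \<le> n" for j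
    using root_coroot[of i j] that i by simp
  note A = D1_cartan_matrix_charge[OF n4 i]
  have last: "\<gamma> n (coroot i) = of_int (?c n)" "\<gamma> (n - 1) (coroot i) = of_int (?c (n - 1))"
    unfolding c_exponent_last[OF n4] \<alpha>[OF le_refl] \<alpha>[OF diff_le_self] A(2,3)
    by (simp_all only: of_int_add of_int_diff) (simp_all add: field_simps)
  show ?thesis
  proof (cases "k = n")
    case False
    then have "k \<le> n - 1" using k by auto
    moreover have "1 \<le> k" using k by simp
    ultimately show ?thesis
    proof (induction k rule: inc_induct)
      case base show ?case by (rule last(2))
    next
      case (step j)
      then have "j \<le> n - 2" by linarith
      then show ?case
        using step c_exponent_rec[of j n \<alpha> "coroot i"] A(1)[of j] \<alpha>[of j] by simp
    qed
  qed (use last in simp)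
qed

lemma q_exponent_coroot:
  assumes i: "i \<le> n"
  shows "\<beta> (coroot i) = 0"
proof -
  have "\<alpha> 0 (coroot i) = of_int (D1_cartan_matrix n i 0)"
    using root_coroot[of i 0] i by simp
  then have "null_root n \<alpha> (coroot i) = 0"
    unfolding null_root_c_exponent[OF n4]
    using c_exponent_coroot[OF i, of 1] c_exponent_coroot[OF i, of 2] D1_cartan_matrix_charge(4)[OF n4 i] n4
    by simp
  then show ?thesis by (simp add: q_exponent_def)
qed

lemma signed_exponent_coroot:
  assumes "i \<le> n" "fst a \<in> {1..n}"
  shows "signed_exponent \<gamma> a (coroot i) = of_int (colour_charge (aa n i) (a, r) + colour_charge (bb n i) (a, r))"
  using c_exponent_coroot[OF assms]
  by (cases a; cases "snd a") (auto simp: signed_exponent_def colour_charge_def bar_def prod_eq_iff)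

lemma root_dual: "i \<le> n \<Longrightarrow> \<alpha> i \<in> dual_on cartan"
  by (rule root_in_dual) simp

lemma c_exponent_dual:
  assumes "k \<in> {1..n}"
  shows "\<gamma> k \<in> dual_on cartan"
proof (cases "k = n")
  case True
  have "(\<lambda>x. 1 / 2 * \<alpha> n x + (- 1 / 2) * \<alpha> (n - 1) x) \<in> dual_on cartan"
    by (intro dual_on_add dual_on_mult root_dual) auto
  also have "(\<lambda>x. 1 / 2 * \<alpha> n x + (- 1 / 2) * \<alpha> (n - 1) x) = \<gamma> k"
    using True by (simp add: fun_eq_iff c_exponent_def)
  finally show ?thesis .
next
  case False
  have "(\<lambda>x. (\<Sum>i=k..n - 2. \<alpha> i x) + (1 / 2 * \<alpha> (n - 1) x + 1 / 2 * \<alpha> n x)) \<in> dual_on cartan"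
    by (intro dual_on_add dual_on_mult dual_on_sum root_dual) auto
  also have "(\<lambda>x. (\<Sum>i=k..n - 2. \<alpha> i x) + (1 / 2 * \<alpha> (n - 1) x + 1 / 2 * \<alpha> n x)) = \<gamma> k"
    using False by (simp add: fun_eq_iff c_exponent_def)
  finally show ?thesis .
qed

lemma q_exponent_dual: "\<beta> \<in> dual_on cartan"
proof -
  have "(\<lambda>x. (- 1 / 2) * (\<alpha> 0 x + (\<gamma> 1 x + \<gamma> 2 x))) \<in> dual_on cartan"
    by (intro dual_on_add dual_on_mult root_dual c_exponent_dual) (use n4 in auto)
  also have "(\<lambda>x. (- 1 / 2) * (\<alpha> 0 x + (\<gamma> 1 x + \<gamma> 2 x))) = \<beta>"
    by (simp add: fun_eq_iff q_exponent_def null_root_c_exponent[OF n4] field_simps)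
  finally show ?thesis .
qed

lemma monomial_exponent_eq:
  assumes "keys a \<subseteq> {1..n}"
  shows "monomial_exponent \<gamma> \<beta> a b x = (\<Sum>k=1..n. of_int (lookup a k) * \<gamma> k x) + of_int b * \<beta> x"
  unfolding monomial_exponent_def using assms
  by (intro arg_cong2[where f = "(+)"] sum.mono_neutral_left) (auto simp: in_keys_iff)

lemma q_exponent_nonzero: "\<exists>x. \<beta> x \<noteq> 0"
proof (rule ccontr)
  assume "\<not> ?thesis"
  then have z: "null_root n \<alpha> x = 0" for x by (simp add: q_exponent_def)
  let ?c = "\<lambda>i. if i \<in> {2..n - 2} then 2 else 1 :: complex"
  have "(\<Sum>i\<in>{0..n}. ?c i * \<alpha> i x) = null_root n \<alpha> x" for x
  proof -
    have "{0..n} = {2..n - 2} \<union> {0, 1, n - 1, n}" using n4 by auto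
    then have "(\<Sum>i\<in>{0..n}. ?c i * \<alpha> i x) =
        (\<Sum>i\<in>{2..n - 2}. ?c i * \<alpha> i x) + (\<Sum>i\<in>{0, 1, n - 1, n}. ?c i * \<alpha> i x)"
      using n4 by (simp only:) (rule sum.union_disjoint, auto)
    also have "(\<Sum>i\<in>{2..n - 2}. ?c i * \<alpha> i x) = (\<Sum>i=2..n - 2. 2 * \<alpha> i x)"
      by (rule sum.cong) auto
    also have "(\<Sum>i\<in>{0, 1, n - 1, n}. ?c i * \<alpha> i x) = \<alpha> 0 x + \<alpha> 1 x + \<alpha> (n - 1) x + \<alpha> n x"
      using n4 by auto
    finally show ?thesis by (simp add: null_root_def)
  qed
  then have "?c 0 = 0" using z by (intro roots_independent) auto
  then show False by simp
qed

text \<open>On the coroots the exponent of q vanishes, so the difference \<open>d\<close> pairs to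
  zero with each of them. Nodes n-1 and n give \<open>d (n - 1) = d n = 0\<close>, and the chain
  carries this down to 1. The exponent of q is then determined because \<delta> is not zero.\<close>

lemma monomial_exponent_inj:
  assumes a: "keys a \<subseteq> {1..n}" and a': "keys a' \<subseteq> {1..n}"
    and eq: "monomial_exponent \<gamma> \<beta> a b = monomial_exponent \<gamma> \<beta> a' b'"
  shows "a = a' \<and> b = b'"
proof -
  define d where "d k = lookup a k - lookup a' k" for k
  have z: "(\<Sum>k=1..n. of_int (d k) * \<gamma> k x) + of_int (b - b') * \<beta> x = 0" for x
    using fun_cong[OF eq, of x] unfolding monomial_exponent_eq[OF a] monomial_exponent_eq[OF a']
    by (simp add: d_def sum_subtractf algebra_simps)
  have sd: "(if snd (aa n i) then d (fst (aa n i)) else - d (fst (aa n i)))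
      + (if snd (bb n i) then d (fst (bb n i)) else - d (fst (bb n i))) = 0" if i: "i \<le> n" for i
  proof -
    have s: "(\<Sum>k=1..n. d k * colour_charge c (P k, 0)) = (if snd c then d (fst c) else - d (fst c))"
      if "fst c \<in> {1..n}" for c
    proof -
      have "(\<Sum>k=1..n. d k * colour_charge c (P k, 0)) =
          (\<Sum>k=1..n. if k = fst c then if snd c then d k else - d k else 0)"
        by (rule sum.cong) (auto simp: colour_charge_def bar_def prod_eq_iff)
      then show ?thesis using that by simp
    qed
    have "of_int (\<Sum>k=1..n. d k * (colour_charge (aa n i) (P k, 0) + colour_charge (bb n i) (P k, 0))) = (0::complex)"
      using z[of "coroot i"] q_exponent_coroot[OF i] c_exponent_coroot[OF i] by simp
    then have "(\<Sum>k=1..n. d k * colour_charge (aa n i) (P k, 0)) + (\<Sum>k=1..n. d k * colour_charge (bb n i) (P k, 0)) = 0"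
      by (simp only: of_int_eq_0_iff distrib_left sum.distrib)
    then show ?thesis
      using s[of "aa n i"] s[of "bb n i"] i n4 by (auto simp: aa_def bb_def split: if_splits)
  qed
  have dn: "d (n - 1) = 0" "d n = 0"
  proof -
    have "n - 1 \<noteq> n" "n - 1 \<noteq> 0" "n - 1 + 1 = n" "n \<noteq> 0" using n4 by auto
    then have "aa n (n - 1) = P (n - 1)" "bb n (n - 1) = M n" "aa n n = P (n - 1)" "bb n n = P n"
      unfolding aa_def bb_def by (simp_all only: simp_thms if_False if_True)
    then show "d (n - 1) = 0" "d n = 0" using sd[of n] sd[of "n - 1"] by auto
  qed
  have d0: "d k = 0" if "k \<in> {1..n}" for k
  proof (cases "k = n")
    case False
    then have "k \<le> n - 1" "1 \<le> k" using that by auto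
    then show ?thesis
    proof (induction k rule: inc_induct)
      case base show ?case by (rule dn)
    next
      case (step j)
      then have "j \<le> n" "j \<noteq> n" "j \<noteq> 0" by auto
      moreover from this have "aa n j = P j" "bb n j = M (Suc j)" by (simp_all add: aa_def bb_def)
      ultimately show ?case using sd[of j] step by simp
    qed
  qed (use dn in simp)
  have "a = a'"
  proof (rule poly_mapping_eqI)
    fix k
    show "lookup a k = lookup a' k"
    proof (cases "k \<in> {1..n}")
      case True then show ?thesis using d0[OF True] by (simp add: d_def)
    next
      case False
      then have "k \<notin> keys a" "k \<notin> keys a'" using a a' by blast+
      then show ?thesis by (simp add: in_keys_iff)
    qed
  qed
  moreover have "b = b'"
  proof -
    obtain x where "\<beta> x \<noteq> 0" using q_exponent_nonzero by blast
    moreover have "(\<Sum>k=1..n. of_int (d k) * \<gamma> k x) = 0" by (rule sum.neutral) (use d0 in simp)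
    ultimately show ?thesis using z[of x] by simp
  qed
  ultimately show ?thesis by simp
qed

end

section \<open>The character formula for one vacuum\<close>

context D_fock
begin

lemma character_formula:
  fixes scale :: "complex \<Rightarrow> 'g::ab_group_add \<Rightarrow> 'g"
    and scaleV :: "complex \<Rightarrow> 'v::ab_group_add \<Rightarrow> 'v"
  assumes L: "irreducible_highest_weight_module scale bracket {0..n} (D1_cartan_matrix n)
                cartan e f coroot \<alpha> scaleV act (\<Lambda> i0)"
    and \<Lambda>: "kac_moody_algebra.fundamental_weights scale {0..n} cartan coroot \<Lambda>"
    and i0: "i0 \<le> n" and const: "\<And>i. i \<le> n \<Longrightarrow> const i = (if i = i0 then 1 else 0)"
  shows "exp_times (- \<Lambda> i0) (kac_moody_module.ch scale cartan scaleV act) =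
    to_exponentials (c_exponent n \<alpha>) (q_exponent n \<alpha>) (even_part {1..n} fermion_product)"
proof -
  interpret L: irreducible_highest_weight_module scale bracket "{0..n}" "D1_cartan_matrix n"
    cartan e f coroot \<alpha> scaleV act "\<Lambda> i0" by (rule L)
  interpret A: D1_algebra n scale bracket cartan e f coroot \<alpha>
    by unfold_locales (rule n)
  let ?\<gamma> = "c_exponent n \<alpha>" and ?\<beta> = "q_exponent n \<alpha>"
  \<comment> \<open>The weight contributed by a single mode, evaluated at the Cartan element
    \<open>x\<close>; it is odd, so every \<open>x\<close> defines a grading of the Fock
    space.\<close>
  define g where "g x u = signed_exponent ?\<gamma> (fst u) x + of_int (en u) * ?\<beta> x" for x and u :: mode
  define wt where "wt S x = \<Lambda> i0 x + weight (g x) S" for S x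
  have \<Lambda>_dual: "\<Lambda> i0 \<in> L.dual_on cartan" and \<Lambda>_coroot: "i \<le> n \<Longrightarrow> \<Lambda> i0 (coroot i) = (if i = i0 then 1 else 0)" for i
    using \<Lambda> i0 unfolding L.fundamental_weights_def by auto
  have odd_g: "odd_fun (g x)" for x
    unfolding odd_fun_def g_def by (simp add: signed_exponent_def en_def bar_def algebra_simps)
  have g_root: "g x (aa n i, r) + g x (bb n i, mm i + p - r) = \<alpha> i x" if "i \<le> n" for i r x
    unfolding simple_root_eq[OF n that, of \<alpha> x] by (simp add: g_def en_def algebra_simps)
  have diag_wt: "diagop (\<lambda>S. wt S x) y = pscale (\<Lambda> i0 x) y + diagop (weight (g x)) y" for x y
    by (rule poly_mapping_eqI) (simp add: wt_def lookup_add algebra_simps)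
  have mon: "monomial_exponent ?\<gamma> ?\<beta> (weight cexp S) (weight en S) x = weight (g x) S" if S: "S \<in> states" for S x
  proof -
    have all: "S \<in> all_states" using S by (auto simp: states_def all_states_def)
    have "(\<Sum>k=1..n. of_int (lookup (weight cexp S) k) * ?\<gamma> k x) =
        (\<Sum>k=1..n. \<Sum>u\<in>fset S. of_int (lookup (cexp u) k) * ?\<gamma> k x)"
      by (simp add: weight_def Poly_Mapping.lookup_sum sum_distrib_right)
    also have "\<dots> = (\<Sum>u\<in>fset S. \<Sum>k=1..n. of_int (lookup (cexp u) k) * ?\<gamma> k x)"
      by (rule sum.swap)
    also have "\<dots> = (\<Sum>u\<in>fset S. signed_exponent ?\<gamma> (fst u) x)"
    proof (rule sum.cong)
      fix u assume "u \<in> fset S"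
      then have u: "fst (fst u) \<in> {1..n}" using S by (auto simp: states_def)
      have "(\<Sum>k=1..n. of_int (lookup (cexp u) k) * ?\<gamma> k x) =
          (\<Sum>k=1..n. if k = fst (fst u) then signed_exponent ?\<gamma> (fst u) x else 0)"
        by (rule sum.cong) (auto simp: cexp_def lookup_single when_def signed_exponent_def)
      then show "(\<Sum>k=1..n. of_int (lookup (cexp u) k) * ?\<gamma> k x) = signed_exponent ?\<gamma> (fst u) x"
        using u by simp
    qed simp
    finally show ?thesis
      unfolding A.monomial_exponent_eq[OF keys_sum_cexp[OF all]]
      by (simp add: g_def weight_def sum.distrib sum_distrib_right)
  qed
  have wt_mon: "wt S = \<Lambda> i0 + monomial_exponent ?\<gamma> ?\<beta> (weight cexp S) (weight en S)" if "S \<in> states" for S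
    by (rule ext) (simp add: wt_def mon[OF that])
  have wt_dual: "wt S \<in> L.dual_on cartan" if S: "S \<in> states" for S
  proof -
    have u: "fst (fst u) \<in> {1..n}" if "u \<in> fset S" for u using S that by (auto simp: states_def)
    have "(\<lambda>x. (if snd (fst u) then 1 else - 1) * ?\<gamma> (fst (fst u)) x + of_int (en u) * ?\<beta> x) \<in> L.dual_on cartan"
      if "u \<in> fset S" for u
      by (intro L.dual_on_add L.dual_on_mult A.c_exponent_dual A.q_exponent_dual u that)
    then have "(\<lambda>x. g x u) \<in> L.dual_on cartan" if "u \<in> fset S" for u
      using that by (simp add: g_def signed_exponent_def if_distrib[of "\<lambda>c. c * _"] cong: if_cong)
    then have "(\<lambda>x. \<Lambda> i0 x + (\<Sum>u\<in>fset S. g x u)) \<in> L.dual_on cartan"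
      by (intro L.dual_on_add L.dual_on_sum \<Lambda>_dual)
    moreover have "wt S = (\<lambda>x. \<Lambda> i0 x + (\<Sum>u\<in>fset S. g x u))"
      by (rule ext) (simp add: wt_def weight_def)
    ultimately show ?thesis by (simp only:)
  qed
  have wt_coroot: "wt S (coroot i) = weight (colour_charge (aa n i)) S + weight (colour_charge (bb n i)) S + of_int (const i)"
    if i: "i \<le> n" and S: "S \<in> states" for i S
  proof -
    have "weight (g (coroot i)) S = (\<Sum>u\<in>fset S. colour_charge (aa n i) u + colour_charge (bb n i) u)"
      unfolding weight_def
    proof (rule sum.cong)
      fix u assume "u \<in> fset S"
      then have u: "fst (fst u) \<in> {1..n}" using S by (auto simp: states_def)
      have cc: "of_int (colour_charge c u) = (colour_charge c u :: complex)" for c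
        by (simp add: colour_charge_def)
      show "g (coroot i) u = colour_charge (aa n i) u + colour_charge (bb n i) u"
        using A.signed_exponent_coroot[OF i u, of "snd u"]
        by (simp add: g_def A.q_exponent_coroot[OF i] cc)
    qed simp
    then show ?thesis by (simp add: wt_def weight_def sum.distrib \<Lambda>_coroot[OF i] const[OF i])
  qed
  have dim: "L.V.dim (L.weight_space \<nu>) = card {S \<in> states. wt S = \<nu>}" if \<nu>: "\<nu> \<in> L.dual_on cartan" for \<nu>
  proof (rule L.dim_weight_space[where E = E and F = F and vac = vac])
    fix i j :: nat and x :: fock
    assume ij: "i \<in> {0..n}" "j \<in> {0..n}" and x: "keys x \<subseteq> states"
    have xf: "x \<in> fockspace" using x by (intro fock_even_fockspace) (simp add: fock_even_def)
    have "diagop (weight (colour_charge (aa n i))) x + diagop (weight (colour_charge (bb n i))) x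
        + pscale (of_int (const i)) x = diagop (\<lambda>S. wt S (coroot i)) x"
    proof (rule poly_mapping_eqI)
      fix S
      show "lookup (diagop (weight (colour_charge (aa n i))) x + diagop (weight (colour_charge (bb n i))) x
        + pscale (of_int (const i)) x) S = lookup (diagop (\<lambda>S. wt S (coroot i)) x) S"
      proof (cases "S \<in> keys x")
        case True
        then have "S \<in> states" using x by blast
        then show ?thesis using wt_coroot[of i S] ij by (simp add: lookup_add algebra_simps)
      next
        case False
        then show ?thesis by (simp add: in_keys_iff lookup_add)
      qed
    qed
    then show "E i (F j x) = F j (E i x) + (if i = j then diagop (\<lambda>S. wt S (coroot i)) x else 0)"
      using E_F_comm_eq[OF _ xf, of i] E_F_comm_neq[of i j x] ij by (cases "i = j") (auto simp: add.assoc)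
  next
    fix i x and y :: fock assume i: "i \<in> {0..n}"
    then have "diagop (weight (g x)) (F i y) = F i (diagop (weight (g x)) y) - pscale (\<alpha> i x) (F i y)"
      using g_root by (intro diagop_F odd_g) auto
    then show "diagop (\<lambda>S. wt S x) (F i y) = F i (diagop (\<lambda>S. wt S x) y) - pscale (\<alpha> i x) (F i y)"
      using i by (simp add: diag_wt additive_op_add[OF additive_op_F] F_pscale)
  next
    fix i and x :: fock assume i: "i \<in> {0..n}" and x: "keys x \<subseteq> states"
    show "keys (F i x) \<subseteq> states"
      using F_fock_even[of i x] i x by (simp add: fock_even_def)
    \<comment> \<open>Reaching the vacuum by a lowering step would require a state of
      \<open>ht\<close> equal to 2, whereas all states have nonpositive \<open>ht\<close>.\<close>
    show "lookup (F i x) vac = 0"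
    proof (rule ccontr)
      assume "lookup (F i x) vac \<noteq> 0"
      then have v: "vac \<in> keys (F i x)" by (simp add: in_keys_iff)
      have i': "i \<le> n" using i by simp
      obtain S' where "S' \<in> keys x" "weight ht vac = - 2 + weight ht S'"
        by (rule F_weight[OF odd_ht i' ht_E[OF i'] v])
      then show False using x weight_ht_nonpos[of S'] by auto
    qed
  next
    fix W :: "fock set" and S
    assume W: "F.subspace W" "single vac 1 \<in> W" and S: "S \<in> states"
      and WF: "\<And>i x. i \<in> {0..n} \<Longrightarrow> x \<in> W \<Longrightarrow> F i x \<in> W"
    have "fword v \<in> W" if "set v \<subseteq> {0..n}" for v
      using that by (induction v) (auto intro: W(2) WF)
    then have "F.span {fword v |v. set v \<subseteq> {0..n}} \<subseteq> W"
      using W(1) by (intro F.span_minimal) auto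
    then show "single S 1 \<in> W" using fock_cyclic[OF S] by blast
  next
    fix x :: fock
    assume "keys x \<subseteq> states"
      and "\<And>v. set v \<subseteq> {0..n} \<Longrightarrow> lookup (foldr E v x) vac = 0"
    then show "x = 0" by (intro fock_nondegenerate) (auto simp: fock_even_def)
  qed (use \<nu> in \<open>auto simp: vac_in_states additive_op_E additive_op_F E_pscale F_pscale E_vac wt_def wt_dual\<close>)
  show ?thesis
  proof (rule ext)
    fix \<mu>
    let ?m = "\<lambda>S. monomial_exponent ?\<gamma> ?\<beta> (weight cexp S) (weight en S)"
    have iff: "wt S = \<mu> + \<Lambda> i0 \<longleftrightarrow> ?m S = \<mu>" if "S \<in> states" for S
      unfolding wt_mon[OF that] by (metis add.commute add_left_imp_eq)
    have "L.ch (\<mu> + \<Lambda> i0) = int (card {S \<in> states. ?m S = \<mu>})"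
    proof (cases "\<mu> + \<Lambda> i0 \<in> L.dual_on cartan")
      case True
      have "{S \<in> states. wt S = \<mu> + \<Lambda> i0} = {S \<in> states. ?m S = \<mu>}" using iff by blast
      then show ?thesis using True dim[OF True] by (simp add: L.ch_def)
    next
      case False
      then have "{S \<in> states. ?m S = \<mu>} = {}" using iff wt_dual by force
      then show ?thesis using False by (simp only: L.ch_def if_False card.empty of_nat_0)
    qed
    moreover have "to_exponentials ?\<gamma> ?\<beta> (even_part {1..n} fermion_product) \<mu> = int (card {S \<in> states. ?m S = \<mu>})"
      by (rule to_exponentials_fermion_product[OF A.monomial_exponent_inj])
    ultimately show "exp_times (- \<Lambda> i0) L.ch \<mu> =
        to_exponentials ?\<gamma> ?\<beta> (even_part {1..n} fermion_product) \<mu>"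
      by (simp add: exp_times_def del: One_nat_def)
  qed
qed

end

text \<open>Dominance pins the middle charges to 0 from both ends of the diagram. It leaves one
  alternative at an outer index, the charge of the partner vacuum, which the parity condition rules
  out.\<close>

lemma dominant_level_one:
  fixes N c :: "nat \<Rightarrow> int"
  assumes n: "4 \<le> n" and even: "even (\<Sum>k=1..n. N k)"
    and c: "\<And>i. c i = (if i = i0 then 1 else 0)" "i0 \<in> {0, 1, n - 1, n}"
    and chain: "\<And>i. 1 \<le> i \<Longrightarrow> i \<le> n - 1 \<Longrightarrow> 0 \<le> c i + N i - N (Suc i)"
    and last: "0 \<le> c n + N (n - 1) + N n" and first: "0 \<le> c 0 - N 1 - N 2"
    and k: "k \<in> {1..n}"
  shows "N k = 0"
proof -
  have mono: "N j \<le> N i" if "2 \<le> i" "i \<le> j" "j \<le> n - 1" for i j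
    using that(2,3)
  proof (induction j rule: dec_induct)
    case (step j)
    then have "j \<noteq> i0" using c(2) that(1) by auto
    then show ?case using step chain[of j] c(1)[of j] that(1) by simp
  qed simp
  have n1: "Suc (n - 1) = n" using n by simp
  have sum_c: "c (n - 1) + c n \<le> 1" "c 0 + c 1 \<le> 1" using n by (auto simp: c(1))
  have n2: "1 \<le> n - 1" using n by simp
  note upper = chain[OF le_refl n2, unfolded Suc_1]
  note lower = chain[OF n2 le_refl, unfolded n1]
  \<comment> \<open>Adding the inequalities at the nodes n-1 and n gives
    \<open>2 * N (n - 1) \<ge> - 1\<close>; integrality improves this to 0. The bound on
    \<open>N 2\<close> arises in the same way from the nodes 0 and 1.\<close>
  have "0 \<le> N (n - 1)" using lower last sum_c(1) by linarith
  moreover have "N (n - 1) \<le> N 2" using mono[of 2 "n - 1"] n by simp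
  moreover have "N 2 \<le> 0" using upper first sum_c(2) by linarith
  ultimately have N2: "N 2 = 0" "N (n - 1) = 0" by auto
  have mid: "N j = 0" if "2 \<le> j" "j \<le> n - 1" for j
    using mono[of 2 j] mono[of j "n - 1"] that N2 by simp
  have "(\<Sum>k=1..n. N k) = (\<Sum>k\<in>{1, n}. N k)"
  proof (rule sum.mono_neutral_right)
    show "\<forall>j\<in>{1..n} - {1, n}. N j = 0"
    proof
      fix j assume "j \<in> {1..n} - {1, n}"
      then have "2 \<le> j" "j \<le> n - 1" by auto
      then show "N j = 0" by (rule mid)
    qed
  qed (use n in auto)
  then have ev: "even (N 1 + N n)" using even n by simp
  \<comment> \<open>As \<open>c\<close> is 1 at a single end node, at most one of the two charges
    can be nonzero, and then it is 1 or -1; an even total excludes this.\<close>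
  have "- c 1 \<le> N 1" "N 1 \<le> c 0" "- c n \<le> N n" "N n \<le> c (n - 1)"
    using upper first last lower N2 by auto
  then have "N 1 = 0 \<and> N n = 0"
    using c(2) ev n unfolding c(1) by (elim insertE) (auto, presburger+)
  then show ?thesis
    using mid[of k] k by (cases "k = 1"; cases "k = n") auto
qed

text \<open>The height of a mode grows with its index, so the condition is tested only at the top
  creation mode \<open>\<theta> a - 1\<close>.\<close>

lemma D_fockI:
  assumes n: "4 \<le> n" and bar: "\<And>a. \<theta> (bar a) = p + 1 - \<theta> a"
    and const: "\<And>i. i \<le> n \<Longrightarrow> mm i + p + 1 - \<theta> (aa n i) - \<theta> (bb n i) = (if i = i0 then 1 else 0)"
    and i0: "i0 \<in> {0, 1, n - 1, n}"
    and height: "\<And>a. fst a \<in> {1..n} \<Longrightarrow>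
      2 * (int n - int (fst a)) * (if snd a then 1 else - 1) + (2 * (\<theta> a - 1) - p) * (2 * int n - 2) \<le> 0"
    and energy: "\<And>a. fst a \<in> {1..n} \<Longrightarrow> 2 * \<theta> a \<le> p + 3"
  shows "D_fock p \<theta> n"
proof
  show "mm i + p + 1 - \<theta> (aa n i) - \<theta> (bb n i) \<in> {0, 1}" if "i \<le> n" for i
    using const[OF that] by simp
next
  fix N :: "nat \<Rightarrow> int" and k
  assume ev: "even (\<Sum>k=1..n. N k)" and k: "k \<in> {1..n}"
    and dom: "\<forall>i\<le>n. 0 \<le> mm i + p + 1 - \<theta> (aa n i) - \<theta> (bb n i)
        + (if snd (aa n i) then N (fst (aa n i)) else - N (fst (aa n i)))
        + (if snd (bb n i) then N (fst (bb n i)) else - N (fst (bb n i)))"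
  define c :: "nat \<Rightarrow> int" where "c i = (if i = i0 then 1 else 0)" for i
  have dom': "0 \<le> c i
        + (if snd (aa n i) then N (fst (aa n i)) else - N (fst (aa n i)))
        + (if snd (bb n i) then N (fst (bb n i)) else - N (fst (bb n i)))" if "i \<le> n" for i
    using dom[rule_format, OF that] unfolding const[OF that] c_def .
  show "N k = 0"
  proof (rule dominant_level_one[OF n ev c_def i0 _ _ _ k])
    show "0 \<le> c i + N i - N (Suc i)" if "1 \<le> i" "i \<le> n - 1" for i
    proof -
      have "i \<le> n" "i \<noteq> 0" "i \<noteq> n" using that n by auto
      then show ?thesis using dom'[of i] by (simp add: aa_def bb_def)
    qed
    show "0 \<le> c n + N (n - 1) + N n"
      using dom'[of n] n by (simp add: aa_def bb_def split: if_splits)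
    show "0 \<le> c 0 - N 1 - N 2"
      using dom'[of 0] by (simp add: aa_def bb_def)
  qed
next
  fix a :: colour and r :: int
  assume a: "fst a \<in> {1..n}" and r: "r < \<theta> a"
  have "(2 * r - p) * (2 * int n - 2) \<le> (2 * (\<theta> a - 1) - p) * (2 * int n - 2)"
    using r n by (intro mult_right_mono) auto
  then show "2 * (int n - int (fst a)) * (if snd a then 1 else - 1) + (2 * r - p) * (2 * int n - 2) \<le> 0"
    using height[OF a] by linarith
qed (use n bar energy in auto)

lemma prod_colours:
  "(\<Prod>c\<in>{1..n} \<times> (UNIV :: bool set). g c) = (\<Prod>k=1..n. g (P k) * g (M k))"
proof -
  have "(\<Prod>c\<in>{1..n} \<times> (UNIV :: bool set). g c) = (\<Prod>k=1..n. \<Prod>s\<in>(UNIV :: bool set). g (k, s))"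
    by (simp only: prod.cartesian_product) (rule prod.cong, auto)
  then show ?thesis by (simp add: UNIV_bool mult.commute)
qed

text \<open>The choices of \<open>\<theta>\<close> are read off from the first factors of the
  products: the top mode of colour \<open>c\<close> has q-exponent
  \<open>p + 2 - 2 * \<theta> c\<close>. For \<open>p = 1\<close> this is 1, or 3 and -1 at index 1;
  for \<open>p = 0\<close> it is 2 and 0, interchanged at index n in the third case. The node
  carrying the value 1 is then 0, 1, n-1 and n respectively.\<close>

lemma D_fock_cases:
  assumes n: "4 \<le> n"
  shows "D_fock 1 (\<lambda>_. 1) n"
    and "D_fock 1 (\<lambda>c. if c = P 1 then 0 else if c = M 1 then 2 else 1) n"
    and "D_fock 0 (\<lambda>c. if fst c = n then if snd c then 1 else 0 else if snd c then 0 else 1) n"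
    and "D_fock 0 (\<lambda>c. if snd c then 0 else 1) n"
proof -
  show "D_fock 1 (\<lambda>_. 1) n"
    by (rule D_fockI[OF n, where ?i0.0 = 0]) (auto simp: mm_def)
  show "D_fock 1 (\<lambda>c. if c = P 1 then 0 else if c = M 1 then 2 else 1) n"
    by (rule D_fockI[OF n, where ?i0.0 = 1]) (use n in \<open>auto simp: mm_def aa_def bb_def algebra_simps\<close>)
  show "D_fock 0 (\<lambda>c. if fst c = n then if snd c then 1 else 0 else if snd c then 0 else 1) n"
    by (rule D_fockI[OF n, where ?i0.0 = "n - 1"]) (use n in \<open>auto simp: mm_def aa_def bb_def algebra_simps\<close>)
  show "D_fock 0 (\<lambda>c. if snd c then 0 else 1) n"
    by (rule D_fockI[OF n, where ?i0.0 = n]) (use n in \<open>auto simp: mm_def aa_def bb_def algebra_simps\<close>)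
qed

lemma colour_smono:
  "smono (cexp (P k, 0)) b = c_var k * smono 0 b" "smono (cexp (M k, 0)) b = c_var_inv k * smono 0 b"
  by (simp_all add: cexp_def c_var_smono smono_mult)

theorem theorem1p6:
  fixes n :: nat
    and scale :: "complex \<Rightarrow> 'g::ab_group_add \<Rightarrow> 'g"
    and bracket :: "'g \<Rightarrow> 'g \<Rightarrow> 'g"
    and cartan :: "'g set"
    and e f coroot :: "nat \<Rightarrow> 'g"
    and \<alpha> \<Lambda> :: "nat \<Rightarrow> 'g \<Rightarrow> complex"
    and scaleV :: "complex \<Rightarrow> 'v::ab_group_add \<Rightarrow> 'v"
    and act :: "'g \<Rightarrow> 'v \<Rightarrow> 'v"
  defines "is_L \<equiv> irreducible_highest_weight_module scale bracket {0..n} (D1_cartan_matrix n)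
                    cartan e f coroot \<alpha> scaleV act"
    and "ch \<equiv> kac_moody_module.ch scale cartan scaleV act"
    and "expand \<equiv> to_exponentials (c_exponent n \<alpha>) (q_exponent n \<alpha>)"
    and "E \<equiv> even_part {1..n}"
    and "poch \<equiv> qpochhammer_inf"
  assumes n: "n \<ge> 4"
    and g: "kac_moody_algebra scale bracket {0..n} (D1_cartan_matrix n) cartan e f coroot \<alpha>"
    and \<Lambda>: "kac_moody_algebra.fundamental_weights scale {0..n} cartan coroot \<Lambda>"
  shows
    "(is_L (\<Lambda> 0) \<longrightarrow>
        exp_times (- \<Lambda> 0) ch =
        expand (E (\<Prod>k=1..n. poch (- c_var k * q_var) (q_var\<^sup>2) * poch (- c_var_inv k * q_var) (q_var\<^sup>2)))) \<and>
     (is_L (\<Lambda> 1) \<longrightarrow>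
        exp_times (- \<Lambda> 1) ch =
        expand (E (poch (- c_var 1 * q_var ^ 3) (q_var\<^sup>2) * poch (- c_var_inv 1 * q_var_inv) (q_var\<^sup>2) *
                   (\<Prod>k=2..n. poch (- c_var k * q_var) (q_var\<^sup>2) * poch (- c_var_inv k * q_var) (q_var\<^sup>2))))) \<and>
     (is_L (\<Lambda> (n - 1)) \<longrightarrow>
        exp_times (- \<Lambda> (n - 1)) ch =
        expand (E (poch (- c_var n) (q_var\<^sup>2) * poch (- c_var_inv n * q_var\<^sup>2) (q_var\<^sup>2) *
                   (\<Prod>k=1..n-1. poch (- c_var k * q_var\<^sup>2) (q_var\<^sup>2) * poch (- c_var_inv k) (q_var\<^sup>2))))) \<and>
     (is_L (\<Lambda> n) \<longrightarrow>
        exp_times (- \<Lambda> n) ch =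
        expand (E (poch (- c_var n * q_var\<^sup>2) (q_var\<^sup>2) * poch (- c_var_inv n) (q_var\<^sup>2) *
                   (\<Prod>k=1..n-1. poch (- c_var k * q_var\<^sup>2) (q_var\<^sup>2) * poch (- c_var_inv k) (q_var\<^sup>2)))))"
proof -
  let ?th1 = "\<lambda>c. if c = P 1 then 0 else if c = M 1 then 2 else 1 :: int"
  let ?th2 = "\<lambda>c. if fst c = n then if snd c then 1 else 0 else if snd c then 0 else 1 :: int"
  let ?th3 = "\<lambda>c. if snd c then 0 else 1 :: int"
  interpret D0: D_fock 1 "\<lambda>_. 1" n by (rule D_fock_cases[OF n])
  interpret D1: D_fock 1 ?th1 n by (rule D_fock_cases[OF n])
  interpret D2: D_fock 0 ?th2 n by (rule D_fock_cases[OF n])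
  interpret D3: D_fock 0 ?th3 n by (rule D_fock_cases[OF n])
  have q: "smono 0 1 = q_var" "smono 0 3 = q_var ^ 3" "smono 0 (- 1) = q_var_inv" "smono 0 2 = q_var\<^sup>2" "smono 0 0 = 1"
    by (simp_all add: q_var_smono smono_power smono_0)
  have pn: "(\<Prod>k=1..n. g k) = g n * (\<Prod>k=1..n-1. g k)" for g :: "nat \<Rightarrow> series"
  proof -
    have "{1..n} = insert n {1..n-1}" using n by auto
    then show ?thesis using n by simp
  qed
  have p1: "(\<Prod>k=1..n. g k) = g 1 * (\<Prod>k=2..n. g k)" for g :: "nat \<Rightarrow> series"
  proof -
    have "{1..n} = insert 1 {2..n}" using n by auto
    then show ?thesis by simp
  qed
  have f0: "D0.fermion_product =
      (\<Prod>k=1..n. poch (- c_var k * q_var) (q_var\<^sup>2) * poch (- c_var_inv k * q_var) (q_var\<^sup>2))"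
    unfolding D0.fermion_product_def prod_colours poch_def by (simp add: colour_smono q)
  have f1: "D1.fermion_product =
      poch (- c_var 1 * q_var ^ 3) (q_var\<^sup>2) * poch (- c_var_inv 1 * q_var_inv) (q_var\<^sup>2) *
        (\<Prod>k=2..n. poch (- c_var k * q_var) (q_var\<^sup>2) * poch (- c_var_inv k * q_var) (q_var\<^sup>2))"
    unfolding D1.fermion_product_def prod_colours poch_def p1
    by (intro arg_cong2[where f = "(*)"] prod.cong) (auto simp: colour_smono q)
  have f2: "D2.fermion_product =
      poch (- c_var n) (q_var\<^sup>2) * poch (- c_var_inv n * q_var\<^sup>2) (q_var\<^sup>2) *
        (\<Prod>k=1..n-1. poch (- c_var k * q_var\<^sup>2) (q_var\<^sup>2) * poch (- c_var_inv k) (q_var\<^sup>2))"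
    unfolding D2.fermion_product_def prod_colours poch_def pn
    by (intro arg_cong2[where f = "(*)"] prod.cong) (auto simp: colour_smono q)
  have f3: "D3.fermion_product =
      poch (- c_var n * q_var\<^sup>2) (q_var\<^sup>2) * poch (- c_var_inv n) (q_var\<^sup>2) *
        (\<Prod>k=1..n-1. poch (- c_var k * q_var\<^sup>2) (q_var\<^sup>2) * poch (- c_var_inv k) (q_var\<^sup>2))"
    unfolding D3.fermion_product_def prod_colours poch_def pn
    by (intro arg_cong2[where f = "(*)"] prod.cong) (auto simp: colour_smono q)
  show ?thesis
    unfolding is_L_def ch_def expand_def E_def f0[symmetric] f1[symmetric] f2[symmetric] f3[symmetric]
  proof (intro conjI impI)
    show "exp_times (- \<Lambda> 0) (kac_moody_module.ch scale cartan scaleV act) =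
        to_exponentials (c_exponent n \<alpha>) (q_exponent n \<alpha>) (even_part {1..n} D0.fermion_product)"
      if "irreducible_highest_weight_module scale bracket {0..n} (D1_cartan_matrix n)
        cartan e f coroot \<alpha> scaleV act (\<Lambda> 0)"
      by (rule D0.character_formula[OF that \<Lambda>]) (auto simp: D0.const_def mm_def)
    show "exp_times (- \<Lambda> 1) (kac_moody_module.ch scale cartan scaleV act) =
        to_exponentials (c_exponent n \<alpha>) (q_exponent n \<alpha>) (even_part {1..n} D1.fermion_product)"
      if "irreducible_highest_weight_module scale bracket {0..n} (D1_cartan_matrix n)
        cartan e f coroot \<alpha> scaleV act (\<Lambda> 1)"
    proof (rule D1.character_formula[OF that \<Lambda>])
      show "D1.const i = (if i = 1 then 1 else 0)" if "i \<le> n" for i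
        unfolding D1.const_def using n by (auto simp: mm_def aa_def bb_def)
    qed (use n in simp)
    show "exp_times (- \<Lambda> (n - 1)) (kac_moody_module.ch scale cartan scaleV act) =
        to_exponentials (c_exponent n \<alpha>) (q_exponent n \<alpha>) (even_part {1..n} D2.fermion_product)"
      if "irreducible_highest_weight_module scale bracket {0..n} (D1_cartan_matrix n)
        cartan e f coroot \<alpha> scaleV act (\<Lambda> (n - 1))"
      by (rule D2.character_formula[OF that \<Lambda>]) (use n in \<open>auto simp: D2.const_def mm_def aa_def bb_def\<close>)
    show "exp_times (- \<Lambda> n) (kac_moody_module.ch scale cartan scaleV act) =
        to_exponentials (c_exponent n \<alpha>) (q_exponent n \<alpha>) (even_part {1..n} D3.fermion_product)"
      if "irreducible_highest_weight_module scale bracket {0..n} (D1_cartan_matrix n)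
        cartan e f coroot \<alpha> scaleV act (\<Lambda> n)"
      by (rule D3.character_formula[OF that \<Lambda>]) (use n in \<open>auto simp: D3.const_def mm_def aa_def bb_def\<close>)
  qed
qed

end
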